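(* For all $\nu\in\Lambda_G\subset\mathcal N_G$ there is an equality $$d_G(\nu)=\tfrac12\,\mathrm{def}_G(\nu).$$ In particular $d_G(\nu)\in\tfrac12\mathbb Z$.
   Context: $G$ is a split connected reductive group with simply connected derived group $G_{\mathrm{sc}}$; $A\subset B$ are a split maximal torus and a Borel subgroup; $W$ is the Weyl group of $A$ in $G$; $n=\dim A$; $D=G/G_{\mathrm{sc}}$; $A_{\mathrm{sc}}=A\cap G_{\mathrm{sc}}$. $\alpha_1,\dots,\alpha_l$ are the simple roots, $\alpha_1^\vee,\dots,\alpha_l^\vee$ the simple coroots (a $\mathbb Z$-basis of $X_*(A_{\mathrm{sc}})$), $\varpi_1,\dots,\varpi_l\in X^*(A_{\mathrm{sc}})$ the dual basis (fundamental weights). For $1\le i\le l$, $\omega_i\in X^*(A)$ is a chosen extension of $\varpi_i$ to $A$. $\mathfrak a=X_*(A)\otimes\mathbb R$. $\mathfrak a_G=\{x\in\mathfrak a:\langle\alpha_i,x\rangle=0\text{ for all }i\}$, and $p_G:\mathfrak a\to\mathfrak a_G$ is the projection along the span of the simple coroots. $\Lambda_G$ is the quotient of $X_*(A)$ by the coroot lattice of $G$, identified with the lattice $p_G(X_*(A))\subset\mathfrak a_G$. (It is contained in the set $\mathcal N_G=\coprod_P\Lambda_P^+$, the union over standard parabolics $P=MN\supset B$ of the sets $\Lambda_P^+$ defined in the same way: $\Lambda_P^+$ is the set of elements $x$ of $p_M(X_*(A))\subset\mathfrak a_M$ with $\langle\alpha,x\rangle>0$ for every simple root $\alpha$ occurring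 in $\mathrm{Lie}(N)$, where $\mathfrak a_M$ is the subspace killed by the simple roots of $M$ and $p_M$ is projection onto it along the span of the simple coroots of $M$.) The function $d_G:\mathcal N_G\to\mathbb Q$ is $d_G(\nu)=\sum_{i=1}^l\mathrm{fr}\langle\omega_i,\nu\rangle$, where $\mathrm{fr}(t)=t-[t]\in[0,1)$ is the fractional part of $t$; it is independent of the choice of the extensions $\omega_i$. Defect: let $\tilde W=X_*(A)\rtimes W$ be the extended affine Weyl group, acting on $\mathfrak a$ ($X_*(A)$ by translations, $W$ linearly). Let $p:\tilde W\to W$ be the canonical surjection and $q:\tilde W\to\Lambda_G$ the homomorphism trivial on $W$ and equal to the canonical surjection $X_*(A)\to\Lambda_G$ on $X_*(A)$. The subgroup of $\tilde W$ of elements preserving the base alcove in $\mathfrak a$ (the connected component, lying in the dominant chamber and having $0$ in its closure, of the complement of all the affine root hyperplanes $\langle\alpha,x\rangle=m$, $\alpha$ a root, $m\in\mathbb Z$), equivalently the set of simple affine roots, is mapped isomorphically to $\Lambda_G$ by $q$; inverting this isomorphism gives a homomorphism $s:\Lambda_G\to\tilde W$ with $qs=\mathrm{id}$. For $\nu\in\Lambda_G$ put $w_\nu=ps(\nu)\in W$ and $$\mathrm{def}_G(\nu)=\dim\mathfrak a-\dim\mathfrak a^{w_\nu},$$ where $\mathfrak a^{w}$ is the set of fixed points of $w$ in $\mathfrak a$. *)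

theory Defs
  imports "HOL-Analysis.Analysis"
begin

text \<open>
  A split connected reductive group with a Borel pair enters through its based root datum.
  The type \<^typ>\<open>'v\<close> is the real vector space \<open>\<aa> = X\<^sub>*(A) \<otimes> \<real>\<close>; it is finite-dimensional by
  \<open>full_lattice\<close> below, possibly of dimension 0, and its norm only serves to provide the (unique) vector
  space topology.  Since every linear form on \<open>\<aa>\<close> is then bounded, \<open>'v \<Rightarrow>\<^sub>L real\<close> is the full
  dual space \<open>X\<^sup>*(A) \<otimes> \<real>\<close>, and application of a form to a vector is the canonical pairing.

  The simple roots are \<open>simple_root D i\<close> for \<open>1 \<le> i \<le> ss_rank D\<close>; values at other indices are
  irrelevant, and so are values of \<open>coroot D\<close> outside \<open>roots D\<close>.
\<close>

record (overloaded) 'v based_root_datum =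
  cochars :: "'v set"
  roots :: "('v \<Rightarrow>\<^sub>L real) set"
  coroot :: "('v \<Rightarrow>\<^sub>L real) \<Rightarrow> 'v"
  ss_rank :: nat
  simple_root :: "nat \<Rightarrow> ('v \<Rightarrow>\<^sub>L real)"

text \<open>Only used for finite \<open>S\<close>.\<close>

definition int_span :: "'a::real_vector set \<Rightarrow> 'a set" where
  "int_span S = {\<Sum>s\<in>S. of_int (c s) *\<^sub>R s | c :: 'a \<Rightarrow> int. True}"

definition full_lattice :: "'a::real_vector set \<Rightarrow> bool" where
  "full_lattice L \<longleftrightarrow> (\<exists>B. finite B \<and> independent B \<and> span B = UNIV \<and> L = int_span B)"

definition chars :: "('v::real_normed_vector, 'm) based_root_datum_scheme \<Rightarrow> ('v \<Rightarrow>\<^sub>L real) set" where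
  "chars D = {f :: 'v \<Rightarrow>\<^sub>L real. \<forall>x\<in>cochars D. f x \<in> \<int>}"

definition coroots :: "('v::real_normed_vector, 'm) based_root_datum_scheme \<Rightarrow> 'v set" where
  "coroots D = coroot D ` roots D"

definition simple_coroot :: "('v::real_normed_vector, 'm) based_root_datum_scheme \<Rightarrow> nat \<Rightarrow> 'v" where
  "simple_coroot D i = coroot D (simple_root D i)"

definition reflection ::
  "('v::real_normed_vector, 'm) based_root_datum_scheme \<Rightarrow> ('v \<Rightarrow>\<^sub>L real) \<Rightarrow> 'v \<Rightarrow> 'v" where
  "reflection D \<alpha> x = x - \<alpha> x *\<^sub>R coroot D \<alpha>"

definition dual_reflection ::
  "('v::real_normed_vector, 'm) based_root_datum_scheme \<Rightarrow> ('v \<Rightarrow>\<^sub>L real) \<Rightarrow> ('v \<Rightarrow>\<^sub>L real) \<Rightarrow> ('v \<Rightarrow>\<^sub>L real)" where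
  "dual_reflection D \<alpha> f = f - f (coroot D \<alpha>) *\<^sub>R \<alpha>"

definition reduced_root_datum :: "('v::real_normed_vector, 'm) based_root_datum_scheme \<Rightarrow> bool" where
  "reduced_root_datum D \<longleftrightarrow>
     full_lattice (cochars D) \<and>
     finite (roots D) \<and> roots D \<subseteq> chars D \<and>
     coroots D \<subseteq> cochars D \<and> inj_on (coroot D) (roots D) \<and>
     (\<forall>\<alpha>\<in>roots D. \<alpha> (coroot D \<alpha>) = 2) \<and>
     (\<forall>\<alpha>\<in>roots D. dual_reflection D \<alpha> ` roots D = roots D) \<and>
     (\<forall>\<alpha>\<in>roots D. reflection D \<alpha> ` coroots D = coroots D) \<and>
     (\<forall>\<alpha>\<in>roots D. 2 *\<^sub>R \<alpha> \<notin> roots D)"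

text \<open>The base attached to the Borel subgroup \<open>B\<close>.\<close>

definition simple_system :: "('v::real_normed_vector, 'm) based_root_datum_scheme \<Rightarrow> bool" where
  "simple_system D \<longleftrightarrow>
     simple_root D ` {1..ss_rank D} \<subseteq> roots D \<and>
     inj_on (simple_root D) {1..ss_rank D} \<and>
     independent (simple_root D ` {1..ss_rank D}) \<and>
     (\<forall>\<alpha>\<in>roots D. \<exists>c :: nat \<Rightarrow> nat.
        \<alpha> = (\<Sum>i=1..ss_rank D. of_nat (c i) *\<^sub>R simple_root D i) \<or>
        \<alpha> = - (\<Sum>i=1..ss_rank D. of_nat (c i) *\<^sub>R simple_root D i))"

text \<open>
  The maximal torus \<open>A \<inter> G\<^sub>d\<^sub>e\<^sub>r\<close> of the derived group has cocharacter lattice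
  \<open>X\<^sub>*(A) \<inter> span \<Phi>\<^sup>\<or>\<close>; the derived group is simply connected iff this is the coroot lattice.
\<close>

definition simply_connected_derived_group ::
  "('v::real_normed_vector, 'm) based_root_datum_scheme \<Rightarrow> bool" where
  "simply_connected_derived_group D \<longleftrightarrow> cochars D \<inter> span (coroots D) = int_span (coroots D)"

text \<open>
  A character \<open>\<omega>\<^sub>i\<close> of \<open>A\<close> restricts to the fundamental weight \<open>\<varpi>\<^sub>i\<close> of \<open>A\<^sub>s\<^sub>c\<close> iff it pairs with the
  basis \<open>\<alpha>\<^sub>j\<^sup>\<or>\<close> of \<open>X\<^sub>*(A\<^sub>s\<^sub>c)\<close> as \<open>\<varpi>\<^sub>i\<close> does.
\<close>

definition extends_fundamental_weights ::
  "('v::real_normed_vector, 'm) based_root_datum_scheme \<Rightarrow> (nat \<Rightarrow> ('v \<Rightarrow>\<^sub>L real)) \<Rightarrow> bool" where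
  "extends_fundamental_weights D \<omega> \<longleftrightarrow>
     (\<forall>i\<in>{1..ss_rank D}. \<omega> i \<in> chars D \<and>
        (\<forall>j\<in>{1..ss_rank D}. \<omega> i (simple_coroot D j) = (if i = j then 1 else 0)))"

text \<open>
  A standard parabolic subgroup \<open>P = MN\<close> is given by the set \<open>J \<subseteq> {1..l}\<close> of indices of the simple
  roots of \<open>M\<close>; the simple roots occurring in \<open>Lie(N)\<close> are those with index in \<open>{1..l} - J\<close>, and
  \<open>P = G\<close> corresponds to \<open>J = {1..l}\<close>.
\<close>

definition levi_space :: "('v::real_normed_vector, 'm) based_root_datum_scheme \<Rightarrow> nat set \<Rightarrow> 'v set" where
  "levi_space D J = {x. \<forall>j\<in>J. simple_root D j x = 0}"

definition levi_proj :: "('v::real_normed_vector, 'm) based_root_datum_scheme \<Rightarrow> nat set \<Rightarrow> 'v \<Rightarrow> 'v" where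
  "levi_proj D J x = (THE y. y \<in> levi_space D J \<and> x - y \<in> span (simple_coroot D ` J))"

definition Lambda_plus :: "('v::real_normed_vector, 'm) based_root_datum_scheme \<Rightarrow> nat set \<Rightarrow> 'v set" where
  "Lambda_plus D J =
     {x \<in> levi_proj D J ` cochars D. \<forall>i\<in>{1..ss_rank D} - J. simple_root D i x > 0}"

definition Newton_set :: "('v::real_normed_vector, 'm) based_root_datum_scheme \<Rightarrow> 'v set" where
  "Newton_set D = (\<Union>J\<in>Pow {1..ss_rank D}. Lambda_plus D J)"

definition p_G :: "('v::real_normed_vector, 'm) based_root_datum_scheme \<Rightarrow> 'v \<Rightarrow> 'v" where
  "p_G D = levi_proj D {1..ss_rank D}"

definition Lambda_G :: "('v::real_normed_vector, 'm) based_root_datum_scheme \<Rightarrow> 'v set" where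
  "Lambda_G D = p_G D ` cochars D"

definition d_G ::
  "('v::real_normed_vector, 'm) based_root_datum_scheme \<Rightarrow> (nat \<Rightarrow> ('v \<Rightarrow>\<^sub>L real)) \<Rightarrow> 'v \<Rightarrow> real" where
  "d_G D \<omega> = (\<lambda>\<nu>\<in>Newton_set D. \<Sum>i=1..ss_rank D. frac (\<omega> i \<nu>))"

text \<open>
  The Weyl group, through its faithful action on \<open>\<aa>\<close>.  Reflections are involutions, so closing under
  multiplication by reflections yields the group they generate.
\<close>

inductive_set weyl_group :: "('v::real_normed_vector, 'm) based_root_datum_scheme \<Rightarrow> ('v \<Rightarrow> 'v) set"
  for D :: "('v, 'm) based_root_datum_scheme" where
  one: "id \<in> weyl_group D"
| step: "\<alpha> \<in> roots D \<Longrightarrow> w \<in> weyl_group D \<Longrightarrow> reflection D \<alpha> \<circ> w \<in> weyl_group D"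

text \<open>
  Elements of \<open>W\<^sub>e\<^sub>x\<^sub>t = X\<^sub>*(A) \<rtimes> W\<close> are pairs \<open>(\<lambda>, w)\<close>, i.e. translation by \<open>\<lambda>\<close> after \<open>w\<close>, with
  \<open>(\<lambda>, w) (\<mu>, v) = (\<lambda> + w \<mu>, w v)\<close>.  The surjection onto \<open>W\<close> is \<open>snd\<close>, and the homomorphism to
  \<open>\<Lambda>\<^sub>G\<close> that is trivial on \<open>W\<close> and canonical on \<open>X\<^sub>*(A)\<close> is \<open>(\<lambda>, w) \<mapsto> p\<^sub>G \<lambda>\<close>.
\<close>

definition ext_affine_weyl :: "('v::real_normed_vector, 'm) based_root_datum_scheme \<Rightarrow> ('v \<times> ('v \<Rightarrow> 'v)) set" where
  "ext_affine_weyl D = cochars D \<times> weyl_group D"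

definition aff_action :: "'v::real_normed_vector \<times> ('v \<Rightarrow> 'v) \<Rightarrow> 'v \<Rightarrow> 'v" where
  "aff_action g x = fst g + snd g x"

definition kottwitz_hom ::
  "('v::real_normed_vector, 'm) based_root_datum_scheme \<Rightarrow> 'v \<times> ('v \<Rightarrow> 'v) \<Rightarrow> 'v" where
  "kottwitz_hom D g = p_G D (fst g)"

definition regular_points :: "('v::real_normed_vector, 'm) based_root_datum_scheme \<Rightarrow> 'v set" where
  "regular_points D = UNIV - (\<Union>\<alpha>\<in>roots D. \<Union>m::int. {x. blinfun_apply \<alpha> x = of_int m})"

definition dominant_chamber :: "('v::real_normed_vector, 'm) based_root_datum_scheme \<Rightarrow> 'v set" where
  "dominant_chamber D = {x. \<forall>i\<in>{1..ss_rank D}. simple_root D i x > 0}"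

definition base_alcove :: "('v::real_normed_vector, 'm) based_root_datum_scheme \<Rightarrow> 'v set" where
  "base_alcove D =
     (THE C. C \<in> components (regular_points D) \<and> C \<subseteq> dominant_chamber D \<and> 0 \<in> closure C)"

definition alcove_stabilizer ::
  "('v::real_normed_vector, 'm) based_root_datum_scheme \<Rightarrow> ('v \<times> ('v \<Rightarrow> 'v)) set" where
  "alcove_stabilizer D = {g \<in> ext_affine_weyl D. aff_action g ` base_alcove D = base_alcove D}"

definition alcove_section ::
  "('v::real_normed_vector, 'm) based_root_datum_scheme \<Rightarrow> 'v \<Rightarrow> 'v \<times> ('v \<Rightarrow> 'v)" where
  "alcove_section D = the_inv_into (alcove_stabilizer D) (kottwitz_hom D)"

definition w_of :: "('v::real_normed_vector, 'm) based_root_datum_scheme \<Rightarrow> 'v \<Rightarrow> 'v \<Rightarrow> 'v" where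
  "w_of D \<nu> = snd (alcove_section D \<nu>)"

definition defect :: "('v::real_normed_vector, 'm) based_root_datum_scheme \<Rightarrow> 'v \<Rightarrow> int" where
  "defect D \<nu> = int (dim (UNIV :: 'v set)) - int (dim {x. w_of D \<nu> x = x})"

end

theory Submission
  imports Defs "Jordan_Normal_Form.Determinant"
begin

text \<open>
  Write \<open>e(t) = exp(2\<pi>\<i>t)\<close>.  Let \<open>(\<mu>, u)\<close> be the element of the alcove stabilizer above \<open>\<nu>\<close>.  Since
  \<open>\<nu>\<close> is killed by all roots, the affine map \<open>x \<mapsto> (\<mu> - \<nu>) + u x\<close> also preserves the alcove, and it has a
  fixed point \<open>b\<close> there (\<open>alcove_fixed_point\<close>).  The idea is to read off the eigenvalues of \<open>u\<close> on the
  span \<open>V\<close> of the coroots from the differentials at \<open>b\<close> of the \<open>W\<close>-invariant functions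
  \<open>m\<^sub>i(x) = \<Sum>\<^sub>w e(\<omega>\<^sub>i(w x))\<close>.  Translation by \<open>\<mu> - \<nu>\<close> multiplies \<open>m\<^sub>i\<close> by \<open>e(-\<omega>\<^sub>i(\<nu>))\<close>, because
  \<open>\<omega>\<^sub>i\<close> is integral on the cocharacters \<open>w \<mu>\<close>, and \<open>w \<nu> = \<nu>\<close>.  Differentiating at the fixed point yields
  \<open>dm\<^sub>i(b) \<circ> u = e(-\<omega>\<^sub>i(\<nu>)) dm\<^sub>i(b)\<close> (\<open>orbit_form_eigen\<close>).
  
  If the \<open>l\<close> forms \<open>dm\<^sub>i(b)\<close> are linearly independent on \<open>V\<close>, the eigenvalues of \<open>u\<close> on \<open>V\<close> are therefore
  exactly the numbers \<open>e(-\<omega>\<^sub>i(\<nu>))\<close>.  On the complement of \<open>V\<close> that the roots kill, \<open>u\<close> is the identity, so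
  the defect is the number of \<open>i\<close> with \<open>\<omega>\<^sub>i(\<nu>) \<notin> \<int>\<close> (\<open>fixed_space_codim\<close>).  The operator \<open>u\<close> is real, so
  its eigenvalues are stable under complex conjugation (\<open>eigenvalues_conjugate\<close>), and the fractional parts of
  the \<open>\<omega>\<^sub>i(\<nu>)\<close> and of the \<open>-\<omega>\<^sub>i(\<nu>)\<close> have the same sum.  As \<open>frac t + frac (-t)\<close> is \<open>1\<close> or \<open>0\<close> according
  to whether \<open>t\<close> is not or is an integer, twice that sum is the defect (\<open>sum_frac_eq_half_codim\<close>).
  
  Independence is a statement about the Jacobian determinant of the \<open>m\<^sub>i\<close>, an exponential sum that is
  antisymmetric under \<open>W\<close> with exponents bounded by \<open>\<rho> = \<Sum>\<^sub>i \<omega>\<^sub>i\<close>.  An exponent that is dominant must be regular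
  by antisymmetry, and hence equal to \<open>\<rho>\<close>; so such a sum is determined by its coefficient at \<open>\<rho>\<close>
  (\<open>antisymmetric_eq_0\<close>).  The Jacobian is thus a multiple of the Weyl denominator
  \<open>e\<^sup>\<rho> \<Prod>\<^bsub>\<alpha> > 0\<^esub> (1 - e\<^bsup>-\<alpha>\<^esup>)\<close>, which has no zero off the affine root hyperplanes, and the factor is nonzero
  because only tuples of Weyl group elements that fix every \<open>\<omega>\<^sub>i\<close> contribute to \<open>e\<^sup>\<rho>\<close> (\<open>det_jacobian\<close>).
  
  The same independence shows that the homomorphism from the alcove stabilizer to \<open>\<Lambda>\<^sub>G\<close> is injective
  (\<open>kottwitz_hom_inj\<close>): an element of its kernel has only trivial eigenvalues.  Surjectivity comes from the
  transitivity of the affine Weyl group on the alcoves (\<open>orbit_meets_alcove\<close>).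
\<close>

section \<open>Roots, coroots and reflections\<close>

locale root_datum =
  fixes D :: "'v::real_normed_vector based_root_datum"
  assumes reduced: "reduced_root_datum D"
begin

abbreviation "\<Phi> \<equiv> roots D"
abbreviation "cv \<equiv> coroot D"
abbreviation "reflect \<equiv> reflection D"
abbreviation "coreflect \<equiv> dual_reflection D"
abbreviation "W \<equiv> weyl_group D"
abbreviation winv :: "('v \<Rightarrow> 'v) \<Rightarrow> 'v \<Rightarrow> 'v" where "winv \<equiv> inv_into UNIV"

lemma finite_roots: "finite \<Phi>"
  and roots_chars: "\<alpha> \<in> \<Phi> \<Longrightarrow> \<alpha> \<in> chars D"
  and coroot_cochars: "\<alpha> \<in> \<Phi> \<Longrightarrow> cv \<alpha> \<in> cochars D"
  and root_coroot [simp]: "\<alpha> \<in> \<Phi> \<Longrightarrow> blinfun_apply \<alpha> (cv \<alpha>) = 2"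
  and coreflect_image: "\<alpha> \<in> \<Phi> \<Longrightarrow> coreflect \<alpha> ` \<Phi> = \<Phi>"
  and reflect_image: "\<alpha> \<in> \<Phi> \<Longrightarrow> reflect \<alpha> ` coroots D = coroots D"
  and double_not_root: "\<alpha> \<in> \<Phi> \<Longrightarrow> 2 *\<^sub>R \<alpha> \<notin> \<Phi>"
  using reduced unfolding reduced_root_datum_def coroots_def by auto

lemma bounded_linear_reflect: "bounded_linear (reflect \<alpha>)"
  unfolding reflection_def
  by (intro bounded_linear_sub bounded_linear_ident bounded_linear_scaleR_left
      bounded_linear_compose[OF bounded_linear_scaleR_left] blinfun.bounded_linear_right)

lemma linear_reflect: "linear (reflect \<alpha>)"
  using bounded_linear_reflect bounded_linear.linear by blast

lemma coreflect_apply: "blinfun_apply (coreflect \<alpha> f) x = f (reflect \<alpha> x)"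
  by (simp add: dual_reflection_def reflection_def blinfun.diff_left blinfun.diff_right
      blinfun.scaleR_left blinfun.scaleR_right)

lemma root_reflect: "\<alpha> \<in> \<Phi> \<Longrightarrow> blinfun_apply \<alpha> (reflect \<alpha> x) = - blinfun_apply \<alpha> x"
  by (simp add: reflection_def blinfun.diff_right blinfun.scaleR_right)

lemma reflect_reflect [simp]: "\<alpha> \<in> \<Phi> \<Longrightarrow> reflect \<alpha> (reflect \<alpha> x) = x"
  using root_reflect[of \<alpha> x] unfolding reflection_def by simp

lemma drefl_coreflect [simp]: "\<alpha> \<in> \<Phi> \<Longrightarrow> coreflect \<alpha> (coreflect \<alpha> f) = f"
  by (rule blinfun_eqI) (simp add: coreflect_apply)

lemma coreflect_root: "\<alpha> \<in> \<Phi> \<Longrightarrow> \<beta> \<in> \<Phi> \<Longrightarrow> coreflect \<alpha> \<beta> \<in> \<Phi>"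
  using coreflect_image by blast

lemma bij_coreflect: "\<alpha> \<in> \<Phi> \<Longrightarrow> bij_betw (coreflect \<alpha>) \<Phi> \<Phi>"
  by (rule bij_betw_byWitness[where f' = "coreflect \<alpha>"]) (auto simp: coreflect_root)

lemma coreflect_self: "\<alpha> \<in> \<Phi> \<Longrightarrow> coreflect \<alpha> \<alpha> = - \<alpha>"
  by (simp add: dual_reflection_def) (metis add_diff_cancel_left' diff_minus_eq_add minus_diff_eq scaleR_2)

lemma uminus_root: "\<alpha> \<in> \<Phi> \<Longrightarrow> - \<alpha> \<in> \<Phi>"
  using coreflect_root[of \<alpha> \<alpha>] coreflect_self by simp

text \<open>
  The conjugate of \<open>s\<^sub>\<alpha>\<close> by \<open>s\<^sub>\<beta>\<close> and the reflection in the root \<open>s\<^sub>\<beta>\<alpha>\<close> both preserve the finite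
  set of coroots, and their product is the transvection \<open>x \<mapsto> x + \<gamma>(x) c\<close> along the difference \<open>c\<close> of
  the two candidate coroots.  A transvection of infinite order cannot preserve a finite set on which it acts
  nontrivially, so \<open>c = 0\<close>.
\<close>

lemma coroot_coreflect:
  assumes \<alpha>: "\<alpha> \<in> \<Phi>" and \<beta>: "\<beta> \<in> \<Phi>"
  shows "cv (coreflect \<beta> \<alpha>) = reflect \<beta> (cv \<alpha>)"
proof (rule ccontr)
  assume ne: "cv (coreflect \<beta> \<alpha>) \<noteq> reflect \<beta> (cv \<alpha>)"
  define \<gamma> where "\<gamma> = coreflect \<beta> \<alpha>"
  define c where "c = reflect \<beta> (cv \<alpha>) - cv \<gamma>"
  have \<gamma>: "\<gamma> \<in> \<Phi>" using coreflect_root[OF \<beta> \<alpha>] by (simp add: \<gamma>_def)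
  have c0: "c \<noteq> 0" using ne by (auto simp: c_def \<gamma>_def)
  have \<gamma>c: "blinfun_apply \<gamma> c = 0"
    unfolding c_def blinfun.diff_right root_coroot[OF \<gamma>]
    using \<alpha> \<beta> by (simp add: \<gamma>_def coreflect_apply)
  have tr: "reflect \<beta> (reflect \<alpha> (reflect \<beta> (reflect \<gamma> x))) = x + blinfun_apply \<gamma> x *\<^sub>R c" for x
  proof -
    have "reflect \<beta> (reflect \<alpha> (reflect \<beta> y)) = y - blinfun_apply \<gamma> y *\<^sub>R reflect \<beta> (cv \<alpha>)" for y
    proof -
      have "reflect \<alpha> (reflect \<beta> y) = reflect \<beta> y - blinfun_apply \<gamma> y *\<^sub>R cv \<alpha>"
        by (simp add: reflection_def[of D \<alpha>] \<gamma>_def coreflect_apply)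
      then show ?thesis
        using \<beta> linear_reflect[of \<beta>] by (simp add: linear_diff linear_scale)
    qed
    then have "reflect \<beta> (reflect \<alpha> (reflect \<beta> (reflect \<gamma> x)))
        = reflect \<gamma> x + blinfun_apply \<gamma> x *\<^sub>R reflect \<beta> (cv \<alpha>)"
      using root_reflect[OF \<gamma>] by simp
    also have "\<dots> = x + blinfun_apply \<gamma> x *\<^sub>R c"
      unfolding reflection_def[of D \<gamma>] by (simp add: c_def algebra_simps)
    finally show ?thesis .
  qed
  have pres: "x + blinfun_apply \<gamma> x *\<^sub>R c \<in> coroots D" if "x \<in> coroots D" for x
    unfolding tr[symmetric] using that reflect_image \<alpha> \<beta> \<gamma> by blast
  have it: "cv \<gamma> + (2 * real k) *\<^sub>R c \<in> coroots D" for k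
  proof (induction k)
    case 0
    then show ?case using \<gamma> by (simp add: coroots_def)
  next
    case (Suc k)
    have "blinfun_apply \<gamma> (cv \<gamma> + (2 * real k) *\<^sub>R c) = 2"
      using \<gamma> \<gamma>c by (simp add: blinfun.add_right blinfun.scaleR_right)
    from pres[OF Suc, unfolded this] show ?case by (simp add: algebra_simps)
  qed
  have "inj (\<lambda>k::nat. cv \<gamma> + (2 * real k) *\<^sub>R c)"
    using c0 by (auto simp: inj_on_def)
  moreover have "finite (range (\<lambda>k::nat. cv \<gamma> + (2 * real k) *\<^sub>R c))"
    using it finite_roots
    by - (rule finite_subset[of _ "coroots D"], auto simp: coroots_def)
  ultimately show False using finite_imageD infinite_UNIV_nat by blast
qed

lemma coroot_uminus: "\<alpha> \<in> \<Phi> \<Longrightarrow> cv (- \<alpha>) = - cv \<alpha>"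
  using coroot_coreflect[of \<alpha> \<alpha>] by (simp add: coreflect_self reflection_def scaleR_2)

section \<open>Invariant forms\<close>

text \<open>
  The \<open>W\<close>-equivariant maps between \<open>\<aa>\<^sup>*\<close> and \<open>\<aa>\<close> given by the invariant positive semidefinite forms
  \<open>\<Sum>\<^sub>\<beta> f(\<beta>\<^sup>\<or>) g(\<beta>\<^sup>\<or>)\<close> and \<open>\<Sum>\<^sub>\<beta> \<beta>(x) \<beta>(y)\<close>.
\<close>

definition coroot_sum :: "('v \<Rightarrow>\<^sub>L real) \<Rightarrow> 'v" where
  "coroot_sum f = (\<Sum>\<beta>\<in>\<Phi>. blinfun_apply f (cv \<beta>) *\<^sub>R cv \<beta>)"

definition root_sum :: "'v \<Rightarrow> ('v \<Rightarrow>\<^sub>L real)" where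
  "root_sum x = (\<Sum>\<beta>\<in>\<Phi>. blinfun_apply \<beta> x *\<^sub>R \<beta>)"

lemma linear_coroot_sum: "linear coroot_sum"
  by (rule linearI) (simp_all add: coroot_sum_def blinfun.add_left blinfun.scaleR_left
      scaleR_add_left sum.distrib scaleR_sum_right)

lemma linear_root_sum: "linear root_sum"
  by (rule linearI) (simp_all add: root_sum_def blinfun.add_right blinfun.scaleR_right
      scaleR_add_left sum.distrib scaleR_sum_right)

lemma apply_coroot_sum: "blinfun_apply g (coroot_sum f)
    = (\<Sum>\<beta>\<in>\<Phi>. blinfun_apply f (cv \<beta>) * blinfun_apply g (cv \<beta>))"
  by (simp add: coroot_sum_def blinfun.sum_right blinfun.scaleR_right)

lemma root_sum_apply: "blinfun_apply (root_sum x) y = (\<Sum>\<beta>\<in>\<Phi>. blinfun_apply \<beta> x * blinfun_apply \<beta> y)"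
  by (simp add: root_sum_def blinfun.sum_left blinfun.scaleR_left)

text \<open>
  Both \<open>coroot_sum\<close> and \<open>root_sum\<close> commute with \<open>s\<^sub>\<alpha>\<close>, hence map its one-dimensional
  \<open>-1\<close>-eigenspaces on \<open>\<aa>\<^sup>*\<close> and \<open>\<aa>\<close> into each other.
\<close>

lemma coroot_sum_root:
  assumes \<alpha>: "\<alpha> \<in> \<Phi>"
  shows "2 *\<^sub>R coroot_sum \<alpha> = blinfun_apply \<alpha> (coroot_sum \<alpha>) *\<^sub>R cv \<alpha>"
    and "blinfun_apply \<alpha> (coroot_sum \<alpha>) > 0"
proof -
  have "reflect \<alpha> (coroot_sum \<alpha>) = (\<Sum>\<beta>\<in>\<Phi>. blinfun_apply \<alpha> (cv \<beta>) *\<^sub>R cv (coreflect \<alpha> \<beta>))"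
    using linear_reflect[of \<alpha>] \<alpha>
    by (simp add: coroot_sum_def linear_sum linear_scale coroot_coreflect)
  also have "\<dots> = (\<Sum>\<beta>\<in>\<Phi>. - blinfun_apply \<alpha> (cv (coreflect \<alpha> \<beta>)) *\<^sub>R cv (coreflect \<alpha> \<beta>))"
    using \<alpha> by (intro sum.cong) (simp_all add: coroot_coreflect root_reflect)
  also have "\<dots> = (\<Sum>\<beta>\<in>\<Phi>. - blinfun_apply \<alpha> (cv \<beta>) *\<^sub>R cv \<beta>)"
    by (rule sum.reindex_bij_betw[OF bij_coreflect[OF \<alpha>]])
  also have "\<dots> = - coroot_sum \<alpha>"
    by (simp add: coroot_sum_def sum_negf)
  finally show "2 *\<^sub>R coroot_sum \<alpha> = blinfun_apply \<alpha> (coroot_sum \<alpha>) *\<^sub>R cv \<alpha>"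
    by (simp add: reflection_def scaleR_2 algebra_simps)
  have "0 < (blinfun_apply \<alpha> (cv \<alpha>))\<^sup>2" using \<alpha> by simp
  also have "\<dots> \<le> blinfun_apply \<alpha> (coroot_sum \<alpha>)"
    unfolding apply_coroot_sum power2_eq_square
    by (rule member_le_sum[OF \<alpha> _ finite_roots]) simp
  finally show "blinfun_apply \<alpha> (coroot_sum \<alpha>) > 0" .
qed

lemma root_sum_coroot:
  assumes \<alpha>: "\<alpha> \<in> \<Phi>"
  shows "2 *\<^sub>R root_sum (cv \<alpha>) = blinfun_apply (root_sum (cv \<alpha>)) (cv \<alpha>) *\<^sub>R \<alpha>"
    and "blinfun_apply (root_sum (cv \<alpha>)) (cv \<alpha>) > 0"
proof -
  have "coreflect \<alpha> (root_sum (cv \<alpha>)) = (\<Sum>\<beta>\<in>\<Phi>. blinfun_apply \<beta> (cv \<alpha>) *\<^sub>R coreflect \<alpha> \<beta>)"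
    by (rule blinfun_eqI) (simp add: coreflect_apply root_sum_def blinfun.sum_left blinfun.scaleR_left)
  also have "\<dots> = (\<Sum>\<beta>\<in>\<Phi>. - blinfun_apply (coreflect \<alpha> \<beta>) (cv \<alpha>) *\<^sub>R coreflect \<alpha> \<beta>)"
    using \<alpha> by (intro sum.cong) (simp_all add: coreflect_apply reflection_def scaleR_2 blinfun.minus_right)
  also have "\<dots> = (\<Sum>\<beta>\<in>\<Phi>. - blinfun_apply \<beta> (cv \<alpha>) *\<^sub>R \<beta>)"
    by (rule sum.reindex_bij_betw[OF bij_coreflect[OF \<alpha>]])
  also have "\<dots> = - root_sum (cv \<alpha>)"
    by (simp add: root_sum_def sum_negf)
  finally show "2 *\<^sub>R root_sum (cv \<alpha>) = blinfun_apply (root_sum (cv \<alpha>)) (cv \<alpha>) *\<^sub>R \<alpha>"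
    by (simp add: dual_reflection_def scaleR_2 algebra_simps)
  have "0 < (blinfun_apply \<alpha> (cv \<alpha>))\<^sup>2" using \<alpha> by simp
  also have "\<dots> \<le> blinfun_apply (root_sum (cv \<alpha>)) (cv \<alpha>)"
    unfolding root_sum_apply power2_eq_square
    by (rule member_le_sum[OF \<alpha> _ finite_roots]) simp
  finally show "blinfun_apply (root_sum (cv \<alpha>)) (cv \<alpha>) > 0" .
qed

text \<open>
  By the preceding proportionality \<open>coroot_sum\<close> maps the span of the roots onto that of the coroots.  If
  \<open>y = coroot_sum f\<close> is killed by the roots, then \<open>0 = f(y) = \<Sum>\<^sub>\<beta> f(\<beta>\<^sup>\<or>)\<^sup>2\<close>.
\<close>

lemma span_coroots_eq_0:
  assumes "y \<in> span (coroots D)" and 0: "\<And>\<alpha>. \<alpha> \<in> \<Phi> \<Longrightarrow> blinfun_apply \<alpha> y = 0"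
  shows "y = 0"
proof -
  have "cv \<alpha> \<in> coroot_sum ` span \<Phi>" if "\<alpha> \<in> \<Phi>" for \<alpha>
  proof -
    have "cv \<alpha> = coroot_sum ((2 / blinfun_apply \<alpha> (coroot_sum \<alpha>)) *\<^sub>R \<alpha>)"
      using coroot_sum_root[OF that] linear_coroot_sum
      by (simp add: linear_scale)
         (metis (no_types, lifting) divide_inverse less_irrefl mult.commute right_inverse scaleR_one scaleR_scaleR)
    then show ?thesis using that by (metis image_eqI span_base span_scale)
  qed
  then have "span (coroots D) \<subseteq> coroot_sum ` span \<Phi>"
    using linear_coroot_sum
    by (intro span_minimal) (auto simp: coroots_def linear_subspace_image)
  with assms obtain f where f: "f \<in> span \<Phi>" and y: "y = coroot_sum f" by blast
  have "blinfun_apply g y = 0" if "g \<in> span \<Phi>" for g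
    using that by (induction rule: span_induct_alt) (simp_all add: 0 blinfun.add_left blinfun.scaleR_left)
  from this[OF f] have "(\<Sum>\<beta>\<in>\<Phi>. blinfun_apply f (cv \<beta>) * blinfun_apply f (cv \<beta>)) = 0"
    by (simp add: y apply_coroot_sum)
  then have "\<forall>\<beta>\<in>\<Phi>. blinfun_apply f (cv \<beta>) = 0"
    using finite_roots by (subst (asm) sum_nonneg_eq_0_iff) auto
  then show ?thesis by (simp add: y coroot_sum_def)
qed

lemma span_roots_eq_0:
  assumes "f \<in> span \<Phi>" and 0: "\<And>\<alpha>. \<alpha> \<in> \<Phi> \<Longrightarrow> blinfun_apply f (cv \<alpha>) = 0"
  shows "f = 0"
proof -
  have "\<alpha> \<in> root_sum ` span (coroots D)" if "\<alpha> \<in> \<Phi>" for \<alpha>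
  proof -
    have "\<alpha> = root_sum ((2 / blinfun_apply (root_sum (cv \<alpha>)) (cv \<alpha>)) *\<^sub>R cv \<alpha>)"
      using root_sum_coroot[OF that] linear_root_sum
      by (simp add: linear_scale)
         (metis (no_types, lifting) divide_inverse less_irrefl mult.commute right_inverse scaleR_one scaleR_scaleR)
    moreover have "cv \<alpha> \<in> coroots D" using that by (simp add: coroots_def)
    ultimately show ?thesis by (metis image_eqI span_base span_scale)
  qed
  then have "span \<Phi> \<subseteq> root_sum ` span (coroots D)"
    using linear_root_sum
    by (intro span_minimal) (auto simp: linear_subspace_image)
  with assms obtain y where y: "y \<in> span (coroots D)" and f: "f = root_sum y" by blast
  have "blinfun_apply f z = 0" if "z \<in> span (coroots D)" for z
    using that by (induction rule: span_induct_alt)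
      (auto simp: 0 coroots_def blinfun.add_right blinfun.scaleR_right)
  from this[OF y] have "(\<Sum>\<beta>\<in>\<Phi>. blinfun_apply \<beta> y * blinfun_apply \<beta> y) = 0"
    by (simp add: f root_sum_apply)
  then have "\<forall>\<beta>\<in>\<Phi>. blinfun_apply \<beta> y = 0"
    using finite_roots by (subst (asm) sum_nonneg_eq_0_iff) auto
  then show ?thesis by (simp add: f root_sum_def)
qed

section \<open>The Weyl group\<close>

lemma weyl_bounded_linear: "w \<in> W \<Longrightarrow> bounded_linear w"
proof (induction rule: weyl_group.induct)
  case one
  then show ?case by (simp add: id_def bounded_linear_ident)
next
  case (step \<alpha> w)
  then show ?case using bounded_linear_compose[OF bounded_linear_reflect] by (simp add: o_def)
qed

lemma weyl_linear: "w \<in> W \<Longrightarrow> linear w"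
  using weyl_bounded_linear bounded_linear.linear by blast

lemma weyl_reflect: "\<alpha> \<in> \<Phi> \<Longrightarrow> reflect \<alpha> \<in> W"
  using weyl_group.step[OF _ weyl_group.one] by simp

lemma weyl_comp: "w \<in> W \<Longrightarrow> v \<in> W \<Longrightarrow> w \<circ> v \<in> W"
  by (induction rule: weyl_group.induct) (auto simp: comp_assoc intro: weyl_group.step)

lemma weyl_inverse: "w \<in> W \<Longrightarrow> \<exists>v\<in>W. v \<circ> w = id \<and> w \<circ> v = id"
proof (induction rule: weyl_group.induct)
  case one
  then show ?case using weyl_group.one by (intro bexI[of _ id]) simp_all
next
  case (step \<alpha> w)
  then obtain v where v: "v \<in> W" "v \<circ> w = id" "w \<circ> v = id" by blast
  have "v \<circ> reflect \<alpha> \<in> W" using v step weyl_comp weyl_reflect by blast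
  moreover have "(v \<circ> reflect \<alpha>) \<circ> (reflect \<alpha> \<circ> w) = id" "(reflect \<alpha> \<circ> w) \<circ> (v \<circ> reflect \<alpha>) = id"
    using v step by (auto simp: fun_eq_iff)
  ultimately show ?case by blast
qed

lemma weyl_bij: "w \<in> W \<Longrightarrow> bij w"
  using weyl_inverse o_bij by metis

lemma weyl_inv: "w \<in> W \<Longrightarrow> winv w \<in> W"
  using weyl_inverse by (metis inv_unique_comp)

lemma weyl_winv_comp [simp]: "w \<in> W \<Longrightarrow> winv w \<circ> w = id" "w \<in> W \<Longrightarrow> w \<circ> winv w = id"
  using weyl_bij by (simp_all add: bij_is_inj surj_iff[symmetric] bij_is_surj)

lemma weyl_winv_apply [simp]: "w \<in> W \<Longrightarrow> winv w (w x) = x" "w \<in> W \<Longrightarrow> w (winv w x) = x"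
  using weyl_bij by (simp_all add: bij_is_inj bij_is_surj surj_f_inv_f)

lemma weyl_bij_comp_right: "u \<in> W \<Longrightarrow> bij_betw (\<lambda>w. w \<circ> u) W W"
  by (rule bij_betw_byWitness[where f' = "\<lambda>w. w \<circ> winv u"])
    (auto simp: comp_assoc weyl_comp weyl_inv)

lemma weyl_bij_comp_left: "u \<in> W \<Longrightarrow> bij_betw (\<lambda>w. u \<circ> w) W W"
  by (rule bij_betw_byWitness[where f' = "\<lambda>w. winv u \<circ> w"])
    (auto simp: comp_assoc[symmetric] weyl_comp weyl_inv)

text \<open>The inverse of the usual left action on linear forms, so that \<open>pull (w \<circ> v) = pull v \<circ> pull w\<close>.\<close>

definition pull :: "('v \<Rightarrow> 'v) \<Rightarrow> ('v \<Rightarrow>\<^sub>L real) \<Rightarrow> ('v \<Rightarrow>\<^sub>L real)" where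
  "pull w f = f o\<^sub>L Blinfun w"

lemma pull_apply [simp]: "w \<in> W \<Longrightarrow> blinfun_apply (pull w f) x = f (w x)"
  by (simp add: pull_def bounded_linear_Blinfun_apply weyl_bounded_linear)

lemma pull_id: "pull id f = f"
  by (rule blinfun_eqI) (simp only: pull_apply[OF weyl_group.one] id_apply)

lemma pull_ident: "pull (\<lambda>x. x) f = f"
  using pull_id by (simp add: id_def)

lemma pull_comp: "w \<in> W \<Longrightarrow> v \<in> W \<Longrightarrow> pull v (pull w f) = pull (w \<circ> v) f"
  by (rule blinfun_eqI) (simp add: weyl_comp)

lemma pull_reflect: "\<alpha> \<in> \<Phi> \<Longrightarrow> pull (reflect \<alpha>) f = coreflect \<alpha> f"
  by (rule blinfun_eqI) (simp add: weyl_reflect coreflect_apply)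

lemma weyl_root: "w \<in> W \<Longrightarrow> \<alpha> \<in> \<Phi> \<Longrightarrow> pull w \<alpha> \<in> \<Phi> \<and> w (cv (pull w \<alpha>)) = cv \<alpha>"
proof (induction arbitrary: \<alpha> rule: weyl_group.induct)
  case one
  then show ?case by (simp add: pull_id pull_ident)
next
  case (step \<beta> w)
  have eq: "pull (reflect \<beta> \<circ> w) \<alpha> = pull w (coreflect \<beta> \<alpha>)"
    using step by (simp add: pull_comp[symmetric] weyl_reflect pull_reflect)
  show ?case unfolding eq using step.IH[OF coreflect_root[OF step.hyps(1) step.prems]] step
    by (simp add: coroot_coreflect)
qed

lemma pull_root: "w \<in> W \<Longrightarrow> \<alpha> \<in> \<Phi> \<Longrightarrow> pull w \<alpha> \<in> \<Phi>"
  using weyl_root by blast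

lemma weyl_diff: "w \<in> W \<Longrightarrow> w x - x \<in> span (coroots D)"
proof (induction rule: weyl_group.induct)
  case one
  then show ?case by (simp add: span_zero)
next
  case (step \<alpha> w)
  have "(reflect \<alpha> \<circ> w) x - x = (w x - x) - blinfun_apply \<alpha> (w x) *\<^sub>R cv \<alpha>"
    by (simp add: reflection_def)
  moreover have "cv \<alpha> \<in> span (coroots D)" using step by (auto simp: coroots_def intro: span_base)
  ultimately show ?case using step by (metis span_diff span_scale)
qed

lemma weyl_span_coroots:
  assumes "w \<in> W" "x \<in> span (coroots D)"
  shows "w x \<in> span (coroots D)"
  using span_add[OF weyl_diff[OF assms(1), of x] assms(2)] by simp

lemma pull_diff: "w \<in> W \<Longrightarrow> pull w f - f \<in> span \<Phi>"
proof (induction arbitrary: f rule: weyl_group.induct)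
  case one
  then show ?case by (simp add: pull_id pull_ident span_zero)
next
  case (step \<alpha> w)
  have "pull (reflect \<alpha> \<circ> w) f - f = (pull w (coreflect \<alpha> f) - coreflect \<alpha> f) - f (cv \<alpha>) *\<^sub>R \<alpha>"
    using step by (simp add: pull_comp[symmetric] weyl_reflect pull_reflect dual_reflection_def[of D \<alpha> f])
  then show ?case using step by (metis span_base span_diff span_scale)
qed

lemma weyl_eqI:
  assumes "w \<in> W" "v \<in> W" and eq: "\<And>\<alpha>. \<alpha> \<in> \<Phi> \<Longrightarrow> pull w \<alpha> = pull v \<alpha>"
  shows "w = v"
proof
  fix x
  have "w x - v x \<in> span (coroots D)"
    using span_diff[OF weyl_diff[OF assms(1), of x] weyl_diff[OF assms(2), of x]] by simp
  moreover have "blinfun_apply \<alpha> (w x - v x) = 0" if "\<alpha> \<in> \<Phi>" for \<alpha>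
    using arg_cong[OF eq[OF that], of "\<lambda>f. blinfun_apply f x"] assms by (simp add: blinfun.diff_right)
  ultimately show "w x = v x" using span_coroots_eq_0 by fastforce
qed

text \<open>
  Elements of \<open>W\<close> move points only within the span of the coroots, on which the roots separate points; so the
  permutation of the roots determines the element.
\<close>

lemma finite_weyl: "finite W"
proof -
  have "inj_on (\<lambda>w. restrict (pull w) \<Phi>) W"
    by (intro inj_onI weyl_eqI) (auto simp: restrict_def fun_eq_iff, metis)
  moreover have "(\<lambda>w. restrict (pull w) \<Phi>) ` W \<subseteq> \<Phi> \<rightarrow>\<^sub>E \<Phi>"
    by (auto simp: pull_root)
  moreover have "finite (\<Phi> \<rightarrow>\<^sub>E \<Phi>)" using finite_roots by (simp add: finite_PiE)
  ultimately show ?thesis using finite_imageD finite_subset by blast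
qed

lemma card_weyl_pos: "card W > 0"
  using finite_weyl weyl_group.one by (metis card_gt_0_iff empty_iff)

section \<open>The central part of a cocharacter\<close>

definition central_part :: "'v \<Rightarrow> 'v" where
  "central_part x = (1 / real (card W)) *\<^sub>R (\<Sum>w\<in>W. w x)"

lemma weyl_central_part: "u \<in> W \<Longrightarrow> u (central_part x) = central_part x"
proof -
  assume u: "u \<in> W"
  have "u (central_part x) = (1 / real (card W)) *\<^sub>R (\<Sum>w\<in>W. (u \<circ> w) x)"
    using weyl_linear[OF u] by (simp add: central_part_def linear_scale linear_sum)
  also have "(\<Sum>w\<in>W. (u \<circ> w) x) = (\<Sum>w\<in>W. w x)"
    by (rule sum.reindex_bij_betw[OF weyl_bij_comp_left[OF u]])
  finally show ?thesis by (simp add: central_part_def)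
qed

lemma root_central_part: "\<alpha> \<in> \<Phi> \<Longrightarrow> blinfun_apply \<alpha> (central_part x) = 0"
  using root_reflect[of \<alpha> "central_part x"] weyl_central_part[OF weyl_reflect] by simp

lemma diff_central_part: "x - central_part x \<in> span (coroots D)"
proof -
  have "x - central_part x = (1 / real (card W)) *\<^sub>R (\<Sum>w\<in>W. - (w x - x))"
    using card_weyl_pos by (simp add: central_part_def sum_subtractf algebra_simps)
       (simp add: scaleR_diff_right scaleR_conv_of_real sum_constant_scaleR)
  then show ?thesis using weyl_diff by (metis (no_types, lifting) span_neg span_scale span_sum)
qed

lemma weyl_fixes_root_kernel:
  assumes "w \<in> W" and 0: "\<And>\<alpha>. \<alpha> \<in> \<Phi> \<Longrightarrow> blinfun_apply \<alpha> x = 0"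
  shows "w x = x"
  using assms(1) by (induction rule: weyl_group.induct) (simp_all add: reflection_def 0)

end

section \<open>Positive roots\<close>

locale based_datum = root_datum D for D :: "'v::real_normed_vector based_root_datum" +
  assumes simple: "simple_system D"
begin

definition I :: "nat set" where "I = {1..ss_rank D}"
abbreviation "sr \<equiv> simple_root D"
abbreviation "scv \<equiv> simple_coroot D"

definition pos :: "('v \<Rightarrow>\<^sub>L real) set" where
  "pos = {\<alpha> \<in> \<Phi>. \<exists>c :: nat \<Rightarrow> nat. \<alpha> = (\<Sum>i\<in>I. real (c i) *\<^sub>R sr i)}"

lemma finite_I [simp]: "finite I" by (simp add: I_def)

lemma sr_root [simp]: "i \<in> I \<Longrightarrow> sr i \<in> \<Phi>"
  and sr_inj: "inj_on sr I"
  and sr_independent: "independent (sr ` I)"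
  using simple unfolding simple_system_def I_def by auto

lemma sr_coeffs_0:
  assumes "(\<Sum>i\<in>I. a i *\<^sub>R sr i) = 0" "i \<in> I"
  shows "a i = 0"
proof -
  have "(\<Sum>v\<in>sr ` I. a (the_inv_into I sr v) *\<^sub>R v) = (\<Sum>i\<in>I. a i *\<^sub>R sr i)"
    by (subst sum.reindex[OF sr_inj]) (simp add: the_inv_into_f_f[OF sr_inj])
  then have "a (the_inv_into I sr (sr i)) = 0"
    using assms independentD[OF sr_independent, of "sr ` I" "\<lambda>v. a (the_inv_into I sr v)" "sr i"] by simp
  then show ?thesis using assms(2) by (simp add: the_inv_into_f_f[OF sr_inj])
qed

lemma pos_root: "\<alpha> \<in> pos \<Longrightarrow> \<alpha> \<in> \<Phi>"
  and finite_pos: "finite pos"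
  using finite_roots by (auto simp: pos_def)

lemma pos_or_neg:
  assumes "\<alpha> \<in> \<Phi>"
  shows "\<alpha> \<in> pos \<or> - \<alpha> \<in> pos"
proof -
  obtain c :: "nat \<Rightarrow> nat" where
    "\<alpha> = (\<Sum>i\<in>I. real (c i) *\<^sub>R sr i) \<or> \<alpha> = - (\<Sum>i\<in>I. real (c i) *\<^sub>R sr i)"
    using simple assms unfolding simple_system_def I_def by blast
  then have "\<alpha> = (\<Sum>i\<in>I. real (c i) *\<^sub>R sr i) \<or> - \<alpha> = (\<Sum>i\<in>I. real (c i) *\<^sub>R sr i)"
    by auto
  then show ?thesis unfolding pos_def using assms uminus_root[OF assms] by blast
qed

lemma sr_pos [simp]: "i \<in> I \<Longrightarrow> sr i \<in> pos"
  unfolding pos_def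
  by (auto intro!: exI[of _ "\<lambda>k. if k = i then 1 else 0"] simp: if_distrib[of "\<lambda>n. n *\<^sub>R _"] if_distrib[of real] sum.delta cong: if_cong)

lemma root_nonzero: "\<alpha> \<in> \<Phi> \<Longrightarrow> \<alpha> \<noteq> 0"
  using root_coroot by fastforce

lemma pos_not_neg: "\<alpha> \<in> pos \<Longrightarrow> - \<alpha> \<notin> pos"
proof
  assume a: "\<alpha> \<in> pos" "- \<alpha> \<in> pos"
  then obtain c d :: "nat \<Rightarrow> nat" where c: "\<alpha> = (\<Sum>i\<in>I. real (c i) *\<^sub>R sr i)"
    and d: "- \<alpha> = (\<Sum>i\<in>I. real (d i) *\<^sub>R sr i)" by (auto simp: pos_def)
  have "(\<Sum>i\<in>I. (real (c i) + real (d i)) *\<^sub>R sr i) = 0"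
    unfolding scaleR_add_left sum.distrib c[symmetric] d[symmetric] by simp
  from sr_coeffs_0[OF this] have "c i = 0" if "i \<in> I" for i
    using that by fastforce
  then have "\<alpha> = 0" by (simp add: c)
  then show False using root_nonzero pos_root a by blast
qed

lemma root_apply_int: "\<alpha> \<in> \<Phi> \<Longrightarrow> x \<in> cochars D \<Longrightarrow> blinfun_apply \<alpha> x \<in> \<int>"
  using roots_chars by (auto simp: chars_def)

text \<open>
  Integrality of \<open>\<langle>\<alpha>\<^sub>i, (c \<alpha>\<^sub>i)\<^sup>\<or>\<rangle> = 2 / c\<close> leaves \<open>c = 1\<close> and \<open>c = 2\<close>, and the root datum is reduced.
\<close>

lemma simple_multiple_root:
  assumes "i \<in> I" and r: "real c *\<^sub>R sr i \<in> \<Phi>"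
  shows "c = 1"
proof -
  define \<alpha> where "\<alpha> = real c *\<^sub>R sr i"
  have \<alpha>: "\<alpha> \<in> \<Phi>" using r by (simp add: \<alpha>_def)
  have "real c * blinfun_apply (sr i) (cv \<alpha>) = 2"
    using root_coroot[OF \<alpha>] by (simp add: \<alpha>_def blinfun.scaleR_left)
  moreover obtain m :: int where m: "blinfun_apply (sr i) (cv \<alpha>) = m"
    using root_apply_int[of "sr i" "cv \<alpha>"] assms \<alpha> coroot_cochars by (auto elim: Ints_cases)
  ultimately have "int c * m = 2" by (metis (mono_tags) of_int_eq_iff of_int_mult of_int_numeral of_int_of_nat_eq)
  then have "int c dvd 2" by (metis dvd_triv_left)
  then have "c dvd 2" by (metis int_dvd_int_iff of_nat_numeral)
  then have "c = 1 \<or> c = 2" by (meson prime_nat_iff two_is_prime_nat)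
  moreover have "c \<noteq> 2" using r double_not_root[of "sr i"] assms(1) by auto
  ultimately show ?thesis by simp
qed

text \<open>
  A simple reflection changes only the coefficient of \<open>\<alpha>\<^sub>i\<close>, so a positive root that it makes negative is a
  multiple of \<open>\<alpha>\<^sub>i\<close>.
\<close>

lemma coreflect_pos:
  assumes i: "i \<in> I" and \<alpha>: "\<alpha> \<in> pos" and ne: "\<alpha> \<noteq> sr i"
  shows "coreflect (sr i) \<alpha> \<in> pos"
proof (rule ccontr)
  assume n: "coreflect (sr i) \<alpha> \<notin> pos"
  define m where "m = blinfun_apply \<alpha> (cv (sr i))"
  have "coreflect (sr i) \<alpha> \<in> \<Phi>" using coreflect_root i pos_root[OF \<alpha>] by simp
  then have "- coreflect (sr i) \<alpha> \<in> pos" using n pos_or_neg by blast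
  then obtain d :: "nat \<Rightarrow> nat" where d: "- coreflect (sr i) \<alpha> = (\<Sum>k\<in>I. real (d k) *\<^sub>R sr k)"
    by (auto simp: pos_def)
  obtain c :: "nat \<Rightarrow> nat" where c: "\<alpha> = (\<Sum>k\<in>I. real (c k) *\<^sub>R sr k)"
    using \<alpha> by (auto simp: pos_def)
  have "(\<Sum>k\<in>I. (real (c k) + real (d k) - (if k = i then m else 0)) *\<^sub>R sr k)
      = \<alpha> - coreflect (sr i) \<alpha> - m *\<^sub>R sr i"
    unfolding scaleR_add_left scaleR_diff_left sum.distrib sum_subtractf c[symmetric] d[symmetric]
    using i by (simp add: if_distrib[of "\<lambda>n. n *\<^sub>R _"] sum.delta cong: if_cong)
  also have "\<dots> = 0" by (simp add: m_def dual_reflection_def)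
  finally have *: "(\<Sum>k\<in>I. (real (c k) + real (d k) - (if k = i then m else 0)) *\<^sub>R sr k) = 0" .
  have ck: "c k = 0" if "k \<in> I" "k \<noteq> i" for k
    using sr_coeffs_0[OF * that(1)] that(2) by simp
  have "\<alpha> = (\<Sum>k\<in>I. if k = i then real (c k) *\<^sub>R sr k else 0)"
    unfolding c by (intro sum.cong) (auto simp: ck)
  also have "\<dots> = real (c i) *\<^sub>R sr i" using i by (simp add: sum.delta)
  finally have "\<alpha> = real (c i) *\<^sub>R sr i" .
  moreover from this have "c i = 1" using simple_multiple_root[OF i] pos_root[OF \<alpha>] by simp
  ultimately show False using ne by simp
qed

lemma sr_reflect_self: "i \<in> I \<Longrightarrow> coreflect (sr i) (sr i) = - sr i"
  by (simp add: coreflect_self)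

lemma bij_coreflect_pos:
  assumes i: "i \<in> I"
  shows "bij_betw (coreflect (sr i)) (pos - {sr i}) (pos - {sr i})"
proof (rule bij_betw_byWitness[where f' = "coreflect (sr i)"])
  have "coreflect (sr i) \<alpha> \<noteq> sr i" if "\<alpha> \<in> pos" for \<alpha>
  proof
    assume "coreflect (sr i) \<alpha> = sr i"
    then have "\<alpha> = - sr i"
      using drefl_coreflect[OF sr_root[OF i], of \<alpha>] sr_reflect_self[OF i] by simp
    then show False using that pos_not_neg[OF sr_pos[OF i]] by simp
  qed
  then show "coreflect (sr i) ` (pos - {sr i}) \<subseteq> pos - {sr i}"
    using coreflect_pos[OF i] by auto
  then show "coreflect (sr i) ` (pos - {sr i}) \<subseteq> pos - {sr i}" .
qed (use i in simp_all)

text \<open>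
  The sum of the positive coroots: a point of the open dominant chamber that is also a nonnegative combination of
  simple coroots.
\<close>

definition two_rho_check :: 'v ("\<delta>") where
  "two_rho_check = (\<Sum>\<alpha>\<in>pos. cv \<alpha>)"

lemma sr_delta: "i \<in> I \<Longrightarrow> blinfun_apply (sr i) \<delta> = 2"
proof -
  assume i: "i \<in> I"
  have split: "\<delta> = cv (sr i) + (\<Sum>\<alpha>\<in>pos - {sr i}. cv \<alpha>)"
    unfolding two_rho_check_def using i by (simp add: sum.remove[OF finite_pos])
  have "reflect (sr i) \<delta> = - cv (sr i) + (\<Sum>\<alpha>\<in>pos - {sr i}. cv (coreflect (sr i) \<alpha>))"
    unfolding split using i linear_reflect[of "sr i"]
    by (simp add: linear_add linear_sum coroot_coreflect pos_root)
       (simp add: reflection_def scaleR_2)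
  also have "(\<Sum>\<alpha>\<in>pos - {sr i}. cv (coreflect (sr i) \<alpha>)) = (\<Sum>\<alpha>\<in>pos - {sr i}. cv \<alpha>)"
    by (rule sum.reindex_bij_betw[OF bij_coreflect_pos[OF i]])
  finally have "reflect (sr i) \<delta> = \<delta> - 2 *\<^sub>R cv (sr i)" by (simp add: split scaleR_2)
  then have "blinfun_apply (sr i) \<delta> *\<^sub>R cv (sr i) = 2 *\<^sub>R cv (sr i)" by (simp add: reflection_def)
  then have "blinfun_apply (sr i) (blinfun_apply (sr i) \<delta> *\<^sub>R cv (sr i))
     = blinfun_apply (sr i) (2 *\<^sub>R cv (sr i))" by (rule arg_cong)
  then show ?thesis using i by (simp add: blinfun.scaleR_right)
qed

lemma pos_delta: "\<alpha> \<in> pos \<Longrightarrow> blinfun_apply \<alpha> \<delta> > 0"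
proof -
  assume \<alpha>: "\<alpha> \<in> pos"
  then obtain c :: "nat \<Rightarrow> nat" where c: "\<alpha> = (\<Sum>k\<in>I. real (c k) *\<^sub>R sr k)" by (auto simp: pos_def)
  have ge: "blinfun_apply \<alpha> \<delta> = 2 * real (\<Sum>k\<in>I. c k)"
    by (simp add: c blinfun.sum_left blinfun.scaleR_left sr_delta sum_distrib_left mult.commute)
  have "(\<Sum>k\<in>I. c k) \<noteq> 0"
  proof
    assume "(\<Sum>k\<in>I. c k) = 0"
    then have "\<alpha> = 0" by (simp add: c)
    then show False using root_nonzero pos_root \<alpha> by blast
  qed
  then have "0 < real (\<Sum>k\<in>I. c k)" by (simp only: of_nat_0_less_iff neq0_conv)
  then show ?thesis unfolding ge by (rule mult_pos_pos[OF zero_less_numeral])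
qed

section \<open>The cone of simple coroots\<close>

definition dominant :: "'v \<Rightarrow> bool" where
  "dominant x \<longleftrightarrow> (\<forall>i\<in>I. 0 \<le> blinfun_apply (sr i) x)"

definition codominant :: "('v \<Rightarrow>\<^sub>L real) \<Rightarrow> bool" where
  "codominant f \<longleftrightarrow> (\<forall>i\<in>I. 0 \<le> blinfun_apply f (cv (sr i)))"

definition coroot_cone :: "'v set" where
  "coroot_cone = {\<Sum>i\<in>I. q i *\<^sub>R cv (sr i) | q :: nat \<Rightarrow> real. \<forall>i\<in>I. 0 \<le> q i}"

lemma cone_add: "x \<in> coroot_cone \<Longrightarrow> y \<in> coroot_cone \<Longrightarrow> x + y \<in> coroot_cone"
proof -
  assume "x \<in> coroot_cone" "y \<in> coroot_cone"
  then obtain p q :: "nat \<Rightarrow> real" where "\<forall>i\<in>I. 0 \<le> p i" "\<forall>i\<in>I. 0 \<le> q i"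
    "x = (\<Sum>i\<in>I. p i *\<^sub>R cv (sr i))" "y = (\<Sum>i\<in>I. q i *\<^sub>R cv (sr i))"
    unfolding coroot_cone_def by blast
  then show ?thesis unfolding coroot_cone_def
    by (intro CollectI exI[of _ "\<lambda>i. p i + q i"]) (auto simp: scaleR_add_left sum.distrib)
qed

lemma cone_scale: "x \<in> coroot_cone \<Longrightarrow> 0 \<le> r \<Longrightarrow> r *\<^sub>R x \<in> coroot_cone"
proof -
  assume r: "0 \<le> r" and "x \<in> coroot_cone"
  then obtain p :: "nat \<Rightarrow> real" where "\<forall>i\<in>I. 0 \<le> p i"
    "x = (\<Sum>i\<in>I. p i *\<^sub>R cv (sr i))" unfolding coroot_cone_def by blast
  with r show ?thesis unfolding coroot_cone_def
    by (intro CollectI exI[of _ "\<lambda>i. r * p i"]) (auto simp: scaleR_sum_right)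
qed

lemma cone_0: "0 \<in> coroot_cone"
  unfolding coroot_cone_def by (intro CollectI exI[of _ "\<lambda>_. 0"]) auto

lemma cone_sum: "(\<And>a. a \<in> A \<Longrightarrow> f a \<in> coroot_cone) \<Longrightarrow> sum f A \<in> coroot_cone"
  by (induction A rule: infinite_finite_induct) (auto simp: cone_0 cone_add)

lemma simple_in_cone: "i \<in> I \<Longrightarrow> cv (sr i) \<in> coroot_cone"
  unfolding coroot_cone_def
  by (intro CollectI exI[of _ "\<lambda>k. if k = i then 1 else 0"])
     (auto simp: if_distrib[of "\<lambda>n. n *\<^sub>R _"] sum.delta cong: if_cong)

lemma codominant_cone: "codominant f \<Longrightarrow> x \<in> coroot_cone \<Longrightarrow> 0 \<le> blinfun_apply f x"
  unfolding coroot_cone_def codominant_def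
  by (auto simp: blinfun.sum_right blinfun.scaleR_right intro!: sum_nonneg)

lemma coroot_eq_coroot_sum:
  "\<alpha> \<in> \<Phi> \<Longrightarrow> cv \<alpha> = (2 / blinfun_apply \<alpha> (coroot_sum \<alpha>)) *\<^sub>R coroot_sum \<alpha>"
  "\<alpha> \<in> \<Phi> \<Longrightarrow> coroot_sum \<alpha> = (blinfun_apply \<alpha> (coroot_sum \<alpha>) / 2) *\<^sub>R cv \<alpha>"
proof -
  assume \<alpha>: "\<alpha> \<in> \<Phi>"
  note c = coroot_sum_root[OF \<alpha>]
  have "(1 / 2) *\<^sub>R (2 *\<^sub>R coroot_sum \<alpha>) = (blinfun_apply \<alpha> (coroot_sum \<alpha>) / 2) *\<^sub>R cv \<alpha>"
    unfolding c(1) by simp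
  then show "coroot_sum \<alpha> = (blinfun_apply \<alpha> (coroot_sum \<alpha>) / 2) *\<^sub>R cv \<alpha>" by simp
  have "(2 / blinfun_apply \<alpha> (coroot_sum \<alpha>)) *\<^sub>R coroot_sum \<alpha>
     = (1 / blinfun_apply \<alpha> (coroot_sum \<alpha>)) *\<^sub>R (2 *\<^sub>R coroot_sum \<alpha>)" by simp
  also have "\<dots> = cv \<alpha>" unfolding c(1) using c(2) by simp
  finally show "cv \<alpha> = (2 / blinfun_apply \<alpha> (coroot_sum \<alpha>)) *\<^sub>R coroot_sum \<alpha>" ..
qed

lemma coroot_sum_pos_expansion:
  assumes "\<alpha> = (\<Sum>i\<in>I. real (c i) *\<^sub>R sr i)"
  shows "coroot_sum \<alpha> = (\<Sum>i\<in>I. (real (c i) * (blinfun_apply (sr i) (coroot_sum (sr i)) / 2)) *\<^sub>R cv (sr i))"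
proof -
  have "coroot_sum \<alpha> = (\<Sum>i\<in>I. real (c i) *\<^sub>R coroot_sum (sr i))"
    using assms linear_coroot_sum by (simp add: linear_sum linear_scale)
  also have "\<dots> = (\<Sum>i\<in>I. real (c i) *\<^sub>R ((blinfun_apply (sr i) (coroot_sum (sr i)) / 2) *\<^sub>R cv (sr i)))"
    by (intro sum.cong refl arg_cong2[of _ _ _ _ scaleR] coroot_eq_coroot_sum(2)) simp
  finally show ?thesis by simp
qed

text \<open>
  The linear map \<open>coroot_sum\<close> takes each root to a positive multiple of its coroot, so it turns an expansion of
  a positive root in simple roots into one of its coroot in simple coroots.
\<close>

lemma pos_coroot_cone: "\<alpha> \<in> pos \<Longrightarrow> cv \<alpha> \<in> coroot_cone"
proof -
  assume \<alpha>: "\<alpha> \<in> pos"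
  then obtain c :: "nat \<Rightarrow> nat" where c: "\<alpha> = (\<Sum>k\<in>I. real (c k) *\<^sub>R sr k)" by (auto simp: pos_def)
  have k: "blinfun_apply (sr i) (coroot_sum (sr i)) > 0" if "i \<in> I" for i
    using coroot_sum_root(2) that by simp
  have "coroot_sum \<alpha> \<in> coroot_cone"
    unfolding coroot_sum_pos_expansion[OF c]
    by (intro cone_sum cone_scale simple_in_cone) (use k in \<open>auto intro!: mult_nonneg_nonneg dest: less_imp_le\<close>)
  then show ?thesis
    using coroot_eq_coroot_sum(1) coroot_sum_root(2) pos_root[OF \<alpha>] cone_scale
    by (metis divide_nonneg_pos zero_le_numeral)
qed

lemma delta_cone: "\<delta> \<in> coroot_cone"
  unfolding two_rho_check_def by (intro cone_sum pos_coroot_cone)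

lemma cone_span: "x \<in> coroot_cone \<Longrightarrow> x \<in> span (scv ` I)"
  unfolding coroot_cone_def simple_coroot_def by (auto intro!: span_sum span_scale intro: span_base)

lemma span_simple_coroots: "span (scv ` I) = span (coroots D)"
proof
  show "span (scv ` I) \<subseteq> span (coroots D)"
    by (rule span_mono) (auto simp: coroots_def simple_coroot_def)
  have "cv \<alpha> \<in> span (scv ` I)" if "\<alpha> \<in> \<Phi>" for \<alpha>
    using pos_or_neg[OF that] pos_coroot_cone cone_span coroot_uminus[OF that] span_neg
    by (metis minus_minus)
  then show "span (coroots D) \<subseteq> span (scv ` I)"
    by (intro span_minimal) (auto simp: coroots_def)
qed

lemma pos_simple_nonneg:
  assumes "\<alpha> \<in> pos" "dominant x"
  shows "0 \<le> blinfun_apply \<alpha> x"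
  using assms unfolding pos_def dominant_def
  by (auto simp: blinfun.sum_left blinfun.scaleR_left intro!: sum_nonneg)

section \<open>Words in the simple reflections\<close>

definition word :: "nat list \<Rightarrow> 'v \<Rightarrow> 'v" where
  "word js = foldr (\<lambda>j f. reflect (sr j) \<circ> f) js id"

lemma word_simps: "word [] = id" "word (j # js) = reflect (sr j) \<circ> word js"
  by (simp_all only: word_def foldr.simps id_comp comp_apply id_apply)

lemma word_append: "word (ms @ js) = word ms \<circ> word js"
  by (induction ms) (simp_all only: append_Nil append_Cons word_simps id_comp comp_assoc)

lemma word_weyl: "set js \<subseteq> I \<Longrightarrow> word js \<in> W"
  by (induction js) (auto simp only: word_simps weyl_group.one list.set intro!: weyl_group.step sr_root)

lemma reflect_pull:
  assumes w: "w \<in> W" and \<alpha>: "\<alpha> \<in> \<Phi>"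
  shows "reflect (pull w \<alpha>) = winv w \<circ> reflect \<alpha> \<circ> w"
proof
  fix x
  have "w (reflect (pull w \<alpha>) x) = reflect \<alpha> (w x)"
    using weyl_root[OF w \<alpha>] weyl_linear[OF w] w by (simp add: reflection_def linear_diff linear_scale)
  then show "reflect (pull w \<alpha>) x = (winv w \<circ> reflect \<alpha> \<circ> w) x"
    using w by (metis comp_apply weyl_winv_apply(1))
qed

lemma reflect_uminus: "\<alpha> \<in> \<Phi> \<Longrightarrow> reflect (- \<alpha>) = reflect \<alpha>"
  by (rule ext) (simp add: reflection_def coroot_uminus blinfun.minus_left)

text \<open>
  Induction on the height: since \<open>\<alpha>\<close> is positive on \<open>coroot_sum \<alpha>\<close>, which is a nonnegative combination of the
  simple coroots, some simple reflection lowers the height of a non-simple positive root, and reflections in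
  roots conjugate under \<open>s\<^sub>i\<close> are conjugate under \<open>s\<^sub>i\<close>.
\<close>

lemma reflect_pos_word: "\<alpha> \<in> pos \<Longrightarrow> \<exists>js. set js \<subseteq> I \<and> reflect \<alpha> = word js"
proof (induction "nat \<lfloor>blinfun_apply \<alpha> \<delta>\<rfloor>" arbitrary: \<alpha> rule: less_induct)
  case less
  then obtain c :: "nat \<Rightarrow> nat" where c: "\<alpha> = (\<Sum>k\<in>I. real (c k) *\<^sub>R sr k)" by (auto simp: pos_def)
  have "0 < blinfun_apply \<alpha> (coroot_sum \<alpha>)" using coroot_sum_root(2) pos_root less.prems by blast
  also have "\<dots> = (\<Sum>i\<in>I. (real (c i) * (blinfun_apply (sr i) (coroot_sum (sr i)) / 2)) * blinfun_apply \<alpha> (cv (sr i)))"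
    unfolding coroot_sum_pos_expansion[OF c] by (simp add: blinfun.sum_right blinfun.scaleR_right)
  finally obtain i where i: "i \<in> I"
    and "(real (c i) * (blinfun_apply (sr i) (coroot_sum (sr i)) / 2)) * blinfun_apply \<alpha> (cv (sr i)) > 0"
    by (meson not_less sum_nonpos)
  moreover have "0 \<le> real (c i) * (blinfun_apply (sr i) (coroot_sum (sr i)) / 2)"
    using coroot_sum_root(2)[of "sr i"] i by simp
  ultimately have p: "blinfun_apply \<alpha> (cv (sr i)) > 0"
    by (simp only: zero_less_mult_iff) linarith
  show ?case
  proof (cases "\<alpha> = sr i")
    case True
    then show ?thesis using i by (intro exI[of _ "[i]"]) (auto simp only: word_simps comp_id list.set)
  next
    case False
    let ?\<beta> = "coreflect (sr i) \<alpha>"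
    have \<beta>: "?\<beta> \<in> pos" by (rule coreflect_pos[OF i less.prems False])
    have d: "blinfun_apply ?\<beta> \<delta> = blinfun_apply \<alpha> \<delta> - 2 * blinfun_apply \<alpha> (cv (sr i))"
      using i by (simp add: dual_reflection_def blinfun.diff_left blinfun.scaleR_left sr_delta)
    have "blinfun_apply \<alpha> (cv (sr i)) \<in> \<int>"
      using root_apply_int pos_root less.prems coroot_cochars i by simp
    with p have "blinfun_apply \<alpha> (cv (sr i)) \<ge> 1" by (auto elim!: Ints_cases)
    with d have "\<lfloor>blinfun_apply ?\<beta> \<delta>\<rfloor> < \<lfloor>blinfun_apply \<alpha> \<delta>\<rfloor>" by linarith
    moreover have "0 \<le> \<lfloor>blinfun_apply ?\<beta> \<delta>\<rfloor>" using pos_delta[OF \<beta>] by simp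
    ultimately obtain js where js: "set js \<subseteq> I" "reflect ?\<beta> = word js"
      using less.hyps[OF _ \<beta>] by (metis nat_less_eq_zless)
    have "reflect \<alpha> x = (reflect (sr i) \<circ> reflect ?\<beta> \<circ> reflect (sr i)) x" for x
    proof -
      have "reflect ?\<beta> (reflect (sr i) x) = reflect (sr i) (reflect \<alpha> x)"
        using i pos_root[OF less.prems] linear_reflect[of "sr i"]
        by (simp add: reflection_def[of D "coreflect (sr i) \<alpha>"] reflection_def[of D \<alpha>]
            coreflect_apply coroot_coreflect linear_diff linear_scale)
      then show ?thesis using i by simp
    qed
    then have "reflect \<alpha> = word ([i] @ js @ [i])"
      unfolding word_append word_simps js(2)[symmetric] by (auto simp: fun_eq_iff)
    then show ?thesis using i js by (intro exI[of _ "[i] @ js @ [i]"]) auto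
  qed
qed

lemma weyl_word: "w \<in> W \<Longrightarrow> \<exists>js. set js \<subseteq> I \<and> w = word js"
proof (induction rule: weyl_group.induct)
  case one
  show ?case by (rule exI[of _ "[]"]) (simp only: word_simps list.set empty_subsetI simp_thms)
next
  case (step \<alpha> w)
  from pos_or_neg[OF step.hyps(1)] obtain ms where ms: "set ms \<subseteq> I" "reflect \<alpha> = word ms"
    using reflect_pos_word reflect_uminus[OF step.hyps(1)] by metis
  from step.IH obtain js where js: "set js \<subseteq> I" "w = word js" by blast
  show ?case using ms js by (intro exI[of _ "ms @ js"]) (simp only: word_append set_append Un_subset_iff simp_thms)
qed

text \<open>The deletion property, read off the step at which \<open>\<alpha>\<^sub>i\<close> changes sign along the word.\<close>

lemma word_deletion:
  assumes "set js \<subseteq> I" "i \<in> I" "pull (word js) (sr i) \<notin> pos"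
  shows "\<exists>ks. set ks \<subseteq> I \<and> length ks < length js \<and> reflect (sr i) \<circ> word js = word ks"
  using assms
proof (induction js rule: rev_induct)
  case Nil
  then show ?case by (simp only: word_simps pull_id sr_pos simp_thms)
next
  case (snoc j js)
  have j: "j \<in> I" and js: "set js \<subseteq> I" using snoc.prems by auto
  have wj: "word (js @ [j]) = word js \<circ> reflect (sr j)"
    by (simp only: word_append word_simps comp_id)
  let ?u = "word js" and ?\<beta> = "pull (word js) (sr i)"
  have uW: "?u \<in> W" by (rule word_weyl[OF js])
  show ?case
  proof (cases "?\<beta> \<in> pos")
    case False
    from snoc.IH[OF js snoc.prems(2) False] obtain ks
      where ks: "set ks \<subseteq> I" "length ks < length js" "reflect (sr i) \<circ> ?u = word ks" by blast
    have "reflect (sr i) \<circ> word (js @ [j]) = word (ks @ [j])"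
      unfolding wj by (simp only: word_append word_simps comp_id comp_assoc[symmetric] ks(3))
    then show ?thesis using ks j by (intro exI[of _ "ks @ [j]"]) simp
  next
    case True
    have "pull (word (js @ [j])) (sr i) = coreflect (sr j) ?\<beta>"
      unfolding wj using uW j by (simp only: pull_comp[symmetric] weyl_reflect sr_root pull_reflect)
    then have "?\<beta> = sr j" using snoc.prems(3) coreflect_pos[OF j True] by metis
    then have "reflect (sr j) = winv ?u \<circ> reflect (sr i) \<circ> ?u"
      using reflect_pull[OF uW sr_root[OF snoc.prems(2)]] by simp
    then have "reflect (sr i) (?u (reflect (sr j) x)) = ?u x" for x
      using uW snoc.prems(2) by simp
    then have "reflect (sr i) \<circ> word (js @ [j]) = ?u" unfolding wj by (auto simp: fun_eq_iff)
    then show ?thesis using js by (intro exI[of _ js]) simp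
  qed
qed

text \<open>
  Prepending \<open>s\<^sub>i\<close> to a word \<open>w\<close> adds \<open>\<alpha>\<^sub>i(w x) \<alpha>\<^sub>i\<^sup>\<or>\<close> to \<open>x - w x\<close>.  The coefficient is nonnegative if
  \<open>\<alpha>\<^sub>i \<circ> w\<close> is a positive root; otherwise the deletion property gives a shorter word for \<open>s\<^sub>i w\<close>.
\<close>

lemma dominant_word_le:
  assumes "dominant x" "set js \<subseteq> I"
  shows "x - word js x \<in> coroot_cone"
  using assms(2)
proof (induction js rule: length_induct)
  case (1 js)
  show ?case
  proof (cases js)
    case Nil
    then show ?thesis by (simp only: word_simps id_apply diff_self cone_0)
  next
    case (Cons i ms)
    have i: "i \<in> I" and ms: "set ms \<subseteq> I" using Cons 1 by auto
    show ?thesis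
    proof (cases "pull (word ms) (sr i) \<in> pos")
      case True
      have "0 \<le> blinfun_apply (sr i) (word ms x)"
        using pos_simple_nonneg[OF True assms(1)] word_weyl[OF ms] by simp
      moreover have "x - word ms x \<in> coroot_cone" using 1 Cons ms by simp
      moreover have "x - word js x = (x - word ms x) + blinfun_apply (sr i) (word ms x) *\<^sub>R cv (sr i)"
        unfolding Cons word_simps by (simp add: reflection_def)
      ultimately show ?thesis by (simp only: cone_add cone_scale simple_in_cone i)
    next
      case False
      from word_deletion[OF ms i False] obtain ks
        where ks: "set ks \<subseteq> I" "length ks < length ms" "reflect (sr i) \<circ> word ms = word ks" by blast
      have "word js = word ks" unfolding Cons word_simps ks(3) ..
      then show ?thesis using 1 ks Cons by simp
    qed
  qed
qed

lemma dominant_weyl_le: "dominant x \<Longrightarrow> w \<in> W \<Longrightarrow> x - w x \<in> coroot_cone"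
  using weyl_word dominant_word_le by blast

lemma dominant_delta: "dominant \<delta>"
  by (simp add: dominant_def sr_delta)

end

section \<open>Formal exponential sums\<close>

definition expi :: "real \<Rightarrow> complex" where "expi t = cis (2 * pi * t)"

lemma expi_add: "expi (s + t) = expi s * expi t"
  by (simp add: expi_def cis_mult algebra_simps)

lemma expi_0 [simp]: "expi 0 = 1"
  by (simp add: expi_def)

lemma expi_nonzero [simp]: "expi t \<noteq> 0"
  by (simp add: expi_def)

lemma expi_cnj: "cnj (expi t) = expi (- t)"
  by (simp add: expi_def cis_cnj)

lemma expi_sum: "finite A \<Longrightarrow> expi (\<Sum>a\<in>A. f a) = (\<Prod>a\<in>A. expi (f a))"
  by (induction A rule: finite_induct) (simp_all add: expi_add)

lemma expi_eq_1: "expi t = 1 \<longleftrightarrow> t \<in> \<int>"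
proof
  assume "expi t = 1"
  then have "cos (2 * pi * t) = 1" by (simp add: expi_def complex_eq_iff)
  then obtain n :: int where "2 * pi * t = n * 2 * pi" using cos_one_2pi_int by auto
  then have "t = n" by simp
  then show "t \<in> \<int>" by simp
next
  assume "t \<in> \<int>"
  then show "expi t = 1" by (auto simp: expi_def elim!: Ints_cases)
qed

lemma expi_eq_iff: "expi s = expi t \<longleftrightarrow> s - t \<in> \<int>"
proof -
  have "expi s = expi (s - t) * expi t" by (simp add: expi_add[symmetric])
  then show ?thesis by (simp add: expi_eq_1[symmetric])
qed

text \<open>The coefficient of \<open>e\<^sup>m\<close> in \<open>\<Sum>\<^sub>a k(a) e\<^bsup>\<mu>(a)\<^esup>\<close>.\<close>

definition coef :: "'a set \<Rightarrow> ('a \<Rightarrow> 'b) \<Rightarrow> ('a \<Rightarrow> complex) \<Rightarrow> 'b \<Rightarrow> complex" where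
  "coef A \<mu> k m = (\<Sum>a | a \<in> A \<and> \<mu> a = m. k a)"

lemma coef_support:
  assumes "coef A \<mu> k m \<noteq> 0"
  shows "m \<in> \<mu> ` A"
proof (rule ccontr)
  assume "m \<notin> \<mu> ` A"
  then have *: "{a. a \<in> A \<and> \<mu> a = m} = {}" by blast
  show False using assms unfolding coef_def * by simp
qed

lemma coef_expansion:
  assumes "finite A" "finite S" "\<mu> ` A \<subseteq> S"
  shows "(\<Sum>a\<in>A. k a * F (\<mu> a)) = (\<Sum>m\<in>S. coef A \<mu> k m * F m)"
proof -
  have "(\<Sum>a\<in>A. k a * F (\<mu> a)) = (\<Sum>m\<in>S. \<Sum>a | a \<in> A \<and> \<mu> a = m. k a * F (\<mu> a))"
    by (rule sum.group[OF assms, symmetric])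
  also have "\<dots> = (\<Sum>m\<in>S. coef A \<mu> k m * F m)"
    by (intro sum.cong) (auto simp: coef_def sum_distrib_right)
  finally show ?thesis .
qed

lemma coef_antisymmetric:
  assumes "bij_betw \<tau> A A" and s: "\<And>m. s (s m) = m"
    and \<mu>: "\<And>a. a \<in> A \<Longrightarrow> \<mu> (\<tau> a) = s (\<mu> a)" and k: "\<And>a. a \<in> A \<Longrightarrow> k (\<tau> a) = - k a"
  shows "coef A \<mu> k (s m) = - coef A \<mu> k m"
proof -
  have inj: "inj_on \<tau> A" and im: "\<tau> ` A = A" using assms(1) by (auto simp: bij_betw_def)
  have "{a. a \<in> A \<and> \<mu> a = s m} = \<tau> ` {a. a \<in> A \<and> \<mu> a = m}"
  proof (intro equalityI subsetI)
    fix a assume a: "a \<in> {a. a \<in> A \<and> \<mu> a = s m}"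
    then obtain b where "b \<in> A" "a = \<tau> b" using im by blast
    moreover from this have "\<mu> b = m" using a \<mu>[of b] s by (metis (mono_tags, lifting) mem_Collect_eq)
    ultimately show "a \<in> \<tau> ` {a. a \<in> A \<and> \<mu> a = m}" by blast
  qed (use im \<mu> in auto)
  then show ?thesis
    unfolding coef_def using inj k
    by (simp add: sum.reindex inj_on_def sum_negf)
qed

context based_datum
begin

text \<open>
  Only the values of \<open>\<rho>\<close> on the coroots matter: \<open>\<rho>\<close> may differ from half the sum of the positive roots by a form
  that vanishes on all coroots, and this makes it possible to choose it integral.
\<close>

definition is_rho :: "('v \<Rightarrow>\<^sub>L real) \<Rightarrow> bool" where
  "is_rho \<rho> \<longleftrightarrow> \<rho> \<in> chars D \<and> (\<forall>i\<in>I. blinfun_apply \<rho> (cv (sr i)) = 1)"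

lemma chars_coroot_int: "f \<in> chars D \<Longrightarrow> \<alpha> \<in> \<Phi> \<Longrightarrow> blinfun_apply f (cv \<alpha>) \<in> \<int>"
  using coroot_cochars by (auto simp: chars_def)

text \<open>
  Among the weights \<open>m\<close> with \<open>C m \<noteq> 0\<close> take one with maximal value at \<open>\<delta>\<close>.  By maximality no simple reflection
  raises it, so it is dominant; by antisymmetry no simple reflection fixes it, so it is at least \<open>\<rho>\<close> on every
  simple coroot.  The bound by \<open>\<rho>(\<delta>)\<close> then leaves only \<open>\<rho>\<close> itself.
\<close>

lemma antisymmetric_eq_0:
  fixes C :: "('v \<Rightarrow>\<^sub>L real) \<Rightarrow> complex"
  assumes "is_rho \<rho>" and finS: "finite S" and supp: "\<And>m. C m \<noteq> 0 \<Longrightarrow> m \<in> S"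
    and anti: "\<And>i m. i \<in> I \<Longrightarrow> C (coreflect (sr i) m) = - C m"
    and S: "\<And>m. m \<in> S \<Longrightarrow> m \<in> chars D \<and> m - \<rho> \<in> span \<Phi> \<and> blinfun_apply m \<delta> \<le> blinfun_apply \<rho> \<delta>"
    and C\<rho>: "C \<rho> = 0"
  shows "C m = 0"
proof (rule ccontr)
  assume "C m \<noteq> 0"
  define S' where "S' = {m. C m \<noteq> 0}"
  have "finite S'" "S' \<noteq> {}" using finS supp \<open>C m \<noteq> 0\<close> by (auto simp: S'_def intro: finite_subset)
  define K where "K = Max ((\<lambda>m. blinfun_apply m \<delta>) ` S')"
  have "K \<in> (\<lambda>m. blinfun_apply m \<delta>) ` S'" unfolding K_def using \<open>finite S'\<close> \<open>S' \<noteq> {}\<close> by (intro Max_in) auto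
  then obtain \<mu> where \<mu>: "\<mu> \<in> S'" and K: "K = blinfun_apply \<mu> \<delta>" by blast
  have max: "blinfun_apply m \<delta> \<le> blinfun_apply \<mu> \<delta>" if "m \<in> S'" for m
    unfolding K[symmetric] K_def using that \<open>finite S'\<close> by (intro Max_ge) auto
  have C\<mu>: "C \<mu> \<noteq> 0" using \<mu> by (simp add: S'_def)
  note S\<mu> = S[OF supp[OF C\<mu>]]
  have reg: "blinfun_apply \<mu> (cv (sr i)) \<ge> 1" if i: "i \<in> I" for i
  proof -
    have "coreflect (sr i) \<mu> \<in> S'" using anti[OF i, of \<mu>] C\<mu> by (simp add: S'_def)
    from max[OF this] have ge: "0 \<le> blinfun_apply \<mu> (cv (sr i))"
      using i by (simp add: dual_reflection_def blinfun.diff_left blinfun.scaleR_left sr_delta)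
    have "blinfun_apply \<mu> (cv (sr i)) \<noteq> 0"
    proof
      assume "blinfun_apply \<mu> (cv (sr i)) = 0"
      then have "coreflect (sr i) \<mu> = \<mu>" by (simp add: dual_reflection_def)
      then show False using anti[OF i, of \<mu>] C\<mu> by simp
    qed
    moreover have "blinfun_apply \<mu> (cv (sr i)) \<in> \<int>" using S\<mu> i chars_coroot_int by simp
    ultimately show ?thesis using ge by (auto elim!: Ints_cases)
  qed
  define \<nu> where "\<nu> = \<mu> - \<rho>"
  have cod: "codominant \<nu>"
    using reg assms(1) by (auto simp: codominant_def \<nu>_def is_rho_def blinfun.diff_left)
  have nn: "0 \<le> blinfun_apply \<nu> (cv \<alpha>)" if "\<alpha> \<in> pos" for \<alpha>
    by (rule codominant_cone[OF cod pos_coroot_cone[OF that]])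
  have "(\<Sum>\<alpha>\<in>pos. blinfun_apply \<nu> (cv \<alpha>)) = blinfun_apply \<nu> \<delta>"
    by (simp add: two_rho_check_def blinfun.sum_right)
  also have "\<dots> = 0"
    using codominant_cone[OF cod delta_cone] S\<mu> by (simp add: \<nu>_def blinfun.diff_left)
  finally have "\<forall>\<alpha>\<in>pos. blinfun_apply \<nu> (cv \<alpha>) = 0"
    using nn by (subst (asm) sum_nonneg_eq_0_iff[OF finite_pos]) auto
  then have "blinfun_apply \<nu> (cv \<alpha>) = 0" if "\<alpha> \<in> \<Phi>" for \<alpha>
    using pos_or_neg[OF that] coroot_uminus[OF that] by (auto simp: blinfun.minus_right)
  then have "\<nu> = 0" using S\<mu> by (intro span_roots_eq_0) (simp_all add: \<nu>_def)
  then show False using C\<mu> C\<rho> by (simp add: \<nu>_def)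
qed

section \<open>The Weyl denominator\<close>

text \<open>
  The terms of \<open>e\<^sup>\<rho> \<Prod>\<^bsub>\<alpha> > 0\<^esub> (1 - e\<^bsup>-\<alpha>\<^esup>)\<close> are indexed by the sets \<open>S\<close> of positive roots from whose factors
  \<open>-e\<^bsup>-\<alpha>\<^esup>\<close> is chosen.
\<close>

definition denominator_weight :: "('v \<Rightarrow>\<^sub>L real) \<Rightarrow> ('v \<Rightarrow>\<^sub>L real) set \<Rightarrow> ('v \<Rightarrow>\<^sub>L real)" where
  "denominator_weight \<rho> S = \<rho> - (\<Sum>\<alpha>\<in>S. \<alpha>)"

definition denominator_coef :: "('v \<Rightarrow>\<^sub>L real) \<Rightarrow> ('v \<Rightarrow>\<^sub>L real) \<Rightarrow> complex" where
  "denominator_coef \<rho> = coef (Pow pos) (denominator_weight \<rho>) (\<lambda>S. (-1) ^ card S)"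

lemma denominator_product:
  "(\<Sum>S\<in>Pow pos. (-1) ^ card S * expi (blinfun_apply (denominator_weight \<rho> S) x))
    = expi (blinfun_apply \<rho> x) * (\<Prod>\<alpha>\<in>pos. 1 - expi (- blinfun_apply \<alpha> x))"
proof -
  have "expi (blinfun_apply (denominator_weight \<rho> S) x)
      = expi (blinfun_apply \<rho> x) * (\<Prod>\<alpha>\<in>S. expi (- blinfun_apply \<alpha> x))" if "S \<in> Pow pos" for S
  proof -
    have "finite S" using that finite_pos finite_subset by blast
    then show ?thesis
      by (simp add: denominator_weight_def blinfun.diff_left blinfun.sum_left
          expi_sum[symmetric] expi_add[symmetric] sum_negf)
  qed
  then show ?thesis
    by (simp add: prod_diff_conv_sum[OF finite_pos] sum_distrib_left algebra_simps)
qed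

text \<open>
  The reflection \<open>s\<^sub>i\<close> permutes the positive roots other than \<open>\<alpha>\<^sub>i\<close> and sends \<open>\<rho>\<close> to \<open>\<rho> - \<alpha>\<^sub>i\<close>.  Its effect on
  \<open>\<rho> - \<Sum>S\<close> is therefore to apply it to \<open>S - {\<alpha>\<^sub>i}\<close> and to toggle the membership of \<open>\<alpha>\<^sub>i\<close> in \<open>S\<close>, which
  changes the sign.
\<close>

lemma denominator_antisymmetric:
  assumes \<rho>: "is_rho \<rho>" and i: "i \<in> I"
  shows "denominator_coef \<rho> (coreflect (sr i) m) = - denominator_coef \<rho> m"
proof -
  let ?s = "coreflect (sr i)"
  \<comment> \<open>The sign-reversing involution on the sets of positive roots.\<close>
  define \<tau> where "\<tau> S = ?s ` (S - {sr i}) \<union> ({sr i} - S)" for S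
  have inv: "?s (?s f) = f" for f using i by simp
  have img: "?s ` (pos - {sr i}) = pos - {sr i}"
    using bij_coreflect_pos[OF i] by (simp add: bij_betw_def)
  have sub: "?s ` (S - {sr i}) \<subseteq> pos - {sr i}" if "S \<subseteq> pos" for S
    using that img by blast
  have \<tau>pos: "\<tau> S \<subseteq> pos" if "S \<subseteq> pos" for S
    using sub[OF that] i by (auto simp: \<tau>_def)
  have \<tau>\<tau>: "\<tau> (\<tau> S) = S" if "S \<subseteq> pos" for S
  proof -
    have "\<tau> S - {sr i} = ?s ` (S - {sr i})" "sr i \<in> \<tau> S \<longleftrightarrow> sr i \<notin> S"
      using sub[OF that] by (auto simp: \<tau>_def)
    then have "\<tau> (\<tau> S) = (S - {sr i}) \<union> (if sr i \<in> S then {sr i} else {})"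
      unfolding \<tau>_def[of "\<tau> S"] by (auto simp: image_image inv)
    then show ?thesis by auto
  qed
  have bij: "bij_betw \<tau> (Pow pos) (Pow pos)"
    by (rule bij_betw_byWitness[where f' = \<tau>]) (auto simp: \<tau>\<tau> dest: \<tau>pos)
  have inj: "inj_on ?s X" for X by (rule inj_on_inverseI[of _ ?s]) (rule inv)
  have sr\<rho>: "?s \<rho> = \<rho> - sr i" using \<rho> i by (simp add: is_rho_def dual_reflection_def)
  have lin: "linear ?s"
    by (rule linearI) (simp_all add: dual_reflection_def blinfun.add_left blinfun.scaleR_left algebra_simps)
  have main: "denominator_weight \<rho> (\<tau> S) = ?s (denominator_weight \<rho> S) \<and> (-1::complex) ^ card (\<tau> S) = - ((-1) ^ card S)"
    if S: "S \<in> Pow pos" for S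
  proof -
    have fS: "finite S" using S finite_pos finite_subset by blast
    have disj: "sr i \<notin> ?s ` (S - {sr i})" using sub S by blast
    have s1: "(\<Sum>\<alpha>\<in>?s ` (S - {sr i}). \<alpha>) = ?s (\<Sum>\<alpha>\<in>S - {sr i}. \<alpha>)"
      by (simp add: sum.reindex[OF inj] linear_sum[OF lin])
    have c1: "card (?s ` (S - {sr i})) = card (S - {sr i})" by (rule card_image[OF inj])
    show ?thesis
    proof (cases "sr i \<in> S")
      case True
      then have "\<tau> S = ?s ` (S - {sr i})" by (auto simp: \<tau>_def)
      moreover have "(\<Sum>\<alpha>\<in>S. \<alpha>) = sr i + (\<Sum>\<alpha>\<in>S - {sr i}. \<alpha>)" by (rule sum.remove[OF fS True])
      moreover have "card S = Suc (card (S - {sr i}))" using card.remove[OF fS True] by simp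
      ultimately show ?thesis
        by (simp add: denominator_weight_def s1 c1 linear_diff[OF lin] linear_add[OF lin] sr\<rho> sr_reflect_self[OF i])
    next
      case False
      then have "\<tau> S = insert (sr i) (?s ` (S - {sr i}))" "S - {sr i} = S" by (auto simp: \<tau>_def)
      with False s1 c1 disj fS show ?thesis
        by (simp add: denominator_weight_def linear_diff[OF lin] sr\<rho>)
    qed
  qed
  show ?thesis unfolding denominator_coef_def
    by (rule coef_antisymmetric[OF bij inv]) (use main in blast)+
qed

lemma denominator_coef_rho: "denominator_coef \<rho> \<rho> = 1"
proof -
  have "S = {}" if "S \<subseteq> pos" "denominator_weight \<rho> S = \<rho>" for S
  proof (rule ccontr)
    assume "S \<noteq> {}"
    have "finite S" using that finite_pos finite_subset by blast
    then have "0 < (\<Sum>\<alpha>\<in>S. blinfun_apply \<alpha> \<delta>)"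
      using that pos_delta \<open>S \<noteq> {}\<close> by (intro sum_pos) auto
    moreover have "blinfun_apply (\<Sum>\<alpha>\<in>S. \<alpha>) \<delta> = 0" using that(2) by (simp add: denominator_weight_def)
    ultimately show False by (simp add: blinfun.sum_left)
  qed
  then have "{S. S \<in> Pow pos \<and> denominator_weight \<rho> S = \<rho>} = {{}}"
    by (auto simp: denominator_weight_def)
  then show ?thesis by (simp add: denominator_coef_def coef_def)
qed

lemma denominator_support:
  assumes "is_rho \<rho>" "S \<subseteq> pos"
  shows "denominator_weight \<rho> S \<in> chars D \<and> denominator_weight \<rho> S - \<rho> \<in> span \<Phi>
    \<and> blinfun_apply (denominator_weight \<rho> S) \<delta> \<le> blinfun_apply \<rho> \<delta>"
proof (intro conjI)
  show "denominator_weight \<rho> S \<in> chars D"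
    using assms roots_chars pos_root unfolding is_rho_def chars_def denominator_weight_def
    by (auto simp: blinfun.diff_left blinfun.sum_left intro!: Ints_diff Ints_sum)
  have "- (\<Sum>\<alpha>\<in>S. \<alpha>) \<in> span \<Phi>" using assms pos_root by (intro span_neg span_sum span_base) auto
  then show "denominator_weight \<rho> S - \<rho> \<in> span \<Phi>" by (simp add: denominator_weight_def)
  have "0 \<le> (\<Sum>\<alpha>\<in>S. blinfun_apply \<alpha> \<delta>)" using assms pos_delta by (intro sum_nonneg) (auto dest!: subsetD less_imp_le)
  then show "blinfun_apply (denominator_weight \<rho> S) \<delta> \<le> blinfun_apply \<rho> \<delta>"
    by (simp add: denominator_weight_def blinfun.diff_left blinfun.sum_left)
qed

end

section \<open>Integrality of the Weyl group action\<close>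

lemma int_span_add:
  assumes "x \<in> int_span B" "y \<in> int_span B"
  shows "x + y \<in> int_span B"
proof -
  obtain c d :: "'a \<Rightarrow> int" where "x = (\<Sum>s\<in>B. of_int (c s) *\<^sub>R s)" "y = (\<Sum>s\<in>B. of_int (d s) *\<^sub>R s)"
    using assms unfolding int_span_def by blast
  then have "x + y = (\<Sum>s\<in>B. of_int (c s + d s) *\<^sub>R s)" by (simp add: scaleR_add_left sum.distrib)
  then show ?thesis unfolding int_span_def by (intro CollectI exI[of _ "\<lambda>s. c s + d s"]) simp
qed

lemma int_span_scale:
  assumes "x \<in> int_span B"
  shows "of_int n *\<^sub>R x \<in> int_span B"
proof -
  obtain c :: "'a \<Rightarrow> int" where "x = (\<Sum>s\<in>B. of_int (c s) *\<^sub>R s)"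
    using assms unfolding int_span_def by blast
  then have "of_int n *\<^sub>R x = (\<Sum>s\<in>B. of_int (n * c s) *\<^sub>R s)" by (simp add: scaleR_sum_right)
  then show ?thesis unfolding int_span_def by (intro CollectI exI[of _ "\<lambda>s. n * c s"]) simp
qed

context based_datum
begin

lemma cochars_add: "x \<in> cochars D \<Longrightarrow> y \<in> cochars D \<Longrightarrow> x + y \<in> cochars D"
  and cochars_scale: "x \<in> cochars D \<Longrightarrow> of_int n *\<^sub>R x \<in> cochars D"
proof -
  have "full_lattice (cochars D)" using reduced by (simp add: reduced_root_datum_def)
  then obtain B where B: "cochars D = int_span B" by (auto simp: full_lattice_def)
  show "x \<in> cochars D \<Longrightarrow> y \<in> cochars D \<Longrightarrow> x + y \<in> cochars D"
    unfolding B by (rule int_span_add)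
  show "x \<in> cochars D \<Longrightarrow> of_int n *\<^sub>R x \<in> cochars D"
    unfolding B by (rule int_span_scale)
qed

lemma cochars_diff: "x \<in> cochars D \<Longrightarrow> y \<in> cochars D \<Longrightarrow> x - y \<in> cochars D"
  using cochars_add[OF _ cochars_scale[of y "-1"], of x] by simp

lemma weyl_cochars: "w \<in> W \<Longrightarrow> x \<in> cochars D \<Longrightarrow> w x \<in> cochars D"
proof (induction rule: weyl_group.induct)
  case one
  then show ?case by simp
next
  case (step \<alpha> w)
  have "blinfun_apply \<alpha> (w x) \<in> \<int>" using step root_apply_int by blast
  then obtain n :: int where n: "blinfun_apply \<alpha> (w x) = of_int n" by (elim Ints_cases)
  have "w x - of_int n *\<^sub>R cv \<alpha> \<in> cochars D"
    using step coroot_cochars cochars_scale cochars_diff by blast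
  then show ?case by (simp add: reflection_def n)
qed

lemma pull_chars: "w \<in> W \<Longrightarrow> f \<in> chars D \<Longrightarrow> pull w f \<in> chars D"
  using weyl_cochars by (auto simp: chars_def)

text \<open>
  A dominant form is fixed by every \<open>w\<close> that does not lower its value at the interior point \<open>\<delta>\<close> of the
  dominant chamber: \<open>f - f \<circ> w\<close> is nonnegative on that chamber, and a linear form that is nonnegative on a
  cone and vanishes at an interior point is zero.
\<close>

lemma codominant_fixed:
  assumes f: "codominant f" and w: "w \<in> W" and eq: "blinfun_apply f (w \<delta>) = blinfun_apply f \<delta>"
  shows "pull w f = f"
proof (rule blinfun_eqI)
  fix y
  \<comment> \<open>\<open>c\<close> is so large that \<open>c \<delta> \<plusminus> y\<close> are both dominant.\<close>
  define c where "c = (\<Sum>i\<in>I. \<bar>blinfun_apply (sr i) y\<bar>)"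
  have bound: "\<bar>blinfun_apply (sr i) y\<bar> \<le> 2 * c" if "i \<in> I" for i
  proof -
    have "\<bar>blinfun_apply (sr i) y\<bar> \<le> c" unfolding c_def
      by (rule member_le_sum[OF that]) simp_all
    then show ?thesis by linarith
  qed
  have dom: "dominant (c *\<^sub>R \<delta> + y)" "dominant (c *\<^sub>R \<delta> - y)"
    unfolding dominant_def
    using bound by (fastforce simp: blinfun.add_right blinfun.diff_right blinfun.scaleR_right sr_delta)+
  have lin: "w (c *\<^sub>R \<delta> + y) = c *\<^sub>R w \<delta> + w y" "w (c *\<^sub>R \<delta> - y) = c *\<^sub>R w \<delta> - w y"
    using weyl_linear[OF w] by (simp_all add: linear_add linear_diff linear_scale)
  have "0 \<le> blinfun_apply f ((c *\<^sub>R \<delta> + y) - w (c *\<^sub>R \<delta> + y))"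
    "0 \<le> blinfun_apply f ((c *\<^sub>R \<delta> - y) - w (c *\<^sub>R \<delta> - y))"
    using codominant_cone[OF f dominant_weyl_le[OF _ w]] dom by blast+
  then show "blinfun_apply (pull w f) y = blinfun_apply f y"
    using w unfolding lin by (simp add: blinfun.add_right blinfun.diff_right blinfun.scaleR_right eq)
qed

end

section \<open>The Jacobian of the orbit sums\<close>

locale weighted_datum = based_datum D for D :: "'v::real_normed_vector based_root_datum" +
  fixes \<omega> :: "nat \<Rightarrow> ('v \<Rightarrow>\<^sub>L real)"
  assumes weights: "extends_fundamental_weights D \<omega>"
begin

abbreviation "l \<equiv> ss_rank D"

text \<open>
  The weights and the simple roots are numbered from \<open>0\<close>, as the rows and columns of matrices are.
\<close>

definition om :: "nat \<Rightarrow> ('v \<Rightarrow>\<^sub>L real)" where "om i = \<omega> (Suc i)"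
definition al :: "nat \<Rightarrow> ('v \<Rightarrow>\<^sub>L real)" where "al j = sr (Suc j)"

lemma I_eq: "I = Suc ` {0..<l}"
  by (simp add: I_def image_Suc_atLeastLessThan atLeastLessThanSuc_atLeastAtMost)

lemma I_cases: "i \<in> I \<Longrightarrow> \<exists>k<l. i = Suc k \<and> sr i = al k"
  by (auto simp only: I_eq al_def image_iff Bex_def atLeastLessThan_iff)

lemma al_root [simp]: "j < l \<Longrightarrow> al j \<in> \<Phi>"
  using sr_root by (simp add: al_def I_def)

lemma om_chars: "i < l \<Longrightarrow> om i \<in> chars D"
  and om_al: "i < l \<Longrightarrow> j < l \<Longrightarrow> blinfun_apply (om i) (cv (al j)) = (if i = j then 1 else 0)"
  using weights unfolding extends_fundamental_weights_def om_def al_def simple_coroot_def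
  by auto

lemma om_codominant: "i < l \<Longrightarrow> codominant (om i)"
  unfolding codominant_def by (auto dest!: I_cases simp: om_al)

definition rho :: "'v \<Rightarrow>\<^sub>L real" where
  "rho = (\<Sum>i\<in>{0..<l}. om i)"

lemma is_rho_rho: "is_rho rho"
proof -
  have "rho \<in> chars D"
    using om_chars by (auto simp: rho_def chars_def blinfun.sum_left intro!: Ints_sum)
  moreover have "blinfun_apply rho (cv (al j)) = 1" if "j < l" for j
    using that by (simp add: rho_def blinfun.sum_left om_al)
  ultimately show ?thesis unfolding is_rho_def by (auto dest!: I_cases)
qed

text \<open>
  \<open>orbit_form i x\<close> is, up to the factor \<open>2\<pi>\<i>\<close>, the differential at \<open>x\<close> of the \<open>W\<close>-invariant
  exponential sum \<open>\<Sum>\<^sub>w e(\<omega>\<^sub>i(w x))\<close>.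
\<close>

definition orbit_form :: "nat \<Rightarrow> 'v \<Rightarrow> 'v \<Rightarrow> complex" where
  "orbit_form i x v = (\<Sum>w\<in>W. of_real (blinfun_apply (om i) (w v)) * expi (blinfun_apply (om i) (w x)))"

definition jacobian :: "'v \<Rightarrow> complex mat" where
  "jacobian x = mat l l (\<lambda>(i, j). orbit_form i x (cv (al j)))"

text \<open>
  Expanding the Jacobian determinant along its rows, each of which is a sum over \<open>W\<close>, yields one term for each
  choice of a Weyl group element for every row.
\<close>

definition tuples :: "(nat \<Rightarrow> 'v \<Rightarrow> 'v) set" where
  "tuples = PiE {0..<l} (\<lambda>_. W)"

definition tuple_det :: "(nat \<Rightarrow> 'v \<Rightarrow> 'v) \<Rightarrow> complex" where
  "tuple_det t = Determinant.det (mat l l (\<lambda>(i, j). of_real (blinfun_apply (om i) (t i (cv (al j))))))"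

definition tuple_weight :: "(nat \<Rightarrow> 'v \<Rightarrow> 'v) \<Rightarrow> ('v \<Rightarrow>\<^sub>L real)" where
  "tuple_weight t = (\<Sum>i\<in>{0..<l}. pull (t i) (om i))"

lemma tuples_weyl: "t \<in> tuples \<Longrightarrow> i < l \<Longrightarrow> t i \<in> W"
  by (auto simp: tuples_def)

lemma finite_tuples: "finite tuples"
  by (simp add: tuples_def finite_PiE finite_weyl)

lemma det_jacobian_expansion:
  "Determinant.det (jacobian x) = (\<Sum>t\<in>tuples. tuple_det t * expi (blinfun_apply (tuple_weight t) x))"
proof -
  let ?P = "{p. p permutes {0..<l}}"
  let ?a = "\<lambda>t p. \<Prod>i = 0..<l. complex_of_real (blinfun_apply (om i) (t i (cv (al (p i)))))"
  have lt: "p i < l" if "p \<in> ?P" "i \<in> {0..<l}" for p i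
    using that permutes_in_image[of p "{0..<l}" i] by simp
  have "Determinant.det (jacobian x)
    = (\<Sum>p\<in>?P. of_int (sign p) * (\<Prod>i = 0..<l. orbit_form i x (cv (al (p i)))))"
    by (subst det_def'[of _ l]) (auto simp: jacobian_def lt intro!: sum.cong prod.cong)
  also have "\<dots> = (\<Sum>p\<in>?P. of_int (sign p) * (\<Sum>t\<in>tuples. ?a t p * (\<Prod>i = 0..<l. expi (blinfun_apply (om i) (t i x)))))"
    unfolding orbit_form_def tuples_def
    by (subst prod_sum_PiE) (simp_all add: finite_weyl prod.distrib)
  also have "\<dots> = (\<Sum>t\<in>tuples. (\<Sum>p\<in>?P. of_int (sign p) * ?a t p) * (\<Prod>i = 0..<l. expi (blinfun_apply (om i) (t i x))))"
    unfolding sum_distrib_left sum_distrib_right by (subst sum.swap) (simp add: mult.assoc)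
  also have "\<dots> = (\<Sum>t\<in>tuples. tuple_det t * expi (blinfun_apply (tuple_weight t) x))"
  proof (intro sum.cong refl arg_cong2[of _ _ _ _ "(*)"])
    fix t assume t: "t \<in> tuples"
    show "(\<Sum>p\<in>?P. of_int (sign p) * ?a t p) = tuple_det t"
      unfolding tuple_det_def
      by (subst det_def'[of _ l]) (auto simp: lt intro!: sum.cong prod.cong)
    show "(\<Prod>i = 0..<l. expi (blinfun_apply (om i) (t i x))) = expi (blinfun_apply (tuple_weight t) x)"
      using tuples_weyl[OF t] by (simp add: tuple_weight_def blinfun.sum_left expi_sum)
  qed
  finally show ?thesis .
qed

text \<open>The reflection in the \<open>k\<close>-th basis vector has determinant \<open>-1\<close>: its matrix is the identity matrix outside
  row \<open>k\<close>, so only the identity permutation contributes.\<close>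

lemma det_reflection_matrix:
  fixes a :: "nat \<Rightarrow> complex"
  assumes k: "k < n" and a: "a k = 2"
  shows "Determinant.det (mat n n (\<lambda>(i, j). (if i = j then 1 else 0) - (if i = k then a j else 0))) = -1"
    (is "Determinant.det ?A = _")
proof -
  have z: "(\<Prod>i = 0..<n. ?A $$ (i, p i)) = 0" if p: "p permutes {0..<n}" and ne: "p \<noteq> id" for p
  proof -
    have "\<exists>i<n. i \<noteq> k \<and> p i \<noteq> i"
    proof (rule ccontr)
      assume n: "\<not> (\<exists>i<n. i \<noteq> k \<and> p i \<noteq> i)"
      have fix': "p i = i" if "i \<noteq> k" for i
        using n that permutes_not_in[OF p, of i] by (cases "i < n") auto
      have "p k = k" using fix' permutes_inj[OF p] by (metis injD)
      then have "p x = id x" for x using fix'[of x] by (cases "x = k") simp_all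
      then show False using ne by blast
    qed
    then obtain i where i: "i < n" "i \<noteq> k" "p i \<noteq> i" by blast
    have "p i < n" using permutes_in_image[OF p, of i] i by simp
    then have "?A $$ (i, p i) = 0" using i by simp
    then show ?thesis using i(1) by (intro prod_zero bexI[of _ i]) auto
  qed
  have "Determinant.det ?A = (\<Sum>p | p permutes {0..<n}. of_int (sign p) * (\<Prod>i = 0..<n. ?A $$ (i, p i)))"
    by (rule det_def') simp
  also have "\<dots> = (\<Sum>p\<in>{id}. of_int (sign p) * (\<Prod>i = 0..<n. ?A $$ (i, p i)))"
    by (rule sum.mono_neutral_right) (auto simp: finite_permutations permutes_id z simp del: index_mat)
  also have "\<dots> = (\<Prod>i = 0..<n. ?A $$ (i, i))" by simp
  also have "\<dots> = (\<Prod>i = 0..<n. if i = k then -1 else 1)"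
    using a by (intro prod.cong) auto
  also have "\<dots> = -1" using k by (simp add: prod.delta)
  finally show ?thesis .
qed

lemma tuple_det_reflect:
  assumes t: "t \<in> tuples" and k: "k < l"
  shows "tuple_det (\<lambda>i\<in>{0..<l}. t i \<circ> reflect (al k)) = - tuple_det t"
proof -
  let ?T = "mat l l (\<lambda>(i, j). complex_of_real (blinfun_apply (om i) (t i (cv (al j)))))"
  let ?S = "mat l l (\<lambda>(i, j). (if i = j then 1 else 0) - (if i = k then complex_of_real (blinfun_apply (al k) (cv (al j))) else 0))"
  have "mat l l (\<lambda>(i, j). complex_of_real (blinfun_apply (om i) ((\<lambda>i\<in>{0..<l}. t i \<circ> reflect (al k)) i (cv (al j))))) = ?T * ?S"
  proof (rule eq_matI)
    fix i j assume "i < dim_row (?T * ?S)" "j < dim_col (?T * ?S)"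
    then have i: "i < l" and j: "j < l" by auto
    have "t i (reflect (al k) (cv (al j))) = t i (cv (al j)) - blinfun_apply (al k) (cv (al j)) *\<^sub>R t i (cv (al k))"
      using weyl_linear[OF tuples_weyl[OF t i]] by (simp add: reflection_def linear_diff linear_scale)
    then have *: "blinfun_apply (om i) (t i (reflect (al k) (cv (al j))))
      = blinfun_apply (om i) (t i (cv (al j))) - blinfun_apply (al k) (cv (al j)) * blinfun_apply (om i) (t i (cv (al k)))"
      by (simp add: blinfun.diff_right blinfun.scaleR_right)
    have "(?T * ?S) $$ (i, j) = (\<Sum>m\<in>{0..<l}. complex_of_real (blinfun_apply (om i) (t i (cv (al m)))) *
       ((if m = j then 1 else 0) - (if m = k then complex_of_real (blinfun_apply (al k) (cv (al j))) else 0)))"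
      using i j by (simp add: scalar_prod_def)
    also have "\<dots> = (\<Sum>m\<in>{0..<l}. (if m = j then complex_of_real (blinfun_apply (om i) (t i (cv (al m)))) else 0)
        - (if m = k then complex_of_real (blinfun_apply (om i) (t i (cv (al m)))) * complex_of_real (blinfun_apply (al k) (cv (al j))) else 0))"
      by (intro sum.cong) (auto simp: algebra_simps)
    also have "\<dots> = complex_of_real (blinfun_apply (om i) (t i (reflect (al k) (cv (al j)))))"
      unfolding sum_subtractf using j k by (simp add: * sum.delta)
    finally show "mat l l (\<lambda>(i, j). complex_of_real (blinfun_apply (om i) ((\<lambda>i\<in>{0..<l}. t i \<circ> reflect (al k)) i (cv (al j))))) $$ (i, j)
        = (?T * ?S) $$ (i, j)"
      using i j by simp
  qed simp_all
  moreover have "Determinant.det (?T * ?S) = Determinant.det ?T * Determinant.det ?S"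
    by (rule det_mult) auto
  moreover have "Determinant.det ?S = -1"
    by (rule det_reflection_matrix[OF k]) (simp add: k)
  ultimately show ?thesis unfolding tuple_det_def by simp
qed

definition jacobian_coef :: "('v \<Rightarrow>\<^sub>L real) \<Rightarrow> complex" where
  "jacobian_coef = coef tuples tuple_weight tuple_det"

text \<open>
  Multiplying every member of a tuple by \<open>s\<^sub>k\<close> on the right reflects its weight and changes the sign of its
  determinant.
\<close>

lemma jacobian_coef_antisymmetric:
  assumes k: "k < l"
  shows "jacobian_coef (coreflect (al k) m) = - jacobian_coef m"
proof -
  define \<tau> where "\<tau> t = (\<lambda>i\<in>{0..<l}. t i \<circ> reflect (al k))" for t :: "nat \<Rightarrow> 'v \<Rightarrow> 'v"
  have "\<tau> t \<in> tuples" if "t \<in> tuples" for t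
    using that k by (auto simp: \<tau>_def tuples_def intro!: weyl_comp weyl_reflect)
  moreover have "\<tau> (\<tau> t) = t" if "t \<in> tuples" for t
    using that k by (auto simp: \<tau>_def tuples_def fun_eq_iff PiE_def extensional_def)
  ultimately have bij: "bij_betw \<tau> tuples tuples"
    by (intro bij_betw_byWitness[where f' = \<tau>]) auto
  have inv: "coreflect (al k) (coreflect (al k) m) = m" for m using k by simp
  have weight: "tuple_weight (\<tau> t) = coreflect (al k) (tuple_weight t)" if "t \<in> tuples" for t
  proof (rule blinfun_eqI)
    fix x
    have "t i \<circ> reflect (al k) \<in> W" "t i \<in> W" if "i < l" for i
      using weyl_comp[OF tuples_weyl[OF \<open>t \<in> tuples\<close> that] weyl_reflect[OF al_root[OF k]]]
        tuples_weyl[OF \<open>t \<in> tuples\<close> that] by blast+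
    then show "blinfun_apply (tuple_weight (\<tau> t)) x = blinfun_apply (coreflect (al k) (tuple_weight t)) x"
      by (simp add: \<tau>_def tuple_weight_def blinfun.sum_left coreflect_apply del: o_apply)
         (auto intro!: sum.cong)
  qed
  have det: "tuple_det (\<tau> t) = - tuple_det t" if "t \<in> tuples" for t
    unfolding \<tau>_def by (rule tuple_det_reflect[OF that k])
  show ?thesis unfolding jacobian_coef_def
    by (rule coef_antisymmetric[where \<tau> = \<tau> and s = "coreflect (al k)"]) (fact bij inv weight det)+
qed

lemma tuple_weight_delta:
  assumes t: "t \<in> tuples"
  shows "blinfun_apply (tuple_weight t) \<delta> \<le> blinfun_apply rho \<delta>"
    and "blinfun_apply (tuple_weight t) \<delta> = blinfun_apply rho \<delta> \<Longrightarrow> i < l \<Longrightarrow> pull (t i) (om i) = om i"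
proof -
  have nn: "0 \<le> blinfun_apply (om i) \<delta> - blinfun_apply (om i) (t i \<delta>)" if "i < l" for i
    using codominant_cone[OF om_codominant[OF that] dominant_weyl_le[OF dominant_delta tuples_weyl[OF t that]]]
    by (simp add: blinfun.diff_right)
  have d: "blinfun_apply rho \<delta> - blinfun_apply (tuple_weight t) \<delta>
     = (\<Sum>i\<in>{0..<l}. blinfun_apply (om i) \<delta> - blinfun_apply (om i) (t i \<delta>))"
    using tuples_weyl[OF t] by (simp add: rho_def tuple_weight_def blinfun.sum_left sum_subtractf)
  also have "\<dots> \<ge> 0" using nn by (intro sum_nonneg) auto
  finally show "blinfun_apply (tuple_weight t) \<delta> \<le> blinfun_apply rho \<delta>" by simp
  assume eq: "blinfun_apply (tuple_weight t) \<delta> = blinfun_apply rho \<delta>" and i: "i < l"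
  have "(\<Sum>i\<in>{0..<l}. blinfun_apply (om i) \<delta> - blinfun_apply (om i) (t i \<delta>)) = 0"
    using d eq by simp
  then have "blinfun_apply (om i) \<delta> - blinfun_apply (om i) (t i \<delta>) = 0"
    using nn i by (subst (asm) sum_nonneg_eq_0_iff) auto
  then show "pull (t i) (om i) = om i"
    using codominant_fixed[OF om_codominant[OF i] tuples_weyl[OF t i]] by simp
qed

lemma tuple_support:
  assumes t: "t \<in> tuples"
  shows "tuple_weight t \<in> chars D \<and> tuple_weight t - rho \<in> span \<Phi>
    \<and> blinfun_apply (tuple_weight t) \<delta> \<le> blinfun_apply rho \<delta>"
proof (intro conjI tuple_weight_delta(1)[OF t])
  have "blinfun_apply (pull (t i) (om i)) x \<in> \<int>" if "x \<in> cochars D" "i \<in> {0..<l}" for i x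
    using pull_chars[OF tuples_weyl[OF t] om_chars] that unfolding chars_def by auto
  then show "tuple_weight t \<in> chars D"
    by (auto simp: chars_def tuple_weight_def blinfun.sum_left simp del: pull_apply intro!: Ints_sum)
  have "tuple_weight t - rho = (\<Sum>i\<in>{0..<l}. pull (t i) (om i) - om i)"
    by (simp add: tuple_weight_def rho_def sum_subtractf)
  also have "\<dots> \<in> span \<Phi>" using pull_diff[OF tuples_weyl[OF t]] by (intro span_sum) auto
  finally show "tuple_weight t - rho \<in> span \<Phi>" .
qed

text \<open>
  A tuple with weight \<open>\<rho>\<close> attains the maximal value at \<open>\<delta>\<close>, so each of its members fixes the weight of its row.
  Its determinant is then that of the pairing of the fundamental weights with the simple coroots, which is \<open>1\<close>, and
  no cancellation can occur.
\<close>

lemma jacobian_coef_rho: "jacobian_coef rho \<noteq> 0"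
proof -
  define T where "T = {t. t \<in> tuples \<and> tuple_weight t = rho}"
  have "tuple_det t = 1" if "t \<in> T" for t
  proof -
    have t: "t \<in> tuples" and w: "tuple_weight t = rho" using that by (auto simp: T_def)
    have "blinfun_apply (om i) (t i x) = blinfun_apply (om i) x" if "i < l" for i x
      using arg_cong[OF tuple_weight_delta(2)[OF t _ that], of "\<lambda>f. blinfun_apply f x"] w tuples_weyl[OF t that]
      by simp
    then have "mat l l (\<lambda>(i, j). complex_of_real (blinfun_apply (om i) (t i (cv (al j))))) = 1\<^sub>m l"
      by (intro eq_matI) (auto simp: om_al)
    then show ?thesis unfolding tuple_det_def by simp
  qed
  then have "jacobian_coef rho = of_nat (card T)"
    by (simp add: jacobian_coef_def coef_def T_def)
  moreover have "(\<lambda>i\<in>{0..<l}. id) \<in> T"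
  proof -
    have "(\<lambda>i\<in>{0..<l}. id) \<in> tuples" by (auto simp: tuples_def weyl_group.one)
    moreover have "tuple_weight (\<lambda>i\<in>{0..<l}. id) = rho"
      unfolding tuple_weight_def rho_def by (intro sum.cong) (simp_all only: restrict_apply if_True pull_id)
    ultimately show ?thesis by (simp add: T_def)
  qed
  moreover have "finite T" using finite_tuples by (simp add: T_def)
  ultimately show ?thesis by (metis card_gt_0_iff empty_iff less_irrefl of_nat_eq_0_iff)
qed

text \<open>
  The Jacobian and the Weyl denominator, scaled to agree at \<open>\<rho>\<close>, differ by an antisymmetric sum whose coefficient
  at \<open>\<rho>\<close> is zero.
\<close>

theorem det_jacobian:
  "Determinant.det (jacobian x)
    = jacobian_coef rho * expi (blinfun_apply rho x) * (\<Prod>\<alpha>\<in>pos. 1 - expi (- blinfun_apply \<alpha> x))"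
proof -
  define C where "C m = jacobian_coef m - jacobian_coef rho * denominator_coef rho m" for m
  define S where "S = tuple_weight ` tuples \<union> denominator_weight rho ` Pow pos"
  have finS: "finite S" using finite_tuples finite_pos by (simp add: S_def)
  have C0: "C m = 0" for m
  proof (rule antisymmetric_eq_0[OF is_rho_rho finS, where C = C])
    show "m \<in> S" if "C m \<noteq> 0" for m
      using that coef_support[of tuples tuple_weight tuple_det m]
        coef_support[of "Pow pos" "denominator_weight rho" "\<lambda>S. (-1) ^ card S" m]
      unfolding S_def C_def jacobian_coef_def denominator_coef_def
      by (cases "coef tuples tuple_weight tuple_det m = 0") auto
    show "C (coreflect (sr i) m) = - C m" if "i \<in> I" for i m
    proof -
      obtain k where "k < l" "sr i = al k" using I_cases[OF \<open>i \<in> I\<close>] by blast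
      then show ?thesis
        using jacobian_coef_antisymmetric denominator_antisymmetric[OF is_rho_rho \<open>i \<in> I\<close>]
        by (simp add: C_def)
    qed
    show "m \<in> chars D \<and> m - rho \<in> span \<Phi> \<and> blinfun_apply m \<delta> \<le> blinfun_apply rho \<delta>" if "m \<in> S" for m
      using that tuple_support denominator_support[OF is_rho_rho] by (auto simp only: S_def)
    show "C rho = 0" by (simp add: C_def denominator_coef_rho)
  qed
  have "Determinant.det (jacobian x) = (\<Sum>m\<in>S. jacobian_coef m * expi (blinfun_apply m x))"
    unfolding det_jacobian_expansion jacobian_coef_def
    by (rule coef_expansion[OF finite_tuples finS, where F = "\<lambda>m. expi (blinfun_apply m x)"]) (simp add: S_def)
  also have "\<dots> = jacobian_coef rho * (\<Sum>m\<in>S. denominator_coef rho m * expi (blinfun_apply m x))"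
    unfolding sum_distrib_left
  proof (rule sum.cong[OF refl])
    fix m
    have "jacobian_coef m = jacobian_coef rho * denominator_coef rho m" using C0[of m] by (simp add: C_def)
    then show "jacobian_coef m * expi (blinfun_apply m x)
        = jacobian_coef rho * (denominator_coef rho m * expi (blinfun_apply m x))"
      by (simp only: mult.assoc)
  qed
  also have "(\<Sum>m\<in>S. denominator_coef rho m * expi (blinfun_apply m x))
      = (\<Sum>S\<in>Pow pos. (-1) ^ card S * expi (blinfun_apply (denominator_weight rho S) x))"
    unfolding denominator_coef_def
    by (rule coef_expansion[OF _ finS, where F = "\<lambda>m. expi (blinfun_apply m x)", symmetric])
       (auto simp: S_def finite_pos)
  also have "\<dots> = expi (blinfun_apply rho x) * (\<Prod>\<alpha>\<in>pos. 1 - expi (- blinfun_apply \<alpha> x))"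
    by (rule denominator_product)
  finally show ?thesis by (simp add: mult.assoc)
qed

corollary det_jacobian_regular:
  assumes "x \<in> regular_points D"
  shows "Determinant.det (jacobian x) \<noteq> 0"
proof -
  have "1 - expi (- blinfun_apply \<alpha> x) \<noteq> 0" if "\<alpha> \<in> pos" for \<alpha>
  proof -
    have "blinfun_apply \<alpha> x \<notin> \<int>"
      using assms pos_root[OF that] by (auto simp: regular_points_def elim!: Ints_cases)
    then show ?thesis using expi_eq_1[of "- blinfun_apply \<alpha> x"] by auto
  qed
  then show ?thesis unfolding det_jacobian using jacobian_coef_rho finite_pos by simp
qed

end

section \<open>Linear algebra on the span of the coroots\<close>

text \<open>
  Some summand of the Leibniz expansion is nonzero.  This converts nonsingularity into the bijections by which
  eigenvalues are matched and counted below.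
\<close>

lemma nonsingular_transversal:
  fixes A :: "complex mat"
  assumes A: "A \<in> carrier_mat n n" and det: "Determinant.det A \<noteq> 0"
  obtains p where "p permutes {0..<n}" "\<And>i. i < n \<Longrightarrow> A $$ (i, p i) \<noteq> 0"
proof -
  have "\<exists>p. p permutes {0..<n} \<and> (\<forall>i<n. A $$ (i, p i) \<noteq> 0)"
  proof (rule ccontr)
    assume n: "\<not> (\<exists>p. p permutes {0..<n} \<and> (\<forall>i<n. A $$ (i, p i) \<noteq> 0))"
    have "(\<Prod>i = 0..<n. A $$ (i, p i)) = 0" if "p permutes {0..<n}" for p
      using n that by (intro prod_zero) (fastforce simp: Bex_def)+
    then have "of_int (sign p) * (\<Prod>i = 0..<n. A $$ (i, p i)) = 0" if "p permutes {0..<n}" for p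
      using that by (simp only: mult_zero_right)
    then have "Determinant.det A = 0" unfolding det_def'[OF A] by (intro sum.neutral) blast
    then show False using det by simp
  qed
  then show ?thesis using that by blast
qed

lemma independent_Un_direct:
  fixes B C :: "'a::real_vector set"
  assumes B: "finite B" "independent B" and C: "finite C" "independent C"
    and int: "span B \<inter> span C \<subseteq> {0}"
  shows "independent (B \<union> C)" "B \<inter> C = {}"
proof -
  show disj: "B \<inter> C = {}"
  proof (rule ccontr)
    assume "B \<inter> C \<noteq> {}"
    then obtain x where "x \<in> B" "x \<in> C" by blast
    then have "x = 0" using int span_base by blast
    then show False using B(2) \<open>x \<in> B\<close> dependent_zero by blast
  qed
  show "independent (B \<union> C)"
  proof (rule independent_if_scalars_zero)
    fix f x assume s: "(\<Sum>x\<in>B \<union> C. f x *\<^sub>R x) = 0" and x: "x \<in> B \<union> C"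
    let ?b = "\<Sum>x\<in>B. f x *\<^sub>R x" and ?c = "\<Sum>x\<in>C. f x *\<^sub>R x"
    have sum: "?b + ?c = 0" using s by (simp add: sum.union_disjoint[OF B(1) C(1) disj])
    then have "?b = - ?c" by (simp add: eq_neg_iff_add_eq_0)
    moreover have "?b \<in> span B" "- ?c \<in> span C"
      by (auto intro!: span_neg span_sum span_scale intro: span_base)
    ultimately have "?b = 0" using int by auto
    moreover from this have "?c = 0" using sum by simp
    ultimately show "f x = 0"
      using x independentD[OF B(2) B(1) subset_refl] independentD[OF C(2) C(1) subset_refl] by blast
  qed (use B C in simp)
qed

context weighted_datum
begin

lemma finite_dimensional: "\<exists>B :: 'v set. finite B \<and> span B = UNIV"
  using reduced unfolding reduced_root_datum_def full_lattice_def by auto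

lemma independent_finite: "independent (B :: 'v set) \<Longrightarrow> finite B"
  using finite_dimensional independent_span_bound by (metis subset_UNIV)

lemma dim_direct_sum:
  assumes S: "subspace (S :: 'v set)" and T: "subspace T" and int: "S \<inter> T \<subseteq> {0}"
    and sum: "\<And>x. x \<in> U \<Longrightarrow> \<exists>y\<in>S. x - y \<in> T" and sub: "S \<subseteq> U" "T \<subseteq> U"
  shows "dim U = dim S + dim T"
proof -
  obtain B where B: "B \<subseteq> S" "independent B" "S \<subseteq> span B" "card B = dim S" by (rule basis_exists)
  obtain C where C: "C \<subseteq> T" "independent C" "T \<subseteq> span C" "card C = dim T" by (rule basis_exists)
  have fin: "finite B" "finite C" using B C independent_finite by blast+
  have spans: "span B = S" "span C = T" using B C S T span_minimal by blast+
  note d = independent_Un_direct[OF fin(1) B(2) fin(2) C(2)]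
  have "U \<subseteq> span (B \<union> C)"
  proof
    fix x assume "x \<in> U"
    then obtain y where y: "y \<in> S" "x - y \<in> T" using sum by blast
    then have "y \<in> span (B \<union> C)" "x - y \<in> span (B \<union> C)"
      using spans span_mono[of B "B \<union> C"] span_mono[of C "B \<union> C"] by auto
    then have "y + (x - y) \<in> span (B \<union> C)" by (rule span_add)
    then show "x \<in> span (B \<union> C)" by simp
  qed
  moreover have "independent (B \<union> C)" "B \<inter> C = {}" using d int spans by auto
  moreover have "B \<union> C \<subseteq> U" using B C sub by blast
  ultimately have "dim U = card (B \<union> C)" by (intro dim_unique) auto
  then show ?thesis using card_Un_disjoint[OF fin] \<open>B \<inter> C = {}\<close> B C by simp
qed

abbreviation V :: "'v set" where "V \<equiv> span (coroots D)"

lemma al_in_V: "j < l \<Longrightarrow> cv (al j) \<in> V"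
  by (intro span_base) (simp add: coroots_def)

lemma simple_coroots_eq: "scv ` I = (\<lambda>j. cv (al j)) ` {0..<l}"
  by (simp add: I_eq image_image simple_coroot_def al_def del: image_Suc_atLeastLessThan)

lemma V_expansion: "x \<in> V \<Longrightarrow> x = (\<Sum>j = 0..<l. blinfun_apply (om j) x *\<^sub>R cv (al j))"
proof -
  assume "x \<in> V"
  then have "x \<in> span ((\<lambda>j. cv (al j)) ` {0..<l})"
    by (simp add: span_simple_coroots[symmetric] simple_coroots_eq)
  then show ?thesis
  proof (induction rule: span_induct_alt)
    case base
    then show ?case by simp
  next
    case (step c x y)
    then obtain k where k: "k < l" "x = cv (al k)" by auto
    have "(\<Sum>j = 0..<l. blinfun_apply (om j) x *\<^sub>R cv (al j)) = (\<Sum>j = 0..<l. if j = k then cv (al j) else 0)"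
      using k by (intro sum.cong) (auto simp: om_al)
    also have "\<dots> = x" using k by (simp add: sum.delta)
    finally show ?case using step.IH
      by (simp add: blinfun.add_right blinfun.scaleR_right scaleR_add_left sum.distrib scaleR_sum_right[symmetric]
          flip: scaleR_scaleR)
  qed
qed

lemma simple_coroots_independent:
  assumes "(\<Sum>j = 0..<l. c j *\<^sub>R cv (al j)) = 0" "k < l"
  shows "c k = 0"
proof -
  have "0 = blinfun_apply (om k) (\<Sum>j = 0..<l. c j *\<^sub>R cv (al j))" using assms by simp
  also have "\<dots> = (\<Sum>j = 0..<l. if j = k then c j else 0)"
    unfolding blinfun.sum_right blinfun.scaleR_right
    using assms(2) by (intro sum.cong) (auto simp: om_al)
  also have "\<dots> = c k" using assms(2) by (simp add: sum.delta)
  finally show ?thesis ..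
qed

lemma dim_V: "dim V = l"
proof -
  have inj: "inj_on (\<lambda>j. cv (al j)) {0..<l}"
  proof (rule inj_onI)
    fix j k assume a: "j \<in> {0..<l}" "k \<in> {0..<l}" "cv (al j) = cv (al k)"
    then show "j = k" using om_al[of j j] om_al[of j k] by (auto split: if_splits)
  qed
  have "independent ((\<lambda>j. cv (al j)) ` {0..<l})"
  proof (rule independent_if_scalars_zero)
    fix f x assume s: "(\<Sum>x\<in>(\<lambda>j. cv (al j)) ` {0..<l}. f x *\<^sub>R x) = 0" and "x \<in> (\<lambda>j. cv (al j)) ` {0..<l}"
    then obtain k where "k < l" "x = cv (al k)" by auto
    moreover have "(\<Sum>j = 0..<l. f (cv (al j)) *\<^sub>R cv (al j)) = 0"
      using s by (simp add: sum.reindex[OF inj])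
    ultimately show "f x = 0" using simple_coroots_independent[of "\<lambda>j. f (cv (al j))" k] by simp
  qed simp
  then show ?thesis
    unfolding span_simple_coroots[symmetric] simple_coroots_eq
    by (simp add: dim_span dim_eq_card_independent card_image[OF inj])
qed

section \<open>Orbit forms at a regular point\<close>

lemma orbit_form_add: "orbit_form i b (x + y) = orbit_form i b x + orbit_form i b y"
  unfolding orbit_form_def sum.distrib[symmetric]
  by (intro sum.cong refl) (simp add: weyl_linear linear_add blinfun.add_right algebra_simps)

lemma orbit_form_scale: "orbit_form i b (c *\<^sub>R x) = of_real c * orbit_form i b x"
  unfolding orbit_form_def sum_distrib_left
  by (intro sum.cong refl) (simp add: weyl_linear linear_scale blinfun.scaleR_right)

lemma orbit_form_0: "orbit_form i b 0 = 0"
  using orbit_form_scale[of i b 0 0] by simp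

lemma orbit_form_diff: "orbit_form i b (x - y) = orbit_form i b x - orbit_form i b y"
  using orbit_form_add[of i b x "(-1) *\<^sub>R y"] orbit_form_scale[of i b "-1" y] by simp

lemma orbit_form_sum: "finite A \<Longrightarrow> orbit_form i b (\<Sum>a\<in>A. c a *\<^sub>R f a) = (\<Sum>a\<in>A. of_real (c a) * orbit_form i b (f a))"
  by (induction A rule: finite_induct) (simp_all add: orbit_form_0 orbit_form_add orbit_form_scale)

lemma jacobian_carrier: "jacobian b \<in> carrier_mat l l"
  by (simp add: jacobian_def)

text \<open>
  Here \<open>x\<close> and \<open>y\<close> are the real and imaginary parts of a vector of \<open>V \<otimes> \<complex>\<close>; its coordinates in the simple
  coroots, which are given by the fundamental weights, form a vector in the kernel of the Jacobian matrix.
\<close>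

lemma orbit_forms_injective:
  assumes b: "b \<in> regular_points D" and x: "x \<in> V" and y: "y \<in> V"
    and 0: "\<And>i. i < l \<Longrightarrow> orbit_form i b x + \<i> * orbit_form i b y = 0"
  shows "x = 0 \<and> y = 0"
proof -
  define z where "z = vec l (\<lambda>j. Complex (blinfun_apply (om j) x) (blinfun_apply (om j) y))"
  have "jacobian b *\<^sub>v z = 0\<^sub>v l"
  proof (rule eq_vecI)
    fix i assume "i < dim_vec (0\<^sub>v l :: complex vec)"
    then have i: "i < l" by simp
    have "vec_index (jacobian b *\<^sub>v z) i = (\<Sum>j = 0..<l. orbit_form i b (cv (al j)) * Complex (blinfun_apply (om j) x) (blinfun_apply (om j) y))"
      using i by (simp add: z_def jacobian_def scalar_prod_def)
    also have "\<dots> = (\<Sum>j = 0..<l. of_real (blinfun_apply (om j) x) * orbit_form i b (cv (al j)))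
        + \<i> * (\<Sum>j = 0..<l. of_real (blinfun_apply (om j) y) * orbit_form i b (cv (al j)))"
      by (simp add: sum_distrib_left sum.distrib[symmetric] Complex_eq algebra_simps)
    also have "\<dots> = orbit_form i b x + \<i> * orbit_form i b y"
      using V_expansion[OF x] V_expansion[OF y] by (simp add: orbit_form_sum[symmetric])
    finally show "vec_index (jacobian b *\<^sub>v z) i = vec_index (0\<^sub>v l) i" using 0[OF i] i by simp
  qed (simp add: jacobian_def)
  moreover have "z \<in> carrier_vec l" by (simp add: z_def)
  ultimately have z0: "z = 0\<^sub>v l"
    using det_0_iff_vec_prod_zero[OF jacobian_carrier] det_jacobian_regular[OF b] by blast
  have c: "blinfun_apply (om j) x = 0 \<and> blinfun_apply (om j) y = 0" if "j < l" for j
  proof -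
    have "vec_index z j = 0" using z0 that by simp
    then show ?thesis using that by (simp add: z_def complex_eq_iff)
  qed
  have "x = (\<Sum>j = 0..<l. 0)" by (subst V_expansion[OF x]) (simp add: c)
  moreover have "y = (\<Sum>j = 0..<l. 0)" by (subst V_expansion[OF y]) (simp add: c)
  ultimately show ?thesis by simp
qed

lemma orbit_forms_separate:
  assumes "b \<in> regular_points D" "x \<in> V" "\<And>i. i < l \<Longrightarrow> orbit_form i b x = 0"
  shows "x = 0"
  using orbit_forms_injective[OF assms(1,2) span_zero] assms(3) by (simp add: orbit_form_0)

lemma orbit_form_basis_det:
  assumes b: "b \<in> regular_points D" and f: "bij_betw f {0..<l} B" and B: "B \<subseteq> V" "independent B"
  shows "Determinant.det (mat l l (\<lambda>(i, j). orbit_form i b (f j))) \<noteq> 0" (is "Determinant.det ?N \<noteq> 0")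
proof
  assume "Determinant.det ?N = 0"
  moreover have "?N \<in> carrier_mat l l" by simp
  ultimately obtain z where z: "z \<in> carrier_vec l" "z \<noteq> 0\<^sub>v l" "?N *\<^sub>v z = 0\<^sub>v l"
    using det_0_iff_vec_prod_zero by blast
  define x where "x = (\<Sum>j = 0..<l. Re (vec_index z j) *\<^sub>R f j)"
  define y where "y = (\<Sum>j = 0..<l. Im (vec_index z j) *\<^sub>R f j)"
  have fV: "f j \<in> V" if "j < l" for j using f B that by (auto simp: bij_betw_def)
  have inj: "inj_on f {0..<l}" and im: "f ` {0..<l} = B" using f by (auto simp: bij_betw_def)
  have "orbit_form i b x + \<i> * orbit_form i b y = 0" if i: "i < l" for i
  proof -
    have "0 = vec_index (?N *\<^sub>v z) i" using z i by simp
    also have "\<dots> = (\<Sum>j = 0..<l. orbit_form i b (f j) * vec_index z j)"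
      using i z(1) by (simp add: scalar_prod_def)
    also have "\<dots> = (\<Sum>j = 0..<l. of_real (Re (vec_index z j)) * orbit_form i b (f j) + \<i> * (of_real (Im (vec_index z j)) * orbit_form i b (f j)))"
    proof (rule sum.cong[OF refl])
      fix j
      have "vec_index z j = of_real (Re (vec_index z j)) + \<i> * of_real (Im (vec_index z j))" by (rule complex_eq)
      then have "orbit_form i b (f j) * vec_index z j = orbit_form i b (f j) * (of_real (Re (vec_index z j)) + \<i> * of_real (Im (vec_index z j)))"
        by (rule arg_cong)
      then show "orbit_form i b (f j) * vec_index z j
        = of_real (Re (vec_index z j)) * orbit_form i b (f j) + \<i> * (of_real (Im (vec_index z j)) * orbit_form i b (f j))"
        by (simp add: algebra_simps)
    qed
    also have "\<dots> = orbit_form i b x + \<i> * orbit_form i b y"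
      by (simp add: x_def y_def orbit_form_sum sum.distrib sum_distrib_left)
    finally show ?thesis ..
  qed
  moreover have "x \<in> V" "y \<in> V" using fV by (auto simp: x_def y_def intro!: span_sum span_scale)
  ultimately have xy: "x = 0" "y = 0" using orbit_forms_injective[OF b] by blast+
  have zero: "c j = 0" if c: "(\<Sum>j = 0..<l. c j *\<^sub>R f j) = 0" and j: "j < l" for c :: "nat \<Rightarrow> real" and j
  proof -
    have "(\<Sum>v\<in>B. c (the_inv_into {0..<l} f v) *\<^sub>R v) = (\<Sum>j = 0..<l. c j *\<^sub>R f j)"
      unfolding im[symmetric] sum.reindex[OF inj] o_def by (intro sum.cong refl) (simp add: the_inv_into_f_f[OF inj])
    then have "c (the_inv_into {0..<l} f (f j)) = 0"
      using c j im independentD[OF B(2) independent_finite[OF B(2)] subset_refl, of "\<lambda>v. c (the_inv_into {0..<l} f v)" "f j"]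
      by auto
    then show ?thesis using j by (simp add: the_inv_into_f_f[OF inj])
  qed
  have "vec_index z j = 0" if "j < l" for j
    using zero[of "\<lambda>j. Re (vec_index z j)" j] zero[of "\<lambda>j. Im (vec_index z j)" j] xy that
    by (simp add: x_def y_def complex_eq_iff)
  then have "z = 0\<^sub>v l" using z(1) by (intro eq_vecI) auto
  then show False using z(2) by simp
qed

lemma weyl_funpow: "u \<in> W \<Longrightarrow> u ^^ n \<in> W"
  by (induction n) (simp_all only: funpow.simps weyl_group.one weyl_comp)

lemma weyl_finite_order: "u \<in> W \<Longrightarrow> \<exists>N>0. \<forall>x. (u ^^ N) x = x"
proof -
  assume u: "u \<in> W"
  have "finite (range (\<lambda>n. u ^^ n))"
    by (rule finite_subset[OF _ finite_weyl]) (use weyl_funpow[OF u] in auto)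
  then have "\<not> inj (\<lambda>n. u ^^ n)" using finite_imageD infinite_UNIV_nat by blast
  then obtain i j where "u ^^ i = u ^^ j" "i \<noteq> j" unfolding inj_def by blast
  then obtain i j where ij: "u ^^ i = u ^^ j" "i < j" by (metis nat_neq_iff)
  have "(u ^^ (j - i)) x = x" for x
  proof -
    have "(u ^^ i) ((u ^^ (j - i)) x) = (u ^^ j) x" using ij(2) funpow_add[of i "j - i" u] by simp
    then have "(u ^^ i) ((u ^^ (j - i)) x) = (u ^^ i) x" using ij(1) by simp
    then show ?thesis by (rule injD[OF bij_is_inj[OF weyl_bij[OF weyl_funpow[OF u]]]])
  qed
  then show ?thesis using ij(2) by (intro exI[of _ "j - i"]) simp
qed

text \<open>
  The chain rule at the fixed point \<open>b\<close> of \<open>x \<mapsto> \<tau> + u x\<close>, carried out on the sums over \<open>W\<close>: the hypothesis on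
  \<open>\<tau>\<close> says that translation by \<open>\<tau>\<close> multiplies the orbit sum of \<open>\<omega>\<^sub>i\<close> by \<open>e(-\<omega>\<^sub>i(\<nu>))\<close>.
\<close>

lemma orbit_form_eigen:
  assumes u: "u \<in> W" and b: "b = \<tau> + u b" and i: "i < l"
    and int: "\<And>w. w \<in> W \<Longrightarrow> blinfun_apply (om i) (w \<tau>) + blinfun_apply (om i) \<nu> \<in> \<int>"
  shows "orbit_form i b (u v) = expi (- blinfun_apply (om i) \<nu>) * orbit_form i b v"
proof -
  have e: "expi (blinfun_apply (om i) (w b)) = expi (- blinfun_apply (om i) \<nu>) * expi (blinfun_apply (om i) ((w \<circ> u) b))"
    if w: "w \<in> W" for w
  proof -
    have "w b = w (\<tau> + u b)" using b by (rule arg_cong)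
    then have "blinfun_apply (om i) (w b) = blinfun_apply (om i) (w \<tau>) + blinfun_apply (om i) ((w \<circ> u) b)"
      using weyl_linear[OF w] by (simp add: linear_add blinfun.add_right)
    moreover have "expi (blinfun_apply (om i) (w \<tau>)) = expi (- blinfun_apply (om i) \<nu>)"
      unfolding expi_eq_iff using int[OF w] by simp
    ultimately show ?thesis by (simp only: expi_add)
  qed
  have "orbit_form i b (u v) = (\<Sum>w\<in>W. of_real (blinfun_apply (om i) ((w \<circ> u) v)) * expi (blinfun_apply (om i) (w b)))"
    unfolding orbit_form_def by (simp only: comp_apply)
  also have "\<dots> = expi (- blinfun_apply (om i) \<nu>) *
      (\<Sum>w\<in>W. of_real (blinfun_apply (om i) ((w \<circ> u) v)) * expi (blinfun_apply (om i) ((w \<circ> u) b)))"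
    unfolding sum_distrib_left by (intro sum.cong refl) (simp only: e mult.left_commute)
  also have "(\<Sum>w\<in>W. of_real (blinfun_apply (om i) ((w \<circ> u) v)) * expi (blinfun_apply (om i) ((w \<circ> u) b)))
      = orbit_form i b v"
    unfolding orbit_form_def
    by (rule sum.reindex_bij_betw[OF weyl_bij_comp_right[OF u],
          of "\<lambda>w. of_real (blinfun_apply (om i) (w v)) * expi (blinfun_apply (om i) (w b))"])
  finally show ?thesis .
qed

text \<open>
  The orbit forms and their complex conjugates are two eigenbases of the same real operator, with eigenvalues \<open>c\<^sub>i\<close>
  and the conjugates of the \<open>c\<^sub>i\<close>.  The matrix \<open>E\<close> from one to the other has \<open>E\<^sub>i\<^sub>j = 0\<close> unless \<open>c\<^sub>j\<close> is the
  conjugate of \<open>c\<^sub>i\<close>, so a nonzero transversal of \<open>E\<close> is the required permutation.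
\<close>

lemma eigenvalues_conjugate:
  assumes b: "b \<in> regular_points D" and u: "u \<in> W"
    and eig: "\<And>i v. i < l \<Longrightarrow> orbit_form i b (u v) = c i * orbit_form i b v"
  obtains p where "p permutes {0..<l}" "\<And>i. i < l \<Longrightarrow> c (p i) = cnj (c i)"
proof -
  define N where "N = jacobian b"
  have N: "N \<in> carrier_mat l l" by (simp add: N_def jacobian_carrier)
  have dN: "Determinant.det N \<noteq> 0" unfolding N_def by (rule det_jacobian_regular[OF b])
  obtain B where B: "B \<in> carrier_mat l l" "B * N = 1\<^sub>m l"
    using det_non_zero_imp_unit[OF N dN] by (auto simp: Units_def ring_mat_simps)
  define N' where "N' = map_mat cnj N"
  have N': "N' \<in> carrier_mat l l" using N by (simp add: N'_def)
  interpret cnj: comm_ring_hom cnj by unfold_locales auto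
  have dN': "Determinant.det N' \<noteq> 0" using dN by (simp add: N'_def)
  define E where "E = N' * B"
  have E: "E \<in> carrier_mat l l" using N' B by (simp add: E_def)
  have "Determinant.det B \<noteq> 0" using det_mult[OF B(1) N] B(2) by auto
  then have dE: "Determinant.det E \<noteq> 0" using det_mult[OF N' B(1)] dN' by (simp add: E_def)
  have EN: "E * N = N'" using N' B N by (simp add: E_def assoc_mult_mat[of _ l l _ l _ l])
  have entry: "(\<Sum>j = 0..<l. E $$ (i, j) * orbit_form j b (cv (al k))) = cnj (orbit_form i b (cv (al k)))"
    if i: "i < l" and k: "k < l" for i k
  proof -
    have "(E * N) $$ (i, k) = (\<Sum>j = 0..<l. E $$ (i, j) * orbit_form j b (cv (al k)))"
      using E i k by (simp add: scalar_prod_def N_def jacobian_def)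
    moreover have "N' $$ (i, k) = cnj (orbit_form i b (cv (al k)))"
      using i k by (simp add: N'_def N_def jacobian_def)
    ultimately show ?thesis using EN by simp
  qed
  have onV: "(\<Sum>j = 0..<l. E $$ (i, j) * orbit_form j b x) = cnj (orbit_form i b x)"
    if i: "i < l" and x: "x \<in> V" for i x
  proof -
    have ex: "orbit_form j b x = (\<Sum>k = 0..<l. of_real (blinfun_apply (om k) x) * orbit_form j b (cv (al k)))" for j
      by (subst V_expansion[OF x]) (simp add: orbit_form_sum)
    have "(\<Sum>j = 0..<l. E $$ (i, j) * orbit_form j b x)
       = (\<Sum>k = 0..<l. of_real (blinfun_apply (om k) x) * (\<Sum>j = 0..<l. E $$ (i, j) * orbit_form j b (cv (al k))))"
      unfolding ex sum_distrib_left by (subst sum.swap) (simp add: mult.left_commute)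
    also have "\<dots> = cnj (orbit_form i b x)"
      unfolding ex cnj_sum using i by (intro sum.cong) (simp_all add: entry)
    finally show ?thesis .
  qed
  have comm: "E $$ (i, j) * (c j - cnj (c i)) = 0" if i: "i < l" and j: "j < l" for i j
  proof -
    \<comment> \<open>The linear relation among the orbit forms obtained by applying row \<open>i\<close> of \<open>E\<close> to \<open>u x\<close> in two ways.\<close>
    define r where "r = vec l (\<lambda>j. E $$ (i, j) * (c j - cnj (c i)))"
    have "transpose_mat N *\<^sub>v r = 0\<^sub>v l"
    proof (rule eq_vecI)
      fix k assume "k < dim_vec (0\<^sub>v l :: complex vec)"
      then have k: "k < l" by simp
      let ?x = "cv (al k)"
      have xV: "?x \<in> V" "u ?x \<in> V" using al_in_V[OF k] weyl_span_coroots[OF u] by auto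
      have "vec_index (transpose_mat N *\<^sub>v r) k = (\<Sum>j = 0..<l. orbit_form j b ?x * (E $$ (i, j) * (c j - cnj (c i))))"
        using k N by (simp add: r_def scalar_prod_def N_def jacobian_def)
      also have "\<dots> = (\<Sum>j = 0..<l. E $$ (i, j) * orbit_form j b (u ?x)) - cnj (c i) * (\<Sum>j = 0..<l. E $$ (i, j) * orbit_form j b ?x)"
        unfolding sum_distrib_left sum_subtractf[symmetric]
        by (intro sum.cong) (simp_all add: eig algebra_simps)
      also have "\<dots> = 0" unfolding onV[OF i xV(1)] onV[OF i xV(2)] by (simp add: eig[OF i])
      finally show "vec_index (transpose_mat N *\<^sub>v r) k = vec_index (0\<^sub>v l) k" using k by simp
    qed (use N in simp)
    moreover have "Determinant.det (transpose_mat N) \<noteq> 0" using det_transpose[OF N] dN by simp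
    moreover have "r \<in> carrier_vec l" by (simp add: r_def)
    moreover have "transpose_mat N \<in> carrier_mat l l" using N by simp
    ultimately have "r = 0\<^sub>v l" using det_0_iff_vec_prod_zero by blast
    then have "vec_index r j = 0" using j by simp
    then show ?thesis using j by (simp add: r_def)
  qed
  obtain p where p: "p permutes {0..<l}" "\<And>i. i < l \<Longrightarrow> E $$ (i, p i) \<noteq> 0"
    using nonsingular_transversal[OF E dE] by blast
  have "c (p i) = cnj (c i)" if "i < l" for i
    using comm[OF that, of "p i"] p(2)[OF that] permutes_in_image[OF p(1), of i] that by simp
  then show ?thesis using that p(1) by blast
qed

text \<open>Averaging over the powers of \<open>u\<close> is a projection onto the fixed space that kills the range of \<open>1 - u\<close>.\<close>

lemma fixed_space_complement:
  assumes u: "u \<in> W"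
  shows "{x. u x = x} \<inter> range (\<lambda>x. x - u x) \<subseteq> {0}"
    and "\<exists>y. u y = y \<and> x - y \<in> range (\<lambda>x. x - u x)"
proof -
  obtain N where N: "N > 0" "\<And>x. (u ^^ N) x = x" using weyl_finite_order[OF u] by blast
  define P where "P x = (1 / real N) *\<^sub>R (\<Sum>k<N. (u ^^ k) x)" for x
  have lin: "linear (u ^^ k)" for k using weyl_linear weyl_funpow[OF u] by blast
  have cyc: "(\<Sum>k<N. (u ^^ Suc k) x) = (\<Sum>k<N. (u ^^ k) x)" for x
  proof -
    have "(u ^^ 0) x + (\<Sum>k<N. (u ^^ Suc k) x) = (\<Sum>k<Suc N. (u ^^ k) x)"
      by (rule sum.lessThan_Suc_shift[symmetric])
    also have "\<dots> = (\<Sum>k<N. (u ^^ k) x) + x" using N(2) by (simp only: sum.lessThan_Suc)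
    finally show ?thesis by simp
  qed
  have sw: "(u ^^ k) (u x) = (u ^^ Suc k) x" for k x
    by (simp only: funpow_Suc_right comp_apply)
  have Pu: "P (u x) = P x" for x unfolding P_def sw cyc ..
  have uP: "u (P x) = P x" for x
  proof -
    have "u (P x) = (1 / real N) *\<^sub>R (\<Sum>k<N. (u ^^ Suc k) x)"
      using weyl_linear[OF u] by (simp add: P_def linear_scale linear_sum)
    then show ?thesis unfolding cyc P_def .
  qed
  have Pdiff: "P (x - y) = P x - P y" for x y
    by (simp add: P_def linear_diff[OF lin] sum_subtractf scaleR_diff_right)
  have Pfix: "P x = x" if "u x = x" for x
  proof -
    have "(u ^^ k) x = x" for k using that by (induction k) simp_all
    then show ?thesis using N(1) by (simp add: P_def sum_constant_scaleR)
  qed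
  show "{x. u x = x} \<inter> range (\<lambda>x. x - u x) \<subseteq> {0}"
  proof
    fix x assume x: "x \<in> {x. u x = x} \<inter> range (\<lambda>x. x - u x)"
    then obtain y where "x = y - u y" by blast
    then have "P x = 0" by (simp add: Pdiff Pu)
    then show "x \<in> {0}" using x Pfix by simp
  qed
  have sub: "subspace (range (\<lambda>x. x - u x))"
    using weyl_linear[OF u] by (intro linear_subspace_image linear_compose_sub) (auto simp: linear_ident)
  have tel: "x - (u ^^ k) x \<in> range (\<lambda>x. x - u x)" for k x
  proof (induction k)
    case 0
    then show ?case using subspace_0[OF sub] by simp
  next
    case (Suc k)
    have "x - (u ^^ Suc k) x = (x - (u ^^ k) x) + ((u ^^ k) x - u ((u ^^ k) x))" by simp
    also have "\<dots> \<in> range (\<lambda>x. x - u x)" using Suc by (intro subspace_add[OF sub]) auto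
    finally show ?case .
  qed
  have "x - P x = (1 / real N) *\<^sub>R (\<Sum>k<N. x - (u ^^ k) x)"
    using N(1) by (simp add: P_def sum_subtractf scaleR_diff_right sum_constant_scaleR)
  also have "\<dots> \<in> range (\<lambda>x. x - u x)" by (intro subspace_scale[OF sub] subspace_sum[OF sub] tel)
  finally show "\<exists>y. u y = y \<and> x - y \<in> range (\<lambda>x. x - u x)" using uP by blast
qed

text \<open>
  Evaluate the orbit forms on a basis of \<open>V\<close> that consists of fixed vectors of \<open>u\<close> and of vectors in the range of
  \<open>1 - u\<close>.  A form with eigenvalue \<open>1\<close> vanishes on the latter, a form with another eigenvalue on the former; so a
  nonzero transversal of the matrix of values matches the eigenvalues \<open>\<noteq> 1\<close> with the basis vectors in the range.
\<close>

lemma fixed_space_codim: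
  assumes b: "b \<in> regular_points D" and u: "u \<in> W"
    and eig: "\<And>i v. i < l \<Longrightarrow> orbit_form i b (u v) = c i * orbit_form i b v"
  shows "dim (UNIV :: 'v set) = dim {x. u x = x} + card {i \<in> {0..<l}. c i \<noteq> 1}"
proof -
  define R where "R = range (\<lambda>x. x - u x)"
  have R: "subspace R" unfolding R_def
    using weyl_linear[OF u] by (intro linear_subspace_image linear_compose_sub) (auto simp: linear_ident)
  have F: "subspace {x. u x = x}"
    using weyl_linear[OF u] by (auto simp: subspace_def linear_add linear_scale linear_0)
  have int: "{x. u x = x} \<inter> R \<subseteq> {0}" unfolding R_def by (rule fixed_space_complement(1)[OF u])
  have RV: "R \<subseteq> V"
  proof
    fix x assume "x \<in> R"
    then obtain y where "x = - (u y - y)" by (auto simp: R_def)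
    then show "x \<in> V" using weyl_diff[OF u] span_neg by metis
  qed
  have dimU: "dim (UNIV :: 'v set) = dim {x. u x = x} + dim R"
    by (rule dim_direct_sum[OF F R int]) (use fixed_space_complement(2)[OF u] in \<open>auto simp: R_def\<close>)
  define F' where "F' = {x. u x = x} \<inter> V"
  have F': "subspace F'" unfolding F'_def by (intro subspace_inter F) simp
  obtain B where B: "B \<subseteq> F'" "independent B" "F' \<subseteq> span B" by (rule basis_exists)
  obtain C where C: "C \<subseteq> R" "independent C" "R \<subseteq> span C" "card C = dim R" by (rule basis_exists)
  have fin: "finite B" "finite C" using B C independent_finite by blast+
  have sp: "span B = F'" "span C = R" using B C F' R span_minimal by blast+
  have int': "span B \<inter> span C \<subseteq> {0}" unfolding sp using int by (auto simp: F'_def)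
  note BC = independent_Un_direct[OF fin(1) B(2) fin(2) C(2) int']
  have BCV: "B \<union> C \<subseteq> V" using B C RV by (auto simp: F'_def)
  have "V \<subseteq> span (B \<union> C)"
  proof
    fix x assume x: "x \<in> V"
    obtain y where y: "u y = y" "x - y \<in> R" using fixed_space_complement(2)[OF u] by (auto simp: R_def)
    have "x - y \<in> V" using y RV by blast
    then have "x - (x - y) \<in> V" by (rule span_diff[OF x])
    then have "y \<in> F'" using y by (simp add: F'_def)
    then have "y \<in> span (B \<union> C)" "x - y \<in> span (B \<union> C)"
      using y sp span_mono[of B "B \<union> C"] span_mono[of C "B \<union> C"] by auto
    then have "y + (x - y) \<in> span (B \<union> C)" by (rule span_add)
    then show "x \<in> span (B \<union> C)" by simp
  qed
  then have "card (B \<union> C) = dim V" using BC BCV by (intro basis_card_eq_dim)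
  then have "card (B \<union> C) = l" by (simp only: dim_V)
  then obtain f where f: "bij_betw f {0..<l} (B \<union> C)"
    using ex_bij_betw_nat_finite[of "B \<union> C"] fin by auto
  have "Determinant.det (mat l l (\<lambda>(i, j). orbit_form i b (f j))) \<noteq> 0"
    by (rule orbit_form_basis_det[OF b f BCV BC(1)])
  then obtain p where p: "p permutes {0..<l}"
    and nz: "\<And>i. i < l \<Longrightarrow> mat l l (\<lambda>(i, j). orbit_form i b (f j)) $$ (i, p i) \<noteq> 0"
    using nonsingular_transversal[of "mat l l (\<lambda>(i, j). orbit_form i b (f j))" l] by auto
  have fp: "bij_betw (f \<circ> p) {0..<l} (B \<union> C)"
    using bij_betw_trans[OF permutes_imp_bij[OF p] f] .
  have char: "c i \<noteq> 1 \<longleftrightarrow> f (p i) \<in> C" if i: "i < l" for i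
  proof -
    have "p i < l" using permutes_in_image[OF p, of i] i by simp
    then have n: "orbit_form i b (f (p i)) \<noteq> 0" using nz[OF i] i by simp
    have "f (p i) \<in> B \<union> C" using fp i by (auto simp: bij_betw_def)
    moreover have "c i = 1" if "f (p i) \<in> B"
    proof -
      have "u (f (p i)) = f (p i)" using that B by (auto simp: F'_def)
      then show ?thesis using eig[OF i, of "f (p i)"] n by simp
    qed
    moreover have "c i \<noteq> 1" if "f (p i) \<in> C"
    proof
      assume "c i = 1"
      have "f (p i) \<in> range (\<lambda>x. x - u x)" using that C(1) unfolding R_def by blast
      then obtain y where "f (p i) = y - u y" by blast
      then have "orbit_form i b (f (p i)) = 0"
        using eig[OF i, of y] \<open>c i = 1\<close> by (simp add: orbit_form_diff)
      then show False using n by simp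
    qed
    ultimately show ?thesis by blast
  qed
  have "card {i \<in> {0..<l}. c i \<noteq> 1} = card ((f \<circ> p) ` {i \<in> {0..<l}. c i \<noteq> 1})"
    using fp by (intro card_image[symmetric]) (auto simp: bij_betw_def intro: inj_on_subset)
  also have "(f \<circ> p) ` {i \<in> {0..<l}. c i \<noteq> 1} = C"
  proof (intro equalityI subsetI)
    fix x assume x: "x \<in> C"
    then have "x \<in> (f \<circ> p) ` {0..<l}" using fp by (auto simp: bij_betw_def)
    then obtain i where "i < l" "x = f (p i)" by auto
    then show "x \<in> (f \<circ> p) ` {i \<in> {0..<l}. c i \<noteq> 1}" using x char by auto
  qed (use char in auto)
  finally show ?thesis using dimU C(4) by simp
qed

text \<open>
  As the \<open>e(-t\<^sub>i)\<close> are the eigenvalues of a real operator, negation permutes the classes of the \<open>t\<^sub>i\<close> modulo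
  \<open>\<int>\<close>; the identity \<open>frac t + frac (-t) = 1\<close> for \<open>t \<notin> \<int>\<close> then turns the sum of fractional parts into half
  the number of nontrivial eigenvalues.
\<close>

theorem sum_frac_eq_half_codim:
  assumes b: "b \<in> regular_points D" and u: "u \<in> W"
    and eig: "\<And>i v. i < l \<Longrightarrow> orbit_form i b (u v) = expi (- t i) * orbit_form i b v"
  shows "(\<Sum>i = 0..<l. frac (t i)) = (1 / 2) * (real (dim (UNIV :: 'v set)) - real (dim {x. u x = x}))"
proof -
  obtain p where p: "p permutes {0..<l}" and conj: "\<And>i. i < l \<Longrightarrow> expi (- t (p i)) = cnj (expi (- t i))"
    using eigenvalues_conjugate[OF b u, of "\<lambda>i. expi (- t i)"] eig by blast
  have fr: "frac (t (p i)) = frac (- t i)" if "i < l" for i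
  proof -
    have "- t (p i) - t i \<in> \<int>" using conj[OF that] by (simp add: expi_cnj expi_eq_iff)
    then obtain n :: int where "- t (p i) - t i = n" by (elim Ints_cases)
    then have "t (p i) = - t i + of_int (- n)" by simp
    then show ?thesis by (simp only: frac_add_of_int_right)
  qed
  have "(\<Sum>i = 0..<l. frac (t i)) = (\<Sum>i = 0..<l. frac (t (p i)))"
    using sum.permute[OF p, of "\<lambda>i. frac (t i)"] by (simp add: o_def)
  also have "\<dots> = (\<Sum>i = 0..<l. frac (- t i))" by (intro sum.cong) (simp_all add: fr)
  finally have "2 * (\<Sum>i = 0..<l. frac (t i)) = (\<Sum>i = 0..<l. frac (t i) + frac (- t i))"
    by (simp add: sum.distrib)
  also have "\<dots> = (\<Sum>i = 0..<l. if expi (- t i) \<noteq> 1 then 1 else 0)"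
    by (intro sum.cong) (auto simp: expi_eq_1 frac_neg frac_eq_0_iff)
  also have "\<dots> = real (card {i \<in> {0..<l}. expi (- t i) \<noteq> 1})"
    by (simp add: sum.If_cases Int_def)
  finally show ?thesis using fixed_space_codim[OF b u eig] by simp
qed

end

context based_datum
begin

section \<open>The base alcove\<close>

definition alcove :: "'v set" where
  "alcove = {x. \<forall>\<alpha>\<in>pos. 0 < blinfun_apply \<alpha> x \<and> blinfun_apply \<alpha> x < 1}"

lemma regular_iff: "x \<in> regular_points D \<longleftrightarrow> (\<forall>\<alpha>\<in>\<Phi>. blinfun_apply \<alpha> x \<notin> \<int>)"
  by (auto simp: regular_points_def elim!: Ints_cases)

lemma alcove_regular: "alcove \<subseteq> regular_points D"
proof
  fix x assume x: "x \<in> alcove"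
  have pos: "blinfun_apply \<alpha> x \<notin> \<int>" if "\<alpha> \<in> pos" for \<alpha>
  proof
    assume "blinfun_apply \<alpha> x \<in> \<int>"
    then obtain n :: int where "blinfun_apply \<alpha> x = n" by (elim Ints_cases)
    then show False using x that by (auto simp: alcove_def)
  qed
  have "blinfun_apply \<alpha> x \<notin> \<int>" if "\<alpha> \<in> \<Phi>" for \<alpha>
    using pos_or_neg[OF that] pos[of \<alpha>] pos[of "- \<alpha>"] by (auto simp: blinfun.minus_left)
  then show "x \<in> regular_points D" by (simp add: regular_iff)
qed

lemma convex_alcove: "convex alcove"
proof (rule convexI)
  fix x y and s t :: real
  assume xy: "x \<in> alcove" "y \<in> alcove" and st: "0 \<le> s" "0 \<le> t" "s + t = 1"
  have "0 < s * blinfun_apply \<alpha> x + t * blinfun_apply \<alpha> y \<and> s * blinfun_apply \<alpha> x + t * blinfun_apply \<alpha> y < 1"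
    if "\<alpha> \<in> pos" for \<alpha>
  proof -
    have x: "blinfun_apply \<alpha> x \<in> {0<..<1}" and y: "blinfun_apply \<alpha> y \<in> {0<..<1}"
      using xy that by (auto simp: alcove_def)
    have "s * blinfun_apply \<alpha> x + t * blinfun_apply \<alpha> y \<in> {0<..<1}"
      using convexD[OF convex_real_interval(8), OF x y st] by simp
    then show ?thesis by simp
  qed
  then show "s *\<^sub>R x + t *\<^sub>R y \<in> alcove"
    by (auto simp: alcove_def blinfun.add_right blinfun.scaleR_right)
qed

lemma alcove_scale:
  assumes "x \<in> alcove" "0 < t" "t \<le> 1"
  shows "t *\<^sub>R x \<in> alcove"
proof -
  have "t * blinfun_apply \<alpha> x < 1" if "\<alpha> \<in> pos" for \<alpha>
  proof -
    have x: "0 < blinfun_apply \<alpha> x" "blinfun_apply \<alpha> x < 1" using assms that by (auto simp: alcove_def)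
    then have "t * blinfun_apply \<alpha> x \<le> blinfun_apply \<alpha> x"
      using assms by (intro mult_left_le_one_le) auto
    then show ?thesis using x by linarith
  qed
  then show ?thesis using assms by (auto simp: alcove_def blinfun.scaleR_right)
qed

lemma alcove_nonempty: "alcove \<noteq> {}"
proof -
  define c where "c = 1 + (\<Sum>\<alpha>\<in>pos. blinfun_apply \<alpha> \<delta>)"
  have nn: "0 \<le> (\<Sum>\<alpha>\<in>pos. blinfun_apply \<alpha> \<delta>)" using pos_delta by (intro sum_nonneg) (auto dest: less_imp_le)
  have "blinfun_apply \<alpha> \<delta> < c" if "\<alpha> \<in> pos" for \<alpha>
    using member_le_sum[OF that, of "\<lambda>\<alpha>. blinfun_apply \<alpha> \<delta>"] finite_pos pos_delta
    by (force simp: c_def dest: less_imp_le)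
  then have "(1 / c) *\<^sub>R \<delta> \<in> alcove"
    using nn pos_delta by (auto simp: alcove_def blinfun.scaleR_right c_def)
  then show ?thesis by blast
qed

text \<open>
  On a connected set of regular points a root cannot cross the values \<open>0\<close> and \<open>1\<close>.
\<close>

lemma connected_meets_alcove:
  assumes "connected C" "C \<subseteq> regular_points D" "C \<inter> alcove \<noteq> {}"
  shows "C \<subseteq> alcove"
proof
  fix y assume y: "y \<in> C"
  obtain x where x: "x \<in> C" "x \<in> alcove" using assms by blast
  have "0 < blinfun_apply \<alpha> y \<and> blinfun_apply \<alpha> y < 1" if \<alpha>: "\<alpha> \<in> pos" for \<alpha>
  proof -
    have con: "connected (blinfun_apply \<alpha> ` C)"
      by (intro connected_continuous_image assms(1) linear_continuous_on blinfun.bounded_linear_right)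
    have img: "blinfun_apply \<alpha> x \<in> blinfun_apply \<alpha> ` C" "blinfun_apply \<alpha> y \<in> blinfun_apply \<alpha> ` C"
      using x y by auto
    have ni: "0 \<notin> blinfun_apply \<alpha> ` C" "1 \<notin> blinfun_apply \<alpha> ` C"
      using assms(2) pos_root[OF \<alpha>] by (force simp: regular_iff)+
    have "blinfun_apply \<alpha> x \<in> {0<..<1}" using x \<alpha> by (auto simp: alcove_def)
    then show ?thesis
      using connectedD_interval[OF con img(2,1), of 0] connectedD_interval[OF con img, of 1] ni
      by (meson greaterThanLessThan_iff less_imp_le not_le)
  qed
  then show "y \<in> alcove" by (simp add: alcove_def)
qed

lemma alcove_component: "alcove \<in> components (regular_points D)"
  unfolding in_components_maximal
  using alcove_nonempty alcove_regular convex_connected[OF convex_alcove] connected_meets_alcove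
  by blast

lemma alcove_dominant: "alcove \<subseteq> dominant_chamber D"
  using sr_pos by (auto simp: alcove_def dominant_chamber_def I_def)

lemma zero_closure_alcove: "0 \<in> closure alcove"
proof -
  obtain x where x: "x \<in> alcove" using alcove_nonempty by blast
  have lim: "(\<lambda>n. (1 / real (Suc n)) *\<^sub>R x) \<longlonglongrightarrow> 0 *\<^sub>R x"
    by (intro tendsto_scaleR tendsto_const LIMSEQ_Suc lim_1_over_n)
  have mem: "(1 / real (Suc n)) *\<^sub>R x \<in> alcove" for n
    by (rule alcove_scale[OF x]) auto
  show ?thesis unfolding closure_sequential
    using lim mem by (intro exI[of _ "\<lambda>n. (1 / real (Suc n)) *\<^sub>R x"]) simp
qed

lemma base_alcove_eq: "base_alcove D = alcove"
  unfolding base_alcove_def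
proof (rule the_equality)
  show "alcove \<in> components (regular_points D) \<and> alcove \<subseteq> dominant_chamber D \<and> 0 \<in> closure alcove"
    using alcove_component alcove_dominant zero_closure_alcove by blast
next
  fix C assume C: "C \<in> components (regular_points D) \<and> C \<subseteq> dominant_chamber D \<and> 0 \<in> closure C"
  \<comment> \<open>Near \<open>0\<close> no root reaches the value \<open>1\<close>, so a dominant regular point near \<open>0\<close> lies in the alcove.\<close>
  define U where "U = (\<Inter>\<alpha>\<in>pos. {x. blinfun_apply \<alpha> x < 1})"
  have "open U" unfolding U_def
    by (intro open_INT finite_pos ballI open_Collect_less continuous_on_const
        linear_continuous_on blinfun.bounded_linear_right)
  moreover have "0 \<in> U \<inter> closure C" using C by (simp add: U_def)
  ultimately have "U \<inter> C \<noteq> {}" using open_Int_closure_eq_empty[of U C] by blast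
  then obtain y where y: "y \<in> U" "y \<in> C" by blast
  have reg: "y \<in> regular_points D" using y C in_components_subset by blast
  have "dominant y" using y C by (force simp: dominant_def dominant_chamber_def I_def)
  have "0 < blinfun_apply \<alpha> y" if "\<alpha> \<in> pos" for \<alpha>
  proof -
    have "blinfun_apply \<alpha> y \<noteq> 0" using reg pos_root[OF that] by (auto simp: regular_iff)
    then show ?thesis using pos_simple_nonneg[OF that \<open>dominant y\<close>] by simp
  qed
  then have "y \<in> alcove" using y by (auto simp: alcove_def U_def)
  then show "C = alcove"
    using C y components_nonoverlap[of C "regular_points D" alcove] alcove_component by blast
qed

lemma regular_affine:
  assumes "\<mu> \<in> cochars D" "w \<in> W" "x \<in> regular_points D"
  shows "\<mu> + w x \<in> regular_points D"
  unfolding regular_iff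
proof
  fix \<alpha> assume \<alpha>: "\<alpha> \<in> \<Phi>"
  have n: "blinfun_apply (pull w \<alpha>) x \<notin> \<int>"
    using assms(3) pull_root[OF assms(2) \<alpha>] unfolding regular_iff by blast
  have "blinfun_apply \<alpha> (\<mu> + w x) - blinfun_apply \<alpha> \<mu> = blinfun_apply (pull w \<alpha>) x"
    using assms(2) by (simp add: blinfun.add_right)
  then show "blinfun_apply \<alpha> (\<mu> + w x) \<notin> \<int>"
    using n root_apply_int[OF \<alpha> assms(1)] Ints_diff by metis
qed

lemma affine_alcove_subset:
  assumes "\<mu> \<in> cochars D" "w \<in> W" "x \<in> alcove" "\<mu> + w x \<in> alcove"
  shows "(\<lambda>y. \<mu> + w y) ` alcove \<subseteq> alcove"
proof (rule connected_meets_alcove)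
  have "convex ((\<lambda>y. \<mu> + w y) ` alcove)"
    using convex_translation[OF convex_linear_image[OF weyl_linear[OF assms(2)] convex_alcove], of \<mu>]
    by (simp add: image_image)
  then show "connected ((\<lambda>y. \<mu> + w y) ` alcove)" by (rule convex_connected)
  show "(\<lambda>y. \<mu> + w y) ` alcove \<subseteq> regular_points D"
    using regular_affine[OF assms(1,2)] alcove_regular by blast
  show "(\<lambda>y. \<mu> + w y) ` alcove \<inter> alcove \<noteq> {}" using assms by blast
qed

lemma affine_alcove_eq:
  assumes "\<mu> \<in> cochars D" "w \<in> W" "x \<in> alcove" "\<mu> + w x \<in> alcove"
  shows "(\<lambda>y. \<mu> + w y) ` alcove = alcove"
proof
  show "(\<lambda>y. \<mu> + w y) ` alcove \<subseteq> alcove" by (rule affine_alcove_subset[OF assms])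
  let ?\<mu>' = "- winv w \<mu>"
  have lin: "linear (winv w)" by (rule weyl_linear[OF weyl_inv[OF assms(2)]])
  have inverse: "?\<mu>' + winv w (\<mu> + w y) = y" for y
    using assms(2) by (simp add: linear_add[OF lin])
  have inverse': "\<mu> + w (?\<mu>' + winv w y) = y" for y
    using assms(2) weyl_linear[OF assms(2)] by (simp add: linear_add linear_diff linear_neg)
  have "?\<mu>' \<in> cochars D"
    using cochars_scale[OF weyl_cochars[OF weyl_inv[OF assms(2)] assms(1)], of "-1"] by simp
  then have sub: "(\<lambda>y. ?\<mu>' + winv w y) ` alcove \<subseteq> alcove"
    by (rule affine_alcove_subset[OF _ weyl_inv[OF assms(2)] assms(4)]) (simp only: inverse assms(3))
  show "alcove \<subseteq> (\<lambda>y. \<mu> + w y) ` alcove"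
  proof
    fix y assume "y \<in> alcove"
    then have "?\<mu>' + winv w y \<in> alcove" using sub by blast
    then show "y \<in> (\<lambda>y. \<mu> + w y) ` alcove" using inverse'[of y] by (metis image_eqI)
  qed
qed

section \<open>Transitivity on alcoves\<close>

text \<open>
  The squared distance for the invariant form \<open>\<Sum>\<^sub>\<beta> \<beta>(x) \<beta>(y)\<close>; it is blind to translations that all roots kill.
\<close>

definition root_dist :: "'v \<Rightarrow> 'v \<Rightarrow> real" where
  "root_dist x y = (\<Sum>\<beta>\<in>\<Phi>. (blinfun_apply \<beta> y - blinfun_apply \<beta> x)\<^sup>2)"

lemma root_dist_shift:
  assumes \<alpha>: "\<alpha> \<in> \<Phi>"
  obtains \<kappa> where "\<kappa> > 0"
    "\<And>x y t. root_dist x (y - t *\<^sub>R cv \<alpha>) = root_dist x y - t * \<kappa> * (blinfun_apply \<alpha> y - blinfun_apply \<alpha> x - t)"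
proof -
  define \<kappa> where "\<kappa> = blinfun_apply (root_sum (cv \<alpha>)) (cv \<alpha>)"
  note r = root_sum_coroot[OF \<alpha>]
  have half: "2 * (\<Sum>\<beta>\<in>\<Phi>. blinfun_apply \<beta> (cv \<alpha>) * blinfun_apply \<beta> z) = \<kappa> * blinfun_apply \<alpha> z" for z
    using arg_cong[OF r(1), of "\<lambda>f. blinfun_apply f z"]
    by (simp add: blinfun.scaleR_left root_sum_apply[symmetric] \<kappa>_def)
  have "root_dist x (y - t *\<^sub>R cv \<alpha>) = root_dist x y - t * \<kappa> * (blinfun_apply \<alpha> y - blinfun_apply \<alpha> x - t)" for x y t
  proof -
    have "root_dist x (y - t *\<^sub>R cv \<alpha>) = (\<Sum>\<beta>\<in>\<Phi>. (blinfun_apply \<beta> y - blinfun_apply \<beta> x)\<^sup>2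
        - t * (2 * (blinfun_apply \<beta> (cv \<alpha>) * blinfun_apply \<beta> (y - x))) + t\<^sup>2 * (blinfun_apply \<beta> (cv \<alpha>) * blinfun_apply \<beta> (cv \<alpha>)))"
      unfolding root_dist_def
      by (intro sum.cong refl) (simp add: blinfun.diff_right blinfun.scaleR_right power2_eq_square algebra_simps)
    also have "\<dots> = root_dist x y - t * (2 * (\<Sum>\<beta>\<in>\<Phi>. blinfun_apply \<beta> (cv \<alpha>) * blinfun_apply \<beta> (y - x)))
       + t\<^sup>2 * (\<Sum>\<beta>\<in>\<Phi>. blinfun_apply \<beta> (cv \<alpha>) * blinfun_apply \<beta> (cv \<alpha>))"
      by (simp add: root_dist_def sum.distrib sum_subtractf sum_distrib_left)
    also have "(\<Sum>\<beta>\<in>\<Phi>. blinfun_apply \<beta> (cv \<alpha>) * blinfun_apply \<beta> (cv \<alpha>)) = \<kappa>"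
      using half[of "cv \<alpha>"] \<alpha> by simp
    also have "root_dist x y - t * (2 * (\<Sum>\<beta>\<in>\<Phi>. blinfun_apply \<beta> (cv \<alpha>) * blinfun_apply \<beta> (y - x))) + t\<^sup>2 * \<kappa>
        = root_dist x y - t * \<kappa> * (blinfun_apply \<alpha> y - blinfun_apply \<alpha> x - t)"
      unfolding half by (simp add: blinfun.diff_right power2_eq_square algebra_simps)
    finally show ?thesis .
  qed
  then show ?thesis using that r(2) \<kappa>_def by blast
qed

lemma cochars_0: "0 \<in> cochars D"
proof -
  have "full_lattice (cochars D)" using reduced by (simp add: reduced_root_datum_def)
  then obtain B where "cochars D = int_span B" by (auto simp: full_lattice_def)
  then show ?thesis unfolding int_span_def by (auto intro!: exI[of _ "\<lambda>_. 0"])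
qed

text \<open>
  The translations are those cocharacters that \<open>p\<^sub>G\<close> kills.
\<close>

definition affine_orbit :: "'v \<Rightarrow> 'v set" where
  "affine_orbit y = {\<mu> + w y | \<mu> w. \<mu> \<in> cochars D \<and> \<mu> \<in> span (coroots D) \<and> w \<in> W}"

lemma affine_orbit_reflect:
  assumes z: "z \<in> affine_orbit y" and \<alpha>: "\<alpha> \<in> \<Phi>"
  shows "z - (blinfun_apply \<alpha> z - of_int m) *\<^sub>R cv \<alpha> \<in> affine_orbit y"
proof -
  obtain \<mu> w where z: "z = \<mu> + w y" "\<mu> \<in> cochars D" "\<mu> \<in> span (coroots D)" "w \<in> W"
    using z by (auto simp: affine_orbit_def)
  let ?\<mu>' = "reflect \<alpha> \<mu> + of_int m *\<^sub>R cv \<alpha>"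
  have "z - (blinfun_apply \<alpha> z - of_int m) *\<^sub>R cv \<alpha> = ?\<mu>' + (reflect \<alpha> \<circ> w) y"
    using z by (simp add: reflection_def blinfun.add_right algebra_simps)
  moreover have "?\<mu>' \<in> cochars D"
    using weyl_cochars[OF weyl_reflect[OF \<alpha>] z(2)] cochars_scale[OF coroot_cochars[OF \<alpha>]] by (rule cochars_add)
  moreover have "cv \<alpha> \<in> span (coroots D)" using \<alpha> by (auto simp: coroots_def intro: span_base)
  then have "?\<mu>' \<in> span (coroots D)"
    using weyl_span_coroots[OF weyl_reflect[OF \<alpha>] z(3)] by (intro span_add span_scale)
  moreover have "reflect \<alpha> \<circ> w \<in> W" using weyl_group.step[OF \<alpha> z(4)] .
  ultimately show ?thesis unfolding affine_orbit_def by blast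
qed

text \<open>
  On an orbit the roots take values in finitely many cosets of \<open>\<int>\<close>, so the distance from \<open>x\<close> has only
  finitely many values below any bound and attains a minimum.
\<close>

lemma finite_root_dist_values: "finite {root_dist x z | z. z \<in> affine_orbit y \<and> root_dist x z \<le> R}"
proof -
  \<comment> \<open>A bound for the absolute values of the roots at \<open>z\<close>; \<open>F\<close> collects the values that remain possible.\<close>
  define K where "K = (\<Sum>\<beta>\<in>\<Phi>. \<bar>blinfun_apply \<beta> x\<bar>) + R + 1"
  define F where "F = (\<Union>\<beta>\<in>\<Phi>. (\<lambda>n::int. of_int n + blinfun_apply \<beta> y) ` {n. \<bar>real_of_int n\<bar> \<le> K + \<bar>blinfun_apply \<beta> y\<bar>})"
  have "finite {n::int. \<bar>real_of_int n\<bar> \<le> c}" for c :: real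
  proof (rule finite_subset)
    show "{n::int. \<bar>real_of_int n\<bar> \<le> c} \<subseteq> {- \<lceil>c\<rceil>..\<lceil>c\<rceil>}"
      by (auto simp: abs_le_iff le_ceiling_iff) linarith+
  qed simp
  then have finF: "finite F" unfolding F_def using finite_roots by blast
  have "{root_dist x z | z. z \<in> affine_orbit y \<and> root_dist x z \<le> R}
      \<subseteq> (\<lambda>h. \<Sum>\<beta>\<in>\<Phi>. (h \<beta> - blinfun_apply \<beta> x)\<^sup>2) ` (PiE \<Phi> (\<lambda>_. F))"
  proof
    fix q assume "q \<in> {root_dist x z | z. z \<in> affine_orbit y \<and> root_dist x z \<le> R}"
    then obtain z where z: "q = root_dist x z" "z \<in> affine_orbit y" "root_dist x z \<le> R" by blast
    obtain \<mu> w where w: "z = \<mu> + w y" "\<mu> \<in> cochars D" "w \<in> W"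
      using z by (auto simp: affine_orbit_def)
    have "blinfun_apply \<beta> z \<in> F" if \<beta>: "\<beta> \<in> \<Phi>" for \<beta>
    proof -
      have "(blinfun_apply \<beta> z - blinfun_apply \<beta> x)\<^sup>2 \<le> root_dist x z"
        unfolding root_dist_def by (rule member_le_sum[OF \<beta> _ finite_roots]) simp
      then have "(blinfun_apply \<beta> z - blinfun_apply \<beta> x)\<^sup>2 \<le> R" using z(3) by linarith
      moreover have "\<bar>t\<bar> \<le> t\<^sup>2 + 1" for t :: real
        using zero_le_power2[of "\<bar>t\<bar> - 1"] by (simp add: power2_eq_square algebra_simps)
      ultimately have "\<bar>blinfun_apply \<beta> z - blinfun_apply \<beta> x\<bar> \<le> R + 1" by (meson add_right_mono order_trans)
      moreover have "\<bar>blinfun_apply \<beta> x\<bar> \<le> (\<Sum>\<beta>\<in>\<Phi>. \<bar>blinfun_apply \<beta> x\<bar>)"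
        by (rule member_le_sum[OF \<beta> _ finite_roots]) simp
      ultimately have K: "\<bar>blinfun_apply \<beta> z\<bar> \<le> K" unfolding K_def by linarith
      obtain n :: int where n: "blinfun_apply \<beta> \<mu> = n" using root_apply_int[OF \<beta> w(2)] by (elim Ints_cases)
      have e: "blinfun_apply \<beta> z = of_int n + blinfun_apply (pull w \<beta>) y"
        using w(3) by (simp add: w(1) blinfun.add_right n)
      then have "\<bar>real_of_int n\<bar> \<le> K + \<bar>blinfun_apply (pull w \<beta>) y\<bar>" using K by linarith
      then show ?thesis unfolding F_def e using pull_root[OF w(3) \<beta>] by blast
    qed
    then have "restrict (\<lambda>\<beta>. blinfun_apply \<beta> z) \<Phi> \<in> PiE \<Phi> (\<lambda>_. F)" by auto
    then show "q \<in> (\<lambda>h. \<Sum>\<beta>\<in>\<Phi>. (h \<beta> - blinfun_apply \<beta> x)\<^sup>2) ` (PiE \<Phi> (\<lambda>_. F))"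
      by (rule rev_image_eqI) (simp add: z(1) root_dist_def)
  qed
  then show ?thesis
    by (rule finite_subset) (intro finite_imageI finite_PiE finite_roots finF)
qed

text \<open>
  A point of the orbit nearest to a given point of the alcove lies in the alcove: reflecting in a hyperplane
  \<open>\<alpha> = 0\<close> or \<open>\<alpha> = 1\<close> that separates it from the alcove would bring it nearer.
\<close>

lemma orbit_meets_alcove:
  assumes y: "y \<in> regular_points D"
  shows "\<exists>z\<in>affine_orbit y. z \<in> alcove"
proof -
  obtain x where x: "x \<in> alcove" using alcove_nonempty by blast
  have "y = 0 + id y" by simp
  then have "y \<in> affine_orbit y"
    unfolding affine_orbit_def using cochars_0 weyl_group.one span_zero by blast
  define Q where "Q = {root_dist x z | z. z \<in> affine_orbit y \<and> root_dist x z \<le> root_dist x y}"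
  have "finite Q" unfolding Q_def by (rule finite_root_dist_values)
  moreover have "Q \<noteq> {}" using \<open>y \<in> affine_orbit y\<close> by (auto simp: Q_def)
  ultimately have "Min Q \<in> Q" by (rule Min_in)
  then obtain z where z: "z \<in> affine_orbit y" "root_dist x z = Min Q" "root_dist x z \<le> root_dist x y"
    by (auto simp: Q_def)
  have least: "root_dist x z \<le> root_dist x z'" if "z' \<in> affine_orbit y" for z'
  proof (cases "root_dist x z' \<le> root_dist x y")
    case True
    then show ?thesis unfolding z(2) using that \<open>finite Q\<close> by (intro Min_le) (auto simp: Q_def)
  next
    case False
    then show ?thesis using z(3) by linarith
  qed
  have zreg: "z \<in> regular_points D"
    using z(1) regular_affine y by (auto simp: affine_orbit_def)
  have wall: "False" if \<alpha>: "\<alpha> \<in> pos" and sep: "(blinfun_apply \<alpha> z - of_int m) * (of_int m - blinfun_apply \<alpha> x) > 0" for \<alpha> m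
  proof -
    obtain \<kappa> where \<kappa>: "\<kappa> > 0"
      "root_dist x (z - (blinfun_apply \<alpha> z - of_int m) *\<^sub>R cv \<alpha>)
        = root_dist x z - (blinfun_apply \<alpha> z - of_int m) * \<kappa> * (blinfun_apply \<alpha> z - blinfun_apply \<alpha> x - (blinfun_apply \<alpha> z - of_int m))"
      using root_dist_shift[OF pos_root[OF \<alpha>]] by metis
    have "0 < \<kappa> * ((blinfun_apply \<alpha> z - of_int m) * (of_int m - blinfun_apply \<alpha> x))"
      using \<kappa>(1) sep by (rule mult_pos_pos)
    then have "root_dist x (z - (blinfun_apply \<alpha> z - of_int m) *\<^sub>R cv \<alpha>) < root_dist x z"
      unfolding \<kappa>(2) by (simp add: algebra_simps)
    then show False using least[OF affine_orbit_reflect[OF z(1) pos_root[OF \<alpha>]]] by (meson not_le)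
  qed
  have "0 < blinfun_apply \<alpha> z \<and> blinfun_apply \<alpha> z < 1" if \<alpha>: "\<alpha> \<in> pos" for \<alpha>
  proof -
    have xa: "0 < blinfun_apply \<alpha> x" "blinfun_apply \<alpha> x < 1" using x \<alpha> by (auto simp: alcove_def)
    have ne: "blinfun_apply \<alpha> z \<noteq> 0" "blinfun_apply \<alpha> z \<noteq> 1"
      using zreg pos_root[OF \<alpha>] by (force simp: regular_iff)+
    have "\<not> blinfun_apply \<alpha> z < 0"
      using wall[OF \<alpha>, of 0] xa by (auto simp: mult_neg_pos)
    moreover have "\<not> blinfun_apply \<alpha> z > 1"
      using wall[OF \<alpha>, of 1] xa by auto
    ultimately show ?thesis using ne by linarith
  qed
  then show ?thesis using z(1) by (auto simp: alcove_def)
qed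

section \<open>The alcove stabilizer\<close>

lemma p_G_eqI:
  assumes "\<And>\<alpha>. \<alpha> \<in> \<Phi> \<Longrightarrow> blinfun_apply \<alpha> y = 0" "x - y \<in> span (coroots D)"
  shows "p_G D x = y"
  unfolding p_G_def levi_proj_def I_def[symmetric] span_simple_coroots
proof (rule the_equality)
  show "y \<in> levi_space D I \<and> x - y \<in> span (coroots D)"
    using assms by (simp add: levi_space_def)
next
  fix z assume z: "z \<in> levi_space D I \<and> x - z \<in> span (coroots D)"
  have "(x - y) - (x - z) \<in> span (coroots D)" using assms(2) z by (blast intro: span_diff)
  moreover have "blinfun_apply \<alpha> z = 0" if \<alpha>: "\<alpha> \<in> pos" for \<alpha>
  proof -
    obtain c :: "nat \<Rightarrow> nat" where "\<alpha> = (\<Sum>i\<in>I. real (c i) *\<^sub>R sr i)" using \<alpha> by (auto simp: pos_def)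
    then show ?thesis using z by (simp add: levi_space_def blinfun.sum_left blinfun.scaleR_left)
  qed
  then have "blinfun_apply \<alpha> z = 0" if "\<alpha> \<in> \<Phi>" for \<alpha>
    using pos_or_neg[OF that] by (force simp: blinfun.minus_left)
  ultimately have "(x - y) - (x - z) = 0"
    using assms(1) by (intro span_coroots_eq_0) (simp_all add: blinfun.diff_right)
  then show "z = y" by simp
qed

lemma p_G_eq: "p_G D x = central_part x"
  using p_G_eqI root_central_part diff_central_part by blast

lemma root_p_G: "\<alpha> \<in> \<Phi> \<Longrightarrow> blinfun_apply \<alpha> (p_G D x) = 0"
  by (simp add: p_G_eq root_central_part)

lemma diff_p_G: "x - p_G D x \<in> span (coroots D)"
  by (simp add: p_G_eq diff_central_part)

lemma p_G_affine:
  assumes "\<mu> \<in> span (coroots D)" "w \<in> W"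
  shows "p_G D (\<mu> + w x) = p_G D x"
proof (rule p_G_eqI)
  have "(\<mu> + w x) - p_G D x = \<mu> + (w x - x) + (x - p_G D x)" by simp
  also have "\<dots> \<in> span (coroots D)" using assms weyl_diff diff_p_G by (intro span_add) auto
  finally show "(\<mu> + w x) - p_G D x \<in> span (coroots D)" .
qed (rule root_p_G)

lemma alcove_stabilizer_iff:
  "(\<mu>, w) \<in> alcove_stabilizer D \<longleftrightarrow> \<mu> \<in> cochars D \<and> w \<in> W \<and> (\<lambda>x. \<mu> + w x) ` alcove = alcove"
  by (simp add: alcove_stabilizer_def ext_affine_weyl_def base_alcove_eq aff_action_def[abs_def])

text \<open>
  Translation by a lift \<open>\<mu>\<close> of \<open>\<nu>\<close> moves the base alcove to another alcove, and an element of the affine Weyl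
  group, whose image in \<open>\<Lambda>\<^sub>G\<close> is trivial, moves it back.
\<close>

lemma exists_stabilizer:
  assumes "\<nu> \<in> Lambda_G D"
  obtains \<mu> w where "(\<mu>, w) \<in> alcove_stabilizer D" "p_G D \<mu> = \<nu>"
proof -
  obtain \<mu> where \<mu>: "\<mu> \<in> cochars D" "p_G D \<mu> = \<nu>" using assms by (auto simp: Lambda_G_def)
  obtain x where x: "x \<in> alcove" using alcove_nonempty by blast
  have "\<mu> + id x \<in> regular_points D"
    using regular_affine[OF \<mu>(1) weyl_group.one] x alcove_regular by blast
  then obtain z where "z \<in> affine_orbit (\<mu> + x)" "z \<in> alcove" using orbit_meets_alcove by auto
  then obtain \<tau> w where w: "\<tau> \<in> cochars D" "\<tau> \<in> span (coroots D)" "w \<in> W" "\<tau> + w (\<mu> + x) \<in> alcove"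
    by (auto simp: affine_orbit_def)
  have c: "\<tau> + w \<mu> \<in> cochars D" using w \<mu> weyl_cochars cochars_add by blast
  have "(\<tau> + w \<mu>) + w x \<in> alcove" using w(4) weyl_linear[OF w(3)] by (simp add: linear_add add.assoc)
  then have "(\<lambda>y. (\<tau> + w \<mu>) + w y) ` alcove = alcove" by (rule affine_alcove_eq[OF c w(3) x])
  then have "(\<tau> + w \<mu>, w) \<in> alcove_stabilizer D" using c w(3) by (simp only: alcove_stabilizer_iff simp_thms)
  moreover have "p_G D (\<tau> + w \<mu>) = \<nu>" using p_G_affine[OF w(2,3)] \<mu>(2) by simp
  ultimately show ?thesis by (rule that)
qed

lemma alcove_cong:
  assumes "x \<in> alcove" "\<And>\<alpha>. \<alpha> \<in> \<Phi> \<Longrightarrow> blinfun_apply \<alpha> x = blinfun_apply \<alpha> y"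
  shows "y \<in> alcove"
  using assms pos_root by (auto simp: alcove_def)

end

context weighted_datum
begin

text \<open>
  The map \<open>a : x \<mapsto> \<tau> + u x\<close> has finite order: a power of it is the translation by a vector of \<open>V\<close>
  that preserves the alcove, and the alcove is bounded in the directions of \<open>V\<close>.  So the barycentre of an
  orbit in the alcove is a fixed point.
\<close>

lemma alcove_fixed_point:
  assumes u: "u \<in> W" and \<tau>: "\<tau> \<in> V" and pres: "\<And>x. x \<in> alcove \<Longrightarrow> \<tau> + u x \<in> alcove"
  obtains b where "b \<in> alcove" "b = \<tau> + u b"
proof -
  define a where "a x = \<tau> + u x" for x
  obtain N where N: "N > 0" "\<And>x. (u ^^ N) x = x" using weyl_finite_order[OF u] by blast
  \<comment> \<open>The translation part of the \<open>n\<close>-th power of \<open>a\<close>.\<close>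
  define \<sigma> where "\<sigma> n = (\<Sum>k<n. (u ^^ k) \<tau>)" for n
  have an: "(a ^^ n) x = \<sigma> n + (u ^^ n) x" for n x
  proof (induction n arbitrary: x)
    case 0
    then show ?case by (simp add: \<sigma>_def)
  next
    case (Suc n)
    have "(a ^^ Suc n) x = (a ^^ n) (a x)" by (simp only: funpow_Suc_right comp_apply)
    also have "\<dots> = \<sigma> n + (u ^^ n) \<tau> + (u ^^ n) (u x)"
      using weyl_linear[OF weyl_funpow[OF u]] by (simp add: Suc a_def[of x] linear_add)
    also have "(u ^^ n) (u x) = (u ^^ Suc n) x" by (simp only: funpow_Suc_right comp_apply)
    finally show ?case by (simp add: \<sigma>_def)
  qed
  have pow: "(a ^^ n) x \<in> alcove" if "x \<in> alcove" for n x
    using that by (induction n) (simp_all add: a_def pres)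
  obtain x where x: "x \<in> alcove" using alcove_nonempty by blast
  have tr: "x + real m *\<^sub>R \<sigma> N \<in> alcove" for m
  proof (induction m)
    case 0
    then show ?case using x by simp
  next
    case (Suc m)
    show ?case using pow[OF Suc, of N] by (simp add: an N(2) algebra_simps)
  qed
  have "\<sigma> N \<in> V"
    unfolding \<sigma>_def using weyl_span_coroots[OF weyl_funpow[OF u] \<tau>] by (intro span_sum)
  moreover have pos0: "blinfun_apply \<alpha> (\<sigma> N) = 0" if \<alpha>: "\<alpha> \<in> pos" for \<alpha>
  proof (rule ccontr)
    assume ne: "blinfun_apply \<alpha> (\<sigma> N) \<noteq> 0"
    obtain m :: nat where m: "1 < real m * \<bar>blinfun_apply \<alpha> (\<sigma> N)\<bar>"
      using ex_less_of_nat_mult[of "\<bar>blinfun_apply \<alpha> (\<sigma> N)\<bar>" 1] ne by auto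
    have "0 < blinfun_apply \<alpha> x" "blinfun_apply \<alpha> x < 1" using x \<alpha> by (auto simp: alcove_def)
    moreover have "0 < blinfun_apply \<alpha> x + real m * blinfun_apply \<alpha> (\<sigma> N)"
      "blinfun_apply \<alpha> x + real m * blinfun_apply \<alpha> (\<sigma> N) < 1"
      using tr[of m] \<alpha> by (auto simp: alcove_def blinfun.add_right blinfun.scaleR_right)
    moreover have "\<bar>real m * blinfun_apply \<alpha> (\<sigma> N)\<bar> > 1" using m by (simp add: abs_mult)
    ultimately show False by linarith
  qed
  then have "blinfun_apply \<alpha> (\<sigma> N) = 0" if "\<alpha> \<in> \<Phi>" for \<alpha>
    using pos_or_neg[OF that] by (force simp: blinfun.minus_left)
  ultimately have "\<sigma> N = 0" by (rule span_coroots_eq_0)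
  then have aN: "(a ^^ N) x = x" by (simp add: an N(2))
  define b where "b = (\<Sum>k<N. (1 / real N) *\<^sub>R (a ^^ k) x)"
  have "b \<in> alcove" unfolding b_def
    by (rule convex_sum[OF _ convex_alcove]) (use N(1) pow[OF x] in auto)
  moreover have "b = \<tau> + u b"
  proof -
    have "\<tau> + u b = (\<Sum>k<N. (1 / real N) *\<^sub>R \<tau>) + (\<Sum>k<N. (1 / real N) *\<^sub>R u ((a ^^ k) x))"
      using N(1) weyl_linear[OF u] by (simp add: b_def linear_sum linear_scale sum_constant_scaleR)
    also have "\<dots> = (\<Sum>k<N. (1 / real N) *\<^sub>R (a ^^ Suc k) x)"
      by (simp add: sum.distrib[symmetric] scaleR_add_right[symmetric] a_def)
    also have "\<dots> = b"
    proof -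
      have "(1 / real N) *\<^sub>R (a ^^ 0) x + (\<Sum>k<N. (1 / real N) *\<^sub>R (a ^^ Suc k) x) = (\<Sum>k<Suc N. (1 / real N) *\<^sub>R (a ^^ k) x)"
        by (rule sum.lessThan_Suc_shift[symmetric])
      also have "\<dots> = b + (1 / real N) *\<^sub>R x" by (simp only: sum.lessThan_Suc b_def aN)
      finally show ?thesis by simp
    qed
    finally show ?thesis ..
  qed
  ultimately show ?thesis by (rule that)
qed

text \<open>
  An alcove-preserving element of \<open>W\<^sub>e\<^sub>x\<^sub>t\<close> acts on the orbit forms at a fixed point through scalars that depend
  only on its image in \<open>\<Lambda>\<^sub>G\<close>.
\<close>

lemma stabilizer_eigenforms:
  assumes \<mu>: "\<mu> \<in> cochars D" and u: "u \<in> W" and pres: "\<And>x. x \<in> alcove \<Longrightarrow> \<mu> + u x \<in> alcove"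
  shows "\<exists>b\<in>alcove. b = (\<mu> - p_G D \<mu>) + u b \<and>
    (\<forall>i<l. \<forall>v. orbit_form i b (u v) = expi (- blinfun_apply (om i) (p_G D \<mu>)) * orbit_form i b v)"
proof -
  let ?\<tau> = "\<mu> - p_G D \<mu>"
  have "?\<tau> + u x \<in> alcove" if "x \<in> alcove" for x
    by (rule alcove_cong[OF pres[OF that]])
       (simp add: blinfun.add_right blinfun.diff_right root_p_G)
  then obtain b where b: "b \<in> alcove" "b = ?\<tau> + u b"
    using alcove_fixed_point[OF u diff_p_G] by blast
  have int: "blinfun_apply (om i) (w ?\<tau>) + blinfun_apply (om i) (p_G D \<mu>) \<in> \<int>" if "w \<in> W" "i < l" for w i
  proof -
    have "w (p_G D \<mu>) = p_G D \<mu>"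
      using weyl_fixes_root_kernel[OF that(1)] root_p_G by blast
    then have "blinfun_apply (om i) (w ?\<tau>) + blinfun_apply (om i) (p_G D \<mu>) = blinfun_apply (om i) (w \<mu>)"
      using weyl_linear[OF that(1)] by (simp add: linear_diff blinfun.diff_right)
    then show ?thesis using om_chars[OF that(2)] weyl_cochars[OF that(1) \<mu>] by (simp add: chars_def)
  qed
  have "orbit_form i b (u v) = expi (- blinfun_apply (om i) (p_G D \<mu>)) * orbit_form i b v" if "i < l" for i v
    using orbit_form_eigen[OF u b(2) that] int[OF _ that] by blast
  with b show ?thesis by blast
qed

text \<open>
  The quotient \<open>x \<mapsto> \<tau> + h x\<close> of two elements with the same image lies in the kernel, so its eigenvalues on
  the orbit forms are trivial.  These forms separate the points of \<open>V\<close>, whence \<open>h = 1\<close>, and a translation with a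
  fixed point is trivial.
\<close>

lemma kottwitz_hom_inj: "inj_on (kottwitz_hom D) (alcove_stabilizer D)"
proof (rule inj_onI, clarsimp simp: kottwitz_hom_def alcove_stabilizer_iff)
  fix \<mu>1 \<mu>2 and u1 u2 :: "'v \<Rightarrow> 'v"
  assume g1: "\<mu>1 \<in> cochars D" "u1 \<in> W" "(\<lambda>x. \<mu>1 + u1 x) ` alcove = alcove"
    and g2: "\<mu>2 \<in> cochars D" "u2 \<in> W" "(\<lambda>x. \<mu>2 + u2 x) ` alcove = alcove"
    and eq: "p_G D \<mu>1 = p_G D \<mu>2"
  define \<tau> where "\<tau> = winv u1 (\<mu>2 - \<mu>1)"
  define h where "h = winv u1 \<circ> u2"
  have inv1: "winv u1 \<in> W" by (rule weyl_inv[OF g1(2)])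
  have h: "h \<in> W" unfolding h_def by (rule weyl_comp[OF inv1 g2(2)])
  have "(\<mu>2 - p_G D \<mu>2) - (\<mu>1 - p_G D \<mu>1) \<in> V" by (intro span_diff diff_p_G)
  then have "\<mu>2 - \<mu>1 \<in> V" by (simp add: eq)
  then have "\<tau> \<in> V" unfolding \<tau>_def by (rule weyl_span_coroots[OF inv1])
  then have p0: "p_G D \<tau> = 0" by (intro p_G_eqI) simp_all
  have "\<tau> \<in> cochars D" unfolding \<tau>_def using weyl_cochars[OF inv1 cochars_diff] g1 g2 by blast
  moreover have "\<tau> + h x \<in> alcove" if x: "x \<in> alcove" for x
  proof -
    have "\<mu>2 + u2 x \<in> (\<lambda>x. \<mu>1 + u1 x) ` alcove" using g1(3) g2(3) x by blast
    then obtain y where y: "y \<in> alcove" "\<mu>2 + u2 x = \<mu>1 + u1 y" by blast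
    then have "u1 y = (\<mu>2 - \<mu>1) + u2 x" by (simp add: algebra_simps)
    then have "winv u1 (u1 y) = winv u1 ((\<mu>2 - \<mu>1) + u2 x)" by (rule arg_cong)
    then have "y = \<tau> + h x"
      using g1(2) weyl_linear[OF inv1] by (simp add: \<tau>_def h_def linear_add)
    then show ?thesis using y(1) by simp
  qed
  ultimately obtain b where b: "b \<in> alcove" "b = (\<tau> - p_G D \<tau>) + h b"
    and eig: "\<And>i v. i < l \<Longrightarrow> orbit_form i b (h v) = expi (- blinfun_apply (om i) (p_G D \<tau>)) * orbit_form i b v"
    using stabilizer_eigenforms[OF _ h] by blast
  have hx: "h x = x" for x
  proof -
    have "h x - x = 0"
    proof (rule orbit_forms_separate[of b])
      show "b \<in> regular_points D" using b(1) alcove_regular by blast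
      show "h x - x \<in> V" by (rule weyl_diff[OF h])
      show "orbit_form i b (h x - x) = 0" if "i < l" for i
        using eig[OF that] by (simp add: orbit_form_diff p0)
    qed
    then show ?thesis by simp
  qed
  have "\<tau> = 0" using b(2) by (simp add: hx p0)
  then have "u1 \<tau> = 0" using weyl_linear[OF g1(2)] by (simp add: linear_0)
  then have "\<mu>1 = \<mu>2" using g1(2) by (simp add: \<tau>_def)
  moreover have "u1 = u2"
  proof
    fix x
    have "u1 (h x) = u2 x" using g1(2) by (simp add: h_def)
    then show "u1 x = u2 x" by (simp add: hx)
  qed
  ultimately show "\<mu>1 = \<mu>2 \<and> u1 = u2" by simp
qed

lemma sum_frac_eq_half_defect:
  assumes "\<nu> \<in> Lambda_G D"
  shows "(\<Sum>i=1..l. frac (blinfun_apply (\<omega> i) \<nu>)) = (1 / 2) * of_int (defect D \<nu>)"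
proof -
  obtain \<mu> u where g: "(\<mu>, u) \<in> alcove_stabilizer D" and \<nu>: "p_G D \<mu> = \<nu>"
    by (rule exists_stabilizer[OF assms])
  have "alcove_section D \<nu> = (\<mu>, u)"
    unfolding alcove_section_def
    by (rule the_inv_into_f_eq[OF kottwitz_hom_inj _ g]) (simp add: kottwitz_hom_def \<nu>)
  then have w: "w_of D \<nu> = u" by (simp add: w_of_def)
  have g': "\<mu> \<in> cochars D" "u \<in> W" "\<And>x. x \<in> alcove \<Longrightarrow> \<mu> + u x \<in> alcove"
    using g by (auto simp: alcove_stabilizer_iff)
  obtain b where b: "b \<in> alcove" "b = (\<mu> - p_G D \<mu>) + u b"
    and eig: "\<And>i v. i < l \<Longrightarrow> orbit_form i b (u v) = expi (- blinfun_apply (om i) (p_G D \<mu>)) * orbit_form i b v"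
    using stabilizer_eigenforms[OF g'] by blast
  have "b \<in> regular_points D" using b(1) alcove_regular by blast
  then have "(\<Sum>i = 0..<l. frac (blinfun_apply (om i) \<nu>)) = (1 / 2) * (real (dim (UNIV :: 'v set)) - real (dim {x. u x = x}))"
    by (rule sum_frac_eq_half_codim[OF _ g'(2)]) (simp add: eig \<nu>)
  moreover have "(\<Sum>i=1..l. frac (blinfun_apply (\<omega> i) \<nu>)) = (\<Sum>i = 0..<l. frac (blinfun_apply (om i) \<nu>))"
    by (simp only: om_def I_eq[unfolded I_def] sum.reindex[OF inj_Suc] comp_def)
  ultimately show ?thesis by (simp add: defect_def w)
qed

lemma Lambda_G_subset_Newton_set: "Lambda_G D \<subseteq> Newton_set D"
proof -
  have "Lambda_G D = Lambda_plus D {1..l}"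
    unfolding Lambda_plus_def Lambda_G_def p_G_def Diff_cancel by simp
  then show ?thesis unfolding Newton_set_def by blast
qed

end

theorem theorem1p9p2:
  fixes D :: "'v::real_normed_vector based_root_datum"
    and \<omega> :: "nat \<Rightarrow> ('v \<Rightarrow>\<^sub>L real)"
    and \<nu> :: 'v
  assumes "reduced_root_datum D"
    and "simple_system D"
    and "simply_connected_derived_group D"
    and "extends_fundamental_weights D \<omega>"
    and "\<nu> \<in> Lambda_G D"
  shows "d_G D \<omega> \<nu> = (1 / 2) * of_int (defect D \<nu>) \<and>
         (\<exists>k::int. d_G D \<omega> \<nu> = of_int k / 2)"
proof -
  interpret weighted_datum D \<omega>
    using assms by unfold_locales
  have "\<nu> \<in> Newton_set D" using assms(5) Lambda_G_subset_Newton_set by blast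
  then have "d_G D \<omega> \<nu> = (1 / 2) * of_int (defect D \<nu>)"
    using sum_frac_eq_half_defect[OF assms(5)] by (simp add: d_G_def)
  then show ?thesis by (auto intro!: exI[of _ "defect D \<nu>"])
qed

end
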